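(* Let $T_{\mathrm{con}}^{\mathsf{BF}}$ be the smallest $N$ for which the graph $G_N^{\mathsf{BF}}$ of the Bohman-Frieze process on $n$ vertices is connected, let $\gamma=0.577\ldots$ be the Euler-Mascheroni constant, and let $\varphi=(1+\sqrt5)/2$. Then $$\mathbb E[T_{\mathrm{con}}^{\mathsf{BF}}]=\frac{n\log n}{2}+\left(\frac{\gamma}{2}-\frac{\log\varphi}{\sqrt5}\right)n+o(n),$$ and for all $c\in\mathbb R$, $$\lim_{n\to\infty}\Pr\left[T_{\mathrm{con}}^{\mathsf{BF}}\le\frac{n\log n+cn}{2}\right]=\exp\{-\varphi^{-2/\sqrt5}e^{-c}\}.$$ Moreover, with probability tending to $1$ as $n\to\infty$, $G_N^{\mathsf{BF}}$ becomes connected exactly at the round in which the last isolated vertex disappears.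
   Context: $\log$ is the natural logarithm. The Bohman-Frieze process on $n$ vertices is the random graph sequence $(G_N^{\mathsf{BF}})_{N\ge0}$ on vertex set $\{1,\dots,n\}$ where $G_0^{\mathsf{BF}}$ has no edges, and in each round four vertices $v_1,v_2,v_3,v_4$ are chosen independently and uniformly at random (repetitions allowed); if both $v_1$ and $v_2$ are isolated vertices in the current graph, the edge $\{v_1,v_2\}$ is added, otherwise the edge $\{v_3,v_4\}$ is added. Loops and multiple edges are ignored. *)

theory Defs
  imports "HOL-Probability.Probability" "HOL-Library.Landau_Symbols"
begin

text \<open>A simple graph on the vertex set \<open>{1..n}\<close> is represented by its set of edges, each edge
  being a two-element set of vertices.\<close>

definition isolated :: "nat set set \<Rightarrow> nat \<Rightarrow> bool" where
  "isolated E v \<longleftrightarrow> (\<forall>e\<in>E. v \<notin> e)"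

definition graph_connected :: "nat \<Rightarrow> nat set set \<Rightarrow> bool" where
  "graph_connected n E \<longleftrightarrow> (\<forall>u\<in>{1..n}. \<forall>v\<in>{1..n}. (u, v) \<in> {(x, y). {x, y} \<in> E}\<^sup>*)"

definition add_edge :: "nat \<Rightarrow> nat \<Rightarrow> nat set set \<Rightarrow> nat set set" where
  "add_edge u v E = (if u = v then E else insert {u, v} E)"

definition BF_step :: "nat \<Rightarrow> nat \<Rightarrow> nat \<Rightarrow> nat \<Rightarrow> nat set set \<Rightarrow> nat set set" where
  "BF_step v1 v2 v3 v4 E =
     (if isolated E v1 \<and> isolated E v2 then add_edge v1 v2 E else add_edge v3 v4 E)"

text \<open>The four vertices chosen in the round leading from \<open>G\<^sub>N\<close> to \<open>G\<^sub>N\<^sub>+\<^sub>1\<close> are the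
  coordinates \<open>(N, 1), \<dots>, (N, 4)\<close> of a sample point; all coordinates are independent and uniformly
  distributed on \<open>{1..n}\<close>. This is a probability space for \<open>n \<ge> 1\<close>.\<close>

definition BF_space :: "nat \<Rightarrow> (nat \<times> nat \<Rightarrow> nat) measure" where
  "BF_space n = (\<Pi>\<^sub>M i\<in>UNIV \<times> {1..4}. uniform_count_measure {1..n})"

primrec BF_graph :: "(nat \<times> nat \<Rightarrow> nat) \<Rightarrow> nat \<Rightarrow> nat set set" where
  "BF_graph \<omega> 0 = {}"
| "BF_graph \<omega> (Suc N) =
     BF_step (\<omega> (N, 1)) (\<omega> (N, 2)) (\<omega> (N, 3)) (\<omega> (N, 4)) (BF_graph \<omega> N)"

text \<open>Both times are \<open>\<infinity>\<close> (the infimum of the empty set) if the event never happens.\<close>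

definition BF_T_con :: "nat \<Rightarrow> (nat \<times> nat \<Rightarrow> nat) \<Rightarrow> enat" where
  "BF_T_con n \<omega> = Inf (enat ` {N. graph_connected n (BF_graph \<omega> N)})"

text \<open>Edges are never removed, so the last isolated vertex disappears in the first round after which
  there is no isolated vertex.\<close>

definition BF_T_iso :: "nat \<Rightarrow> (nat \<times> nat \<Rightarrow> nat) \<Rightarrow> enat" where
  "BF_T_iso n \<omega> = Inf (enat ` {N. \<forall>v\<in>{1..n}. \<not> isolated (BF_graph \<omega> N) v})"

definition BF_expected_T_con :: "nat \<Rightarrow> ennreal" where
  "BF_expected_T_con n = (\<integral>\<^sup>+ \<omega>. ennreal_of_enat (BF_T_con n \<omega>) \<partial>BF_space n)"

definition golden_ratio :: real where
  "golden_ratio = (1 + sqrt 5) / 2"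

end

theory Submission
  imports Defs "HOL-Real_Asymp.Real_Asymp"
begin

text \<open>Let \<open>X\<close> be the number of isolated vertices after \<open>N\<close> rounds and \<open>x = X / n\<close>. On average \<open>x\<close> follows
  \<open>x' = - 2 * x * (1 + x - x\<^sup>2)\<close> per \<open>n\<close> rounds, and a function \<open>h\<close> with \<open>h(x) \<sim> x\<close> at \<open>0\<close> straightens this
  into \<open>h' = - 2 * h\<close>; the constant of the theorem is \<open>h 1\<close>. Hence \<open>exp (- t\<^sub>N * n * h x)\<close> is nearly a
  martingale when \<open>t\<^sub>N\<close> is proportional to \<open>(1 - 2 / n) ^ (- N)\<close>, which controls the Laplace transform of
  \<open>X\<close> up to the time when about \<open>n powr (1/5)\<close> isolated vertices are left. From then on two isolated
  vertices hardly ever disappear in the same round, the process is a coupon collector, and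
  \<open>(1 - q\<^sub>N) ^ X\<close> with \<open>q\<^sub>N = (1 - 2 / n) ^ (M - N)\<close> is nearly a martingale whose value at
  time \<open>M\<close> is the indicator of \<open>X = 0\<close>.

  A disconnected graph without isolated vertices has a component \<open>S\<close> with \<open>2 \<le> card S \<le> n / 2\<close>. Its boundary is
  never crossed and some round puts an edge inside \<open>S\<close>. The latter costs a factor of order \<open>ln n / n\<close>
  for a fixed \<open>S\<close>, and a union bound over \<open>S\<close> suffices.

  The tail bounds that come out of both arguments are integrable uniformly in \<open>n\<close>, so the expectation
  follows from the limit law by dominated convergence.\<close>

section \<open>The process as a Markov chain\<close>

text \<open>Neither near-martingale works over the whole time range.
  \<open>exp (- t * n * h x)\<close> copes with the nonlinear drift, but it treats a round to first
  order in \<open>t\<close>; the accumulated second-order error, about \<open>t^2 * X\<close>, is of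
  order one at the end, where \<open>t\<close> and \<open>X\<close> are of order one.
  \<open>(1 - q) ^ X\<close> is exact for a coupon collector, but it ignores drift terms of size
  \<open>x^2\<close> per round, and over about \<open>n * ln n\<close> rounds these are negligible
  only once \<open>X\<close> is well below \<open>sqrt n\<close>. Both are accurate when
  \<open>X\<close> is a small positive power of \<open>n\<close>, and there they agree.

  For cuts, the chance that a round crosses a boundary depends on the graph through its isolated
  vertices, so there is no product formula. A weight restores geometric decay at the price
  \<open>exp (card S)\<close>, which the factorial in the number of sets absorbs.

  At a fixed time, being disconnected without isolated vertices has probability at most of order
  \<open>ln n / n\<close>. This is too weak for a union bound over the order \<open>n\<close> rounds
  in which the last isolated vertex may vanish, so the coincidence of the two times needs its own
  argument.\<close>

definition BF_avg :: "nat \<Rightarrow> (nat set set \<Rightarrow> real) \<Rightarrow> nat set set \<Rightarrow> real" where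
  "BF_avg n f E = (\<Sum>a\<in>{1..n}. \<Sum>b\<in>{1..n}. \<Sum>c\<in>{1..n}. \<Sum>d\<in>{1..n}. f (BF_step a b c d E)) / real n ^ 4"

lemma prob_space_BF: "n \<ge> 1 \<Longrightarrow> prob_space (BF_space n)"
  unfolding BF_space_def by (intro prob_space_PiM prob_space_uniform_count_measure) auto

lemma BF_coord_measurable:
  assumes "i \<in> {1..4}"
  shows "(\<lambda>\<omega>. \<omega> (N, i)) \<in> BF_space n \<rightarrow>\<^sub>M count_space UNIV"
proof -
  have "(\<lambda>\<omega>. \<omega> (N, i)) \<in> BF_space n \<rightarrow>\<^sub>M uniform_count_measure {1..n}"
    unfolding BF_space_def using assms by (intro measurable_component_singleton) auto
  then have "(\<lambda>\<omega>. \<omega> (N, i)) \<in> BF_space n \<rightarrow>\<^sub>M count_space {1..n}"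
    by (simp only: measurable_cong_sets[OF refl sets_uniform_count_measure_count_space])
  moreover have "(\<lambda>x. x) \<in> count_space {1..n} \<rightarrow>\<^sub>M count_space UNIV" by simp
  ultimately show ?thesis by (rule measurable_compose)
qed

text \<open>Each coordinate has countably many values, so it can be frozen to a constant and then
  reinstated. Doing this for the four coordinates in turn leaves only the measurability of
  \<open>G\<close>.\<close>

lemma BF_quad_measurable:
  assumes G: "G \<in> BF_space n \<rightarrow>\<^sub>M count_space UNIV"
  shows "(\<lambda>\<omega>. h (\<omega> (N, 1)) (\<omega> (N, 2)) (\<omega> (N, 3)) (\<omega> (N, 4)) (G \<omega>)) \<in> BF_space n \<rightarrow>\<^sub>M count_space UNIV"
proof -
  have "(\<lambda>\<omega>. h a b c d (G \<omega>)) \<in> BF_space n \<rightarrow>\<^sub>M count_space UNIV" for a b c d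
    by (rule measurable_compose[OF G]) simp
  then have "(\<lambda>\<omega>. h a b c (\<omega> (N, 4)) (G \<omega>)) \<in> BF_space n \<rightarrow>\<^sub>M count_space UNIV" for a b c
    by (rule measurable_compose_countable[where f = "\<lambda>d \<omega>. h a b c d (G \<omega>)"])
      (rule BF_coord_measurable, simp)
  then have "(\<lambda>\<omega>. h a b (\<omega> (N, 3)) (\<omega> (N, 4)) (G \<omega>)) \<in> BF_space n \<rightarrow>\<^sub>M count_space UNIV" for a b
    by (rule measurable_compose_countable[where f = "\<lambda>c \<omega>. h a b c (\<omega> (N, 4)) (G \<omega>)"])
      (rule BF_coord_measurable, simp)
  then have "(\<lambda>\<omega>. h a (\<omega> (N, 2)) (\<omega> (N, 3)) (\<omega> (N, 4)) (G \<omega>)) \<in> BF_space n \<rightarrow>\<^sub>M count_space UNIV" for a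
    by (rule measurable_compose_countable[where f = "\<lambda>b \<omega>. h a b (\<omega> (N, 3)) (\<omega> (N, 4)) (G \<omega>)"])
      (rule BF_coord_measurable, simp)
  then show ?thesis
    by (rule measurable_compose_countable[where f = "\<lambda>a \<omega>. h a (\<omega> (N, 2)) (\<omega> (N, 3)) (\<omega> (N, 4)) (G \<omega>)"])
      (rule BF_coord_measurable, simp)
qed

lemma BF_graph_measurable [measurable]:
  "(\<lambda>\<omega>. BF_graph \<omega> N) \<in> BF_space n \<rightarrow>\<^sub>M count_space UNIV"
proof (induction N)
  case (Suc N)
  then show ?case using BF_quad_measurable[of "\<lambda>\<omega>. BF_graph \<omega> N" n BF_step] by simp
qed simp

text \<open>The product measure is invariant under overwriting one coordinate by an independent
  uniform value (\<open>distr_pair_PiM_eq_PiM\<close>); Fubini turns the inner integral into a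
  finite average. This takes the place of conditional expectations given the past.\<close>

lemma BF_resample:
  fixes f :: "(nat \<times> nat \<Rightarrow> nat) \<Rightarrow> real"
  assumes n: "n \<ge> 1" and i: "i \<in> {1..4}"
    and f: "f \<in> borel_measurable (BF_space n)" and B: "\<And>\<omega>. \<omega> \<in> space (BF_space n) \<Longrightarrow> \<bar>f \<omega>\<bar> \<le> B"
  shows "(\<integral>\<omega>. f \<omega> \<partial>BF_space n) = (\<integral>\<omega>. (\<Sum>a\<in>{1..n}. f (fun_upd \<omega> (N, i) a)) / real n \<partial>BF_space n)"
proof -
  let ?U = "uniform_count_measure {1..n}"
  let ?B = "BF_space n"
  let ?g = "\<lambda>(a, \<omega>). fun_upd \<omega> (N, i) a"
  interpret U: prob_space ?U using n by (intro prob_space_uniform_count_measure) auto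
  interpret B: prob_space ?B using n by (rule prob_space_BF)
  interpret P: pair_prob_space ?B ?U ..
  have ins: "insert (N, i) (UNIV \<times> {1..4}) = UNIV \<times> {1..4}" using i by auto
  have d: "distr (?U \<Otimes>\<^sub>M ?B) ?B ?g = ?B"
    using distr_pair_PiM_eq_PiM[of "UNIV \<times> {1..4}" "\<lambda>_. ?U" "(N, i)"] U.prob_space_axioms
    unfolding ins BF_space_def by simp
  have g: "?g \<in> ?U \<Otimes>\<^sub>M ?B \<rightarrow>\<^sub>M ?B"
  proof -
    have "(\<lambda>x. fun_upd (snd x) (N, i) (fst x)) \<in> ?U \<Otimes>\<^sub>M (\<Pi>\<^sub>M j\<in>UNIV \<times> {1..4}. ?U) \<rightarrow>\<^sub>M (\<Pi>\<^sub>M j\<in>insert (N,i) (UNIV \<times> {1..4}). ?U)"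
      by (rule measurable_fun_upd[where J = "UNIV \<times> {1..4}"]) auto
    then show ?thesis unfolding ins BF_space_def by (simp add: case_prod_unfold)
  qed
  have g': "(\<lambda>(\<omega>, a). fun_upd \<omega> (N, i) a) \<in> ?B \<Otimes>\<^sub>M ?U \<rightarrow>\<^sub>M ?B"
    using measurable_compose[OF measurable_pair_swap' g] by (simp add: case_prod_unfold)
  have "(\<integral>\<omega>. f \<omega> \<partial>?B) = (\<integral>\<omega>. f \<omega> \<partial>distr (?U \<Otimes>\<^sub>M ?B) ?B ?g)" by (simp only: d)
  also have "\<dots> = (\<integral>x. f (?g x) \<partial>(?U \<Otimes>\<^sub>M ?B))"
    by (rule integral_distr[OF g f])
  also have "\<dots> = (\<integral>(\<omega>, a). f (fun_upd \<omega> (N, i) a) \<partial>(?B \<Otimes>\<^sub>M ?U))"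
    using P.integral_product_swap[of "\<lambda>(\<omega>, a). f (fun_upd \<omega> (N, i) a)"] measurable_compose[OF g' f]
    by (simp add: case_prod_unfold)
  also have "\<dots> = (\<integral>\<omega>. (\<integral>a. f (fun_upd \<omega> (N, i) a) \<partial>?U) \<partial>?B)"
  proof (rule P.integral_fst[symmetric])
    show "integrable (?B \<Otimes>\<^sub>M ?U) (\<lambda>(\<omega>, a). f (fun_upd \<omega> (N, i) a))"
    proof (rule P.integrable_const_bound[where B = B])
      show "AE x in ?B \<Otimes>\<^sub>M ?U. norm (case x of (\<omega>, a) \<Rightarrow> f (fun_upd \<omega> (N, i) a)) \<le> B"
        using measurable_space[OF g'] B by (intro AE_I2) (auto simp: case_prod_unfold)
      show "(\<lambda>(\<omega>, a). f (fun_upd \<omega> (N, i) a)) \<in> borel_measurable (?B \<Otimes>\<^sub>M ?U)"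
        using measurable_compose[OF g' f] by (simp add: case_prod_unfold)
    qed
  qed
  also have "\<dots> = (\<integral>\<omega>. (\<Sum>a\<in>{1..n}. f (fun_upd \<omega> (N, i) a)) / real n \<partial>?B)"
    by (simp add: integral_uniform_count_measure)
  finally show ?thesis .
qed

text \<open>There are finitely many reachable graphs, so every real function of the graph is bounded
  along the process and hence integrable. The definition also records that edges are not
  loops.\<close>

definition BF_states :: "nat \<Rightarrow> nat set set set" where
  "BF_states n = {E. \<forall>e\<in>E. \<exists>u\<in>{1..n}. \<exists>v\<in>{1..n}. u \<noteq> v \<and> e = {u, v}}"

lemma finite_BF_states: "finite (BF_states n)"
proof (rule finite_subset)
  show "BF_states n \<subseteq> Pow (Pow {1..n})" unfolding BF_states_def by fastforce
qed simp

lemma BF_step_states: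
  assumes "E \<in> BF_states n" "a \<in> {1..n}" "b \<in> {1..n}" "c \<in> {1..n}" "d \<in> {1..n}"
  shows "BF_step a b c d E \<in> BF_states n"
  using assms unfolding BF_step_def add_edge_def BF_states_def by (auto simp del: atLeastAtMost_iff)

lemma BF_coord_range:
  assumes "\<omega> \<in> space (BF_space n)" "i \<in> {1..4}"
  shows "\<omega> (N, i) \<in> {1..n}"
proof -
  have "\<omega> \<in> (\<Pi>\<^sub>E i\<in>UNIV \<times> {1..4}. {1..n})"
    using assms(1) by (simp add: BF_space_def space_PiM space_uniform_count_measure)
  moreover have "(N, i) \<in> UNIV \<times> {1..4}" using assms(2) by blast
  ultimately show ?thesis by (rule PiE_mem)
qed

lemma BF_coord_ranges:
  assumes "\<omega> \<in> space (BF_space n)"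
  shows "\<omega> (N, 1) \<in> {1..n}" "\<omega> (N, 2) \<in> {1..n}" "\<omega> (N, 3) \<in> {1..n}" "\<omega> (N, 4) \<in> {1..n}"
  by (rule BF_coord_range[OF assms], simp)+

lemma BF_graph_states: "\<omega> \<in> space (BF_space n) \<Longrightarrow> BF_graph \<omega> N \<in> BF_states n"
proof (induction N)
  case 0
  show ?case by (simp add: BF_states_def)
next
  case (Suc N)
  then show ?case unfolding BF_graph.simps by (intro BF_step_states BF_coord_ranges) auto
qed

lemma BF_graph_upd: "M \<le> N \<Longrightarrow> BF_graph (fun_upd \<omega> (N, i) a) M = BF_graph \<omega> M"
  by (induction M) auto

lemma abs_avg_le:
  fixes g :: "nat \<Rightarrow> real"
  assumes "n \<ge> 1" "\<And>a. a \<in> {1..n} \<Longrightarrow> \<bar>g a\<bar> \<le> B"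
  shows "\<bar>(\<Sum>a\<in>{1..n}. g a) / real n\<bar> \<le> B"
proof -
  have "\<bar>\<Sum>a\<in>{1..n}. g a\<bar> \<le> (\<Sum>a\<in>{1..n}. B)"
    by (rule order_trans[OF sum_abs]) (intro sum_mono assms(2))
  then show ?thesis using assms(1) by (simp add: field_simps)
qed

lemma BF_graph_integrable:
  fixes f :: "nat set set \<Rightarrow> real"
  assumes "n \<ge> 1"
  shows "integrable (BF_space n) (\<lambda>\<omega>. f (BF_graph \<omega> N))"
proof -
  interpret prob_space "BF_space n" using assms by (rule prob_space_BF)
  have "\<bar>f (BF_graph \<omega> N)\<bar> \<le> Max ((\<lambda>E. \<bar>f E\<bar>) ` BF_states n)" if "\<omega> \<in> space (BF_space n)" for \<omega>
    using BF_graph_states[OF that] finite_BF_states by (intro Max_ge) auto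
  then show ?thesis
    by (intro integrable_const_bound[where B = "Max ((\<lambda>E. \<bar>f E\<bar>) ` BF_states n)"])
      (auto intro: measurable_compose[OF BF_graph_measurable])
qed

text \<open>The graph before the round does not depend on the four coordinates of the round
  (\<open>BF_graph_upd\<close>), so \<open>BF_resample\<close> averages them out one after the
  other. The function sees both the old and the new graph, as is needed for events about what a
  single round does.\<close>

lemma BF_Markov2:
  fixes f :: "nat set set \<Rightarrow> nat set set \<Rightarrow> real"
  assumes n: "n \<ge> 1"
  shows "(\<integral>\<omega>. f (BF_graph \<omega> N) (BF_graph \<omega> (Suc N)) \<partial>BF_space n) =
    (\<integral>\<omega>. BF_avg n (f (BF_graph \<omega> N)) (BF_graph \<omega> N) \<partial>BF_space n)"
proof -
  let ?V = "{1..n}"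
  define h where "h a b c d E = f E (BF_step a b c d E)" for a b c d E
  define B where "B = Max ((\<lambda>(E, E'). \<bar>f E E'\<bar>) ` (BF_states n \<times> BF_states n))"
  have hB: "\<bar>h a b c d E\<bar> \<le> B" if "a \<in> ?V" "b \<in> ?V" "c \<in> ?V" "d \<in> ?V" "E \<in> BF_states n" for a b c d E
    unfolding B_def h_def using that finite_BF_states[of n] BF_step_states[OF that(5,1,2,3,4)]
    by (intro Max_ge) (auto intro!: image_eqI[where x = "(E, BF_step a b c d E)"])
  have meas: "(\<lambda>\<omega>. g (\<omega> (N, 1)) (\<omega> (N, 2)) (\<omega> (N, 3)) (\<omega> (N, 4)) (BF_graph \<omega> N)) \<in> borel_measurable (BF_space n)"
    for g :: "nat \<Rightarrow> nat \<Rightarrow> nat \<Rightarrow> nat \<Rightarrow> nat set set \<Rightarrow> real"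
    by (rule measurable_compose[OF BF_quad_measurable]) simp_all
  define h1 where "h1 b c d E = (\<Sum>a\<in>?V. h a b c d E) / real n" for b c d E
  define h2 where "h2 c d E = (\<Sum>b\<in>?V. h1 b c d E) / real n" for c d E
  define h3 where "h3 d E = (\<Sum>c\<in>?V. h2 c d E) / real n" for d E
  have h1B: "\<bar>h1 b c d E\<bar> \<le> B" if "b \<in> ?V" "c \<in> ?V" "d \<in> ?V" "E \<in> BF_states n" for b c d E
    unfolding h1_def using that by (intro abs_avg_le n hB)
  have h2B: "\<bar>h2 c d E\<bar> \<le> B" if "c \<in> ?V" "d \<in> ?V" "E \<in> BF_states n" for c d E
    unfolding h2_def using that by (intro abs_avg_le n h1B)
  have h3B: "\<bar>h3 d E\<bar> \<le> B" if "d \<in> ?V" "E \<in> BF_states n" for d E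
    unfolding h3_def using that by (intro abs_avg_le n h2B)
  have upd: "BF_graph (fun_upd \<omega> (N, i) a) N = BF_graph \<omega> N" for \<omega> i a by (rule BF_graph_upd) simp
  have avg: "(\<Sum>d\<in>?V. h3 d E) / real n = BF_avg n (f E) E" for E
  proof -
    have "(\<Sum>d\<in>?V. h3 d E) / real n = (\<Sum>d\<in>?V. \<Sum>c\<in>?V. \<Sum>b\<in>?V. \<Sum>a\<in>?V. h a b c d E) / real n ^ 4"
      unfolding h3_def h2_def h1_def by (simp add: sum_divide_distrib power4_eq_xxxx)
    also have "(\<Sum>d\<in>?V. \<Sum>c\<in>?V. \<Sum>b\<in>?V. \<Sum>a\<in>?V. h a b c d E) = (\<Sum>a\<in>?V. \<Sum>b\<in>?V. \<Sum>c\<in>?V. \<Sum>d\<in>?V. h a b c d E)"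
    proof -
      have "(\<Sum>d\<in>?V. \<Sum>c\<in>?V. \<Sum>b\<in>?V. \<Sum>a\<in>?V. h a b c d E) = (\<Sum>d\<in>?V. \<Sum>c\<in>?V. \<Sum>a\<in>?V. \<Sum>b\<in>?V. h a b c d E)"
        by (intro sum.cong refl sum.swap)
      also have "\<dots> = (\<Sum>d\<in>?V. \<Sum>a\<in>?V. \<Sum>c\<in>?V. \<Sum>b\<in>?V. h a b c d E)"
        by (intro sum.cong refl sum.swap)
      also have "\<dots> = (\<Sum>a\<in>?V. \<Sum>d\<in>?V. \<Sum>b\<in>?V. \<Sum>c\<in>?V. h a b c d E)"
        by (subst sum.swap) (intro sum.cong refl sum.swap)
      also have "\<dots> = (\<Sum>a\<in>?V. \<Sum>b\<in>?V. \<Sum>d\<in>?V. \<Sum>c\<in>?V. h a b c d E)"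
        by (intro sum.cong refl sum.swap)
      also have "\<dots> = (\<Sum>a\<in>?V. \<Sum>b\<in>?V. \<Sum>c\<in>?V. \<Sum>d\<in>?V. h a b c d E)"
        by (intro sum.cong refl sum.swap)
      finally show ?thesis .
    qed
    finally show ?thesis by (simp add: BF_avg_def h_def)
  qed
  have mem: "(1::nat) \<in> {1..4}" "(2::nat) \<in> {1..4}" "(3::nat) \<in> {1..4}" "(4::nat) \<in> {1..4}" by simp_all
  note rng = BF_coord_ranges BF_graph_states
  have "(\<integral>\<omega>. f (BF_graph \<omega> N) (BF_graph \<omega> (Suc N)) \<partial>BF_space n)
      = (\<integral>\<omega>. h (\<omega> (N, 1)) (\<omega> (N, 2)) (\<omega> (N, 3)) (\<omega> (N, 4)) (BF_graph \<omega> N) \<partial>BF_space n)"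
    by (simp add: h_def)
  also have "\<dots> = (\<integral>\<omega>. h1 (\<omega> (N, 2)) (\<omega> (N, 3)) (\<omega> (N, 4)) (BF_graph \<omega> N) \<partial>BF_space n)"
    using BF_resample[OF n _ meas[of h], of 1 B N] by (simp add: upd h1_def hB rng mem del: atLeastAtMost_iff One_nat_def)
  also have "\<dots> = (\<integral>\<omega>. h2 (\<omega> (N, 3)) (\<omega> (N, 4)) (BF_graph \<omega> N) \<partial>BF_space n)"
    using BF_resample[OF n _ meas[of "\<lambda>a. h1"], of 2 B N] by (simp add: upd h2_def h1B rng mem del: atLeastAtMost_iff One_nat_def)
  also have "\<dots> = (\<integral>\<omega>. h3 (\<omega> (N, 4)) (BF_graph \<omega> N) \<partial>BF_space n)"
    using BF_resample[OF n _ meas[of "\<lambda>a b. h2"], of 3 B N] by (simp add: upd h3_def h2B rng mem del: atLeastAtMost_iff One_nat_def)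
  also have "\<dots> = (\<integral>\<omega>. (\<Sum>d\<in>?V. h3 d (BF_graph \<omega> N)) / real n \<partial>BF_space n)"
    using BF_resample[OF n _ meas[of "\<lambda>a b c. h3"], of 4 B N] by (simp add: upd h3B rng mem del: atLeastAtMost_iff One_nat_def)
  finally show ?thesis by (simp only: avg)
qed

lemma BF_Markov:
  "n \<ge> 1 \<Longrightarrow> (\<integral>\<omega>. f (BF_graph \<omega> (Suc N)) \<partial>BF_space n) = (\<integral>\<omega>. BF_avg n f (BF_graph \<omega> N) \<partial>BF_space n)"
  by (rule BF_Markov2)

section \<open>One round seen from the isolated vertices\<close>

definition iso_set :: "nat \<Rightarrow> nat set set \<Rightarrow> nat set" where
  "iso_set n E = {v \<in> {1..n}. isolated E v}"

definition iso_count :: "nat \<Rightarrow> nat set set \<Rightarrow> nat" where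
  "iso_count n E = card (iso_set n E)"

lemma iso_set_subset: "iso_set n E \<subseteq> {1..n}"
  by (auto simp: iso_set_def)

lemma finite_iso_set [simp]: "finite (iso_set n E)"
  using iso_set_subset finite_subset by blast

lemma iso_count_le: "iso_count n E \<le> n"
  unfolding iso_count_def using card_mono[OF _ iso_set_subset, of n E] by simp

lemma iso_count_empty [simp]: "iso_count n {} = n"
proof -
  have "iso_set n {} = {1..n}" by (auto simp: iso_set_def isolated_def)
  then show ?thesis by (simp add: iso_count_def)
qed

lemma iso_set_add_edge: "c \<noteq> d \<Longrightarrow> iso_set n (add_edge c d E) = iso_set n E - {c, d}"
  by (auto simp: iso_set_def add_edge_def isolated_def)

lemma iso_set_add_edge_same [simp]: "iso_set n (add_edge c c E) = iso_set n E"
  by (simp add: add_edge_def)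

text \<open>The sum splits according to whether the first pair is accepted. If so, the edge is
  uniform on ordered pairs of isolated vertices; if not, it is the independent second pair, uniform
  on all ordered pairs.\<close>

lemma BF_avg_eq:
  assumes n: "n \<ge> 1"
  shows "BF_avg n f E =
    (\<Sum>a\<in>iso_set n E. \<Sum>b\<in>iso_set n E. f (add_edge a b E)) / real n ^ 2 +
    (1 - (real (iso_count n E) / real n) ^ 2) * ((\<Sum>c\<in>{1..n}. \<Sum>d\<in>{1..n}. f (add_edge c d E)) / real n ^ 2)"
proof -
  let ?V = "{1..n}" and ?I = "iso_set n E"
  define S where "S = (\<Sum>c\<in>?V. \<Sum>d\<in>?V. f (add_edge c d E))"
  let ?g = "\<lambda>(a, b). real n ^ 2 * f (add_edge a b E)"
  have "(\<Sum>c\<in>?V. \<Sum>d\<in>?V. f (BF_step a b c d E)) = (if (a, b) \<in> ?I \<times> ?I then ?g (a, b) else S)"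
    if "a \<in> ?V" "b \<in> ?V" for a b
    using that by (auto simp: BF_step_def S_def iso_set_def power2_eq_square)
  then have "(\<Sum>a\<in>?V. \<Sum>b\<in>?V. \<Sum>c\<in>?V. \<Sum>d\<in>?V. f (BF_step a b c d E)) =
      (\<Sum>a\<in>?V. \<Sum>b\<in>?V. if (a, b) \<in> ?I \<times> ?I then ?g (a, b) else S)"
    by (intro sum.cong refl)
  also have "\<dots> = (\<Sum>p\<in>?V \<times> ?V. if p \<in> ?I \<times> ?I then ?g p else S)"
    by (subst sum.cartesian_product) (intro sum.cong refl, simp only: case_prod_beta prod.collapse)
  also have "\<dots> = (\<Sum>p\<in>(?V \<times> ?V) \<inter> (?I \<times> ?I). ?g p) + (\<Sum>p\<in>(?V \<times> ?V) \<inter> - (?I \<times> ?I). S)"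
    by (subst sum.If_cases) auto
  also have "(?V \<times> ?V) \<inter> (?I \<times> ?I) = ?I \<times> ?I" using iso_set_subset[of n E] by auto
  also have "(?V \<times> ?V) \<inter> - (?I \<times> ?I) = ?V \<times> ?V - ?I \<times> ?I" by auto
  also have "(\<Sum>p\<in>?V \<times> ?V - ?I \<times> ?I. S) = (real n ^ 2 - real (iso_count n E) ^ 2) * S"
  proof -
    have "?I \<times> ?I \<subseteq> ?V \<times> ?V" using iso_set_subset[of n E] by blast
    then have "card (?V \<times> ?V - ?I \<times> ?I) = n ^ 2 - iso_count n E ^ 2"
      by (subst card_Diff_subset) (auto simp: iso_count_def power2_eq_square)
    then show ?thesis using power_mono[OF iso_count_le, of n E 2] by (simp add: of_nat_diff)
  qed
  also have "(\<Sum>p\<in>?I \<times> ?I. ?g p) = real n ^ 2 * (\<Sum>a\<in>?I. \<Sum>b\<in>?I. f (add_edge a b E))"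
    by (subst sum.cartesian_product) (simp add: sum_distrib_left case_prod_unfold)
  finally show ?thesis
    using n unfolding BF_avg_def S_def[symmetric]
    by (simp add: field_simps power2_eq_square power4_eq_xxxx)
qed

lemma BF_avg_mono:
  assumes "\<And>a b. a \<in> {1..n} \<Longrightarrow> b \<in> {1..n} \<Longrightarrow> f (add_edge a b E) \<le> g (add_edge a b E)"
  shows "BF_avg n f E \<le> BF_avg n g E"
  unfolding BF_avg_def using assms
  by (intro divide_right_mono sum_mono) (auto simp: BF_step_def)

lemma iso_count_add_edge:
  assumes "c \<noteq> d"
  shows "iso_count n (add_edge c d E) = iso_count n E - (if c \<in> iso_set n E then 1 else 0) - (if d \<in> iso_set n E then 1 else 0)"
proof -
  have "iso_set n E - {c, d} = iso_set n E - {c} - {d}" by auto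
  then show ?thesis using assms
    by (auto simp: iso_count_def iso_set_add_edge)
qed

lemma iso_count_add_edge_same [simp]: "iso_count n (add_edge c c E) = iso_count n E"
  by (simp add: iso_count_def)

text \<open>The two coefficients are the probabilities of losing exactly one and exactly two
  isolated vertices. One vertex is lost only through the second pair. Two may be lost through either
  pair, whence \<open>2 - x ^ 2 = 1 + (1 - x ^ 2)\<close>, and \<open>1 / n\<close> removes the
  loops. Truncated subtraction is harmless: the first coefficient vanishes at \<open>k = 0\<close>,
  the second at \<open>k = 0\<close> and \<open>k = 1\<close>.\<close>

lemma BF_avg_iso_count:
  fixes n E and f :: "nat \<Rightarrow> real"
  assumes n: "n \<ge> 1"
  defines "k \<equiv> iso_count n E"
  defines "x \<equiv> real k / real n"
  shows "BF_avg n (\<lambda>E. f (iso_count n E)) E =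
    f k + 2 * x * (1 - x) * (1 - x ^ 2) * (f (k - 1) - f k) +
    x * (x - 1 / real n) * (2 - x ^ 2) * (f (k - 2) - f k)"
proof -
  let ?V = "{1..n}" and ?I = "iso_set n E"
  have kn: "k \<le> n" unfolding k_def by (rule iso_count_le)
  have cI: "card ?I = k" by (simp add: k_def iso_count_def)
  have cV: "card (?V - ?I) = n - k"
    using iso_set_subset[of n E] by (subst card_Diff_subset) (auto simp: cI)
  have VI: "?V = ?I \<union> (?V - ?I)" using iso_set_subset[of n E] by auto
  have split: "(\<Sum>d\<in>?V. g d) = (\<Sum>d\<in>?I. g d) + (\<Sum>d\<in>?V - ?I. g d)" for g :: "nat \<Rightarrow> real"
    by (subst VI, rule sum.union_disjoint) auto
  let ?f = "\<lambda>c d. f (iso_count n (add_edge c d E))"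
  have A: "(\<Sum>d\<in>?I. ?f c d) = f k + (real k - 1) * f (k - 2)" if "c \<in> ?I" for c
  proof -
    have "(\<Sum>d\<in>?I. ?f c d) = ?f c c + (\<Sum>d\<in>?I - {c}. ?f c d)"
      using that by (intro sum.remove) auto
    also have "(\<Sum>d\<in>?I - {c}. ?f c d) = (\<Sum>d\<in>?I - {c}. f (k - 2))"
      using that by (intro sum.cong refl) (auto simp: iso_count_add_edge k_def numeral_2_eq_2)
    also have "\<dots> = (real k - 1) * f (k - 2)"
    proof -
      have "k \<ge> 1" using that cI card_gt_0_iff[of ?I] by auto
      then show ?thesis using that by (simp add: cI of_nat_diff)
    qed
    finally show ?thesis by (simp add: k_def)
  qed
  have B: "(\<Sum>d\<in>?V - ?I. ?f c d) = (real n - real k) * f (k - 1)" if "c \<in> ?I" for c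
  proof -
    have "(\<Sum>d\<in>?V - ?I. ?f c d) = (\<Sum>d\<in>?V - ?I. f (k - 1))"
    proof (intro sum.cong refl)
      fix d assume "d \<in> ?V - ?I"
      then have "c \<noteq> d" using that by auto
      then show "?f c d = f (k - 1)" using that \<open>d \<in> ?V - ?I\<close> by (simp add: iso_count_add_edge k_def)
    qed
    then show ?thesis by (simp add: cV of_nat_diff kn del: One_nat_def)
  qed
  have C: "(\<Sum>d\<in>?I. ?f c d) = real k * f (k - 1)" if "c \<in> ?V - ?I" for c
  proof -
    have "(\<Sum>d\<in>?I. ?f c d) = (\<Sum>d\<in>?I. f (k - 1))"
    proof (intro sum.cong refl)
      fix d assume "d \<in> ?I"
      then have "c \<noteq> d" using that by auto
      then show "?f c d = f (k - 1)" using that \<open>d \<in> ?I\<close> by (simp add: iso_count_add_edge k_def)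
    qed
    then show ?thesis by (simp add: cI)
  qed
  have D: "(\<Sum>d\<in>?V - ?I. ?f c d) = (real n - real k) * f k" if "c \<in> ?V - ?I" for c
  proof -
    have "(\<Sum>d\<in>?V - ?I. ?f c d) = (\<Sum>d\<in>?V - ?I. f k)"
    proof (intro sum.cong refl)
      fix d assume "d \<in> ?V - ?I"
      then show "?f c d = f k" using that by (cases "c = d") (simp_all add: iso_count_add_edge k_def)
    qed
    then show ?thesis by (simp add: cV of_nat_diff kn del: One_nat_def)
  qed
  have II: "(\<Sum>a\<in>?I. \<Sum>b\<in>?I. ?f a b) = real k * (f k + (real k - 1) * f (k - 2))"
    using A by (simp add: cI)
  have VV: "(\<Sum>c\<in>?V. \<Sum>d\<in>?V. ?f c d) =
      real k * (f k + (real k - 1) * f (k - 2) + (real n - real k) * f (k - 1)) +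
      (real n - real k) * (real k * f (k - 1) + (real n - real k) * f k)"
  proof -
    have "(\<Sum>c\<in>?V. \<Sum>d\<in>?V. ?f c d) = (\<Sum>c\<in>?I. \<Sum>d\<in>?V. ?f c d) + (\<Sum>c\<in>?V - ?I. \<Sum>d\<in>?V. ?f c d)"
      by (rule split)
    also have "(\<Sum>c\<in>?I. \<Sum>d\<in>?V. ?f c d) = (\<Sum>c\<in>?I. f k + (real k - 1) * f (k - 2) + (real n - real k) * f (k - 1))"
      by (intro sum.cong refl) (simp only: split A B)
    also have "(\<Sum>c\<in>?V - ?I. \<Sum>d\<in>?V. ?f c d) = (\<Sum>c\<in>?V - ?I. real k * f (k - 1) + (real n - real k) * f k)"
      by (intro sum.cong refl) (simp only: split C D)
    finally show ?thesis by (simp add: cI cV of_nat_diff kn del: One_nat_def)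
  qed
  have kx: "real k = x * real n" using n by (simp add: x_def)
  show ?thesis
    unfolding BF_avg_eq[OF n] II VV k_def[symmetric] x_def[symmetric] unfolding kx
    using n by (simp add: field_simps power2_eq_square)
qed

section \<open>Cuts without edges\<close>

definition cut_free :: "nat set \<Rightarrow> nat set set \<Rightarrow> bool" where
  "cut_free S E \<longleftrightarrow> (\<forall>e\<in>E. e \<subseteq> S \<or> e \<inter> S = {})"

lemma cut_free_add_edge:
  "cut_free S (add_edge c d E) \<longleftrightarrow> cut_free S E \<and> (c \<in> S \<longleftrightarrow> d \<in> S)"
  if "c \<noteq> d"
  using that by (auto simp: cut_free_def add_edge_def)

lemma cut_free_add_edge_imp:
  "cut_free S (add_edge c d E) \<Longrightarrow> cut_free S E \<and> (c \<in> S \<longleftrightarrow> d \<in> S)"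
  by (cases "c = d") (auto simp: cut_free_add_edge, simp add: add_edge_def)

lemma iso_count_add_edge_le: "iso_count n (add_edge c d E) \<le> iso_count n E"
  by (cases "c = d") (simp_all add: iso_count_add_edge)

lemma exp_minus_le: "y \<ge> 0 \<Longrightarrow> exp (- y) \<le> 1 - y + y ^ 2 / (2::real)"
proof -
  assume y: "y \<ge> 0"
  let ?f = "\<lambda>y::real. 1 - y + y ^ 2 / 2 - exp (- y)"
  have "?f 0 \<le> ?f y"
  proof (rule DERIV_nonneg_imp_nondecreasing[OF y])
    fix x :: real assume "0 \<le> x" "x \<le> y"
    have "(?f has_real_derivative (- 1 + x + exp (- x))) (at x)"
      by (auto intro!: derivative_eq_intros)
    moreover have "- 1 + x + exp (- x) \<ge> 0" using exp_ge_add_one_self[of "- x"] by simp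
    ultimately show "\<exists>z. (?f has_real_derivative z) (at x) \<and> 0 \<le> z" by blast
  qed
  then show ?thesis by simp
qed

text \<open>While many vertices are isolated, a round may be wasted on an edge between two of them. This
  is compensated by the factor \<open>exp (s * X / n)\<close>, where \<open>X\<close> is the number of isolated vertices:
  such a round decreases \<open>X\<close> by \<open>2\<close> (up to loops), and
  \<open>exp (- 2 * s / n)\<close> is at most the probability that a uniform pair does not cross the cut.\<close>

definition cut_weight :: "nat \<Rightarrow> nat set \<Rightarrow> nat set set \<Rightarrow> real" where
  "cut_weight n S E = of_bool (cut_free S E) * exp (real (card S) * real (iso_count n E) / real n)"

definition cut_edge_weight :: "nat \<Rightarrow> nat set \<Rightarrow> nat set set \<Rightarrow> real" where
  "cut_edge_weight n S E = of_bool (\<exists>e\<in>E. e \<subseteq> S) * cut_weight n S E"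

text \<open>A uniform pair avoids the boundary of an \<open>s\<close>-set with probability
  \<open>1 - 2 * s * (n - s) / n^2\<close>. The extra \<open>2 * s / n^2\<close> pays for rounds
  wasted on a loop at an isolated vertex, which do not decrease the number of isolated
  vertices.\<close>

definition cut_rate :: "nat \<Rightarrow> nat \<Rightarrow> real" where
  "cut_rate n s = 1 - 2 * real s * (real n - real s - 1) / real n ^ 2"

lemma cut_rate_nonneg: assumes "n \<ge> 1" shows "cut_rate n s \<ge> 0"
proof -
  have "4 * real s * (real n - real s) \<le> real n ^ 2"
    using zero_le_power2[of "real n - 2 * real s"] by (simp add: power2_eq_square algebra_simps)
  moreover have "2 * real s * (real n - real s - 1) = (4 * real s * (real n - real s)) / 2 - 2 * real s"
    by (simp add: algebra_simps)
  ultimately have "2 * real s * (real n - real s - 1) \<le> real n ^ 2"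
    using zero_le_power2[of "real n"] of_nat_0_le_iff[of s] by linarith
  then show ?thesis using assms by (simp add: cut_rate_def field_simps)
qed

lemma BF_avg_cut_weight:
  assumes n: "n \<ge> 1" and S: "S \<subseteq> {1..n}"
  shows "BF_avg n (cut_weight n S) E \<le> cut_rate n (card S) * cut_weight n S E"
proof (cases "cut_free S E")
  case False
  then have "cut_weight n S (add_edge c d E) = 0" for c d
    using cut_free_add_edge_imp by (auto simp: cut_weight_def)
  then have "BF_avg n (cut_weight n S) E = 0" unfolding BF_avg_def BF_step_def by (simp add: if_distrib cong: if_cong)
  moreover have "cut_weight n S E = 0" using False by (simp add: cut_weight_def)
  ultimately show ?thesis by simp
next
  case True
  let ?V = "{1..n}" and ?I = "iso_set n E" and ?w = "cut_weight n S E"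
  define s where "s = real (card S)"
  define k where "k = real (iso_count n E)"
  define x where "x = k / real n"
  define y where "y = 2 * s / real n"
  have w: "?w = exp (s * k / real n)" using True by (simp add: cut_weight_def s_def k_def)
  have w0: "?w > 0" by (simp add: w)
  have k: "0 \<le> k" "k \<le> real n" using iso_count_le by (auto simp: k_def)
  have x: "0 \<le> x" "x \<le> 1" using k n by (auto simp: x_def)
  have finS: "finite S" using S finite_subset by blast
  have sn: "0 \<le> s" "s \<le> real n" using card_mono[OF _ S] by (auto simp: s_def)
  have y: "y \<ge> 0" using sn by (simp add: y_def)
  have le_w: "cut_weight n S (add_edge c d E) \<le> ?w" for c d
    using iso_count_add_edge_le[of n c d E] True
    by (auto simp: cut_weight_def intro!: divide_right_mono mult_left_mono)
  have II: "(\<Sum>a\<in>?I. \<Sum>b\<in>?I. cut_weight n S (add_edge a b E)) \<le> ?w * (k * 1 + k * (k - 1) * exp (- y))"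
  proof -
    have "(\<Sum>b\<in>?I. cut_weight n S (add_edge a b E)) \<le> ?w * (1 + (k - 1) * exp (- y))" if a: "a \<in> ?I" for a
    proof -
      have "(\<Sum>b\<in>?I. cut_weight n S (add_edge a b E)) = cut_weight n S (add_edge a a E) + (\<Sum>b\<in>?I - {a}. cut_weight n S (add_edge a b E))"
        using a by (intro sum.remove) auto
      also have "\<dots> \<le> ?w + (\<Sum>b\<in>?I - {a}. ?w * exp (- y))"
      proof (intro add_mono sum_mono le_w)
        fix b assume b: "b \<in> ?I - {a}"
        then have "card {a, b} \<le> card ?I" using a by (intro card_mono) auto
        then have "iso_count n E \<ge> 2" using b by (simp add: iso_count_def)
        then have "real (iso_count n (add_edge a b E)) = k - 2"
          using a b by (simp add: iso_count_add_edge k_def of_nat_diff)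
        then have "cut_weight n S (add_edge a b E) \<le> exp (s * (k - 2) / real n)"
          by (simp add: cut_weight_def s_def)
        also have "s * (k - 2) / real n = s * k / real n + - y" using n by (simp add: y_def field_simps)
        finally show "cut_weight n S (add_edge a b E) \<le> ?w * exp (- y)" by (simp only: w exp_add)
      qed
      also have "\<dots> = ?w * (1 + (k - 1) * exp (- y))"
      proof -
        have "card ?I \<ge> 1" using a card_gt_0_iff[of ?I] by (auto simp: Suc_le_eq)
        then show ?thesis using a by (simp add: k_def iso_count_def of_nat_diff algebra_simps)
      qed
      finally show ?thesis .
    qed
    then have "(\<Sum>a\<in>?I. \<Sum>b\<in>?I. cut_weight n S (add_edge a b E)) \<le> (\<Sum>a\<in>?I. ?w * (1 + (k - 1) * exp (- y)))"
      by (intro sum_mono)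
    then show ?thesis by (simp add: k_def iso_count_def algebra_simps)
  qed
  have VV: "(\<Sum>c\<in>?V. \<Sum>d\<in>?V. cut_weight n S (add_edge c d E)) \<le> ?w * (s ^ 2 + (real n - s) ^ 2)"
  proof -
    have "(\<Sum>c\<in>?V. \<Sum>d\<in>?V. cut_weight n S (add_edge c d E)) \<le> (\<Sum>c\<in>?V. \<Sum>d\<in>?V. ?w * of_bool (c \<in> S \<longleftrightarrow> d \<in> S))"
    proof (intro sum_mono)
      fix c d
      show "cut_weight n S (add_edge c d E) \<le> ?w * of_bool (c \<in> S \<longleftrightarrow> d \<in> S)"
        using le_w[of c d] cut_free_add_edge_imp[of S c d E] by (auto simp: cut_weight_def)
    qed
    also have "\<dots> = ?w * (\<Sum>c\<in>?V. \<Sum>d\<in>?V. of_bool (c \<in> S \<longleftrightarrow> d \<in> S))"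
      by (simp add: sum_distrib_left mult.commute)
    also have "(\<Sum>c\<in>?V. \<Sum>d\<in>?V. of_bool (c \<in> S \<longleftrightarrow> d \<in> S)) = (\<Sum>c\<in>?V. if c \<in> S then s else real n - s)"
    proof (intro sum.cong refl)
      fix c
      have *: "card (?V - S) = n - card S" "card S \<le> n"
        using S finS card_mono[OF _ S] by (auto simp: card_Diff_subset)
      have "(\<Sum>d\<in>?V. of_bool (c \<in> S \<longleftrightarrow> d \<in> S) :: real) = real (card {d\<in>?V. c \<in> S \<longleftrightarrow> d \<in> S})"
        by (simp add: Int_def)
      also have "{d\<in>?V. c \<in> S \<longleftrightarrow> d \<in> S} = (if c \<in> S then S else ?V - S)" using S by auto
      finally show "(\<Sum>d\<in>?V. of_bool (c \<in> S \<longleftrightarrow> d \<in> S)) = (if c \<in> S then s else real n - s)"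
        using * by (simp add: s_def of_nat_diff)
    qed
    also have "\<dots> = s ^ 2 + (real n - s) ^ 2"
    proof -
      have *: "card (?V - S) = n - card S" "card S \<le> n" "?V \<inter> S = S" "?V \<inter> - S = ?V - S"
        using S finS card_mono[OF _ S] by (auto simp: card_Diff_subset)
      show ?thesis
        by (subst sum.If_cases) (auto simp: * s_def of_nat_diff power2_eq_square simp del: One_nat_def)
    qed
    finally show ?thesis .
  qed
  define p where "p = 1 - y + y ^ 2 / 2"
  have p: "(s ^ 2 + (real n - s) ^ 2) / real n ^ 2 = p"
    using n by (simp add: p_def y_def field_simps power2_eq_square)
  have ey: "exp (- y) \<le> p" unfolding p_def by (rule exp_minus_le[OF y])
  have e1: "1 - exp (- y) \<le> y" using exp_ge_add_one_self[of "- y"] by simp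
  have "BF_avg n (cut_weight n S) E \<le> ?w * (k * 1 + k * (k - 1) * exp (- y)) / real n ^ 2 +
      (1 - x ^ 2) * (?w * (s ^ 2 + (real n - s) ^ 2) / real n ^ 2)"
    unfolding BF_avg_eq[OF n] k_def[symmetric] x_def[symmetric]
    using x II VV by (intro add_mono divide_right_mono mult_left_mono) (auto simp: power_le_one)
  \<comment> \<open>A wasted non-loop round contributes \<open>exp (- y)\<close> and any other round
    \<open>p\<close>, the probability of not crossing. As \<open>exp (- y)\<close> is at most
    \<open>p\<close>, their mixture is at most \<open>p\<close>; the last summand is the loop
    correction.\<close>
  also have "\<dots> = ?w * (x ^ 2 * exp (- y) + (1 - x ^ 2) * p + x / real n * (1 - exp (- y)))"
    unfolding p[symmetric] using n by (simp add: x_def field_simps power2_eq_square)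
  also have "\<dots> \<le> ?w * (x ^ 2 * p + (1 - x ^ 2) * p + 1 / real n * y)"
    using x ey e1 w0 y n by (intro mult_left_mono add_mono mult_mono divide_right_mono) (auto simp: power_le_one)
  also have "x ^ 2 * p + (1 - x ^ 2) * p + 1 / real n * y = cut_rate n (card S)"
    using n unfolding p_def y_def cut_rate_def s_def[symmetric] by (simp add: field_simps power2_eq_square)
  finally show ?thesis by (simp add: mult.commute)
qed

lemma cut_edge_weight_le: "cut_edge_weight n S E \<le> cut_weight n S E"
  by (simp add: cut_edge_weight_def cut_weight_def)

text \<open>Either \<open>S\<close> already contains an edge, and the weight decays as before, or it
  receives its first edge in this round. Each of the two sources of the edge, accepted first pair or
  second pair, contributes at most \<open>card S ^ 2 / n ^ 2\<close>.\<close>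

lemma BF_avg_cut_edge_weight:
  assumes n: "n \<ge> 1" and S: "S \<subseteq> {1..n}"
  shows "BF_avg n (cut_edge_weight n S) E \<le> cut_rate n (card S) * cut_edge_weight n S E
    + 2 * real (card S) ^ 2 / real n ^ 2 * cut_weight n S E"
proof (cases "\<exists>e\<in>E. e \<subseteq> S")
  case True
  have "BF_avg n (cut_edge_weight n S) E \<le> BF_avg n (cut_weight n S) E"
    by (intro BF_avg_mono cut_edge_weight_le)
  also have "\<dots> \<le> cut_rate n (card S) * cut_weight n S E" by (rule BF_avg_cut_weight[OF n S])
  also have "cut_weight n S E = cut_edge_weight n S E" using True by (simp add: cut_edge_weight_def)
  finally have "BF_avg n (cut_edge_weight n S) E \<le> cut_rate n (card S) * cut_edge_weight n S E" .
  moreover have "0 \<le> 2 * real (card S) ^ 2 / real n ^ 2 * cut_weight n S E" by (simp add: cut_weight_def)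
  ultimately show ?thesis by linarith
next
  case False
  let ?V = "{1..n}" and ?I = "iso_set n E" and ?w = "cut_weight n S E"
  define s where "s = real (card S)"
  have finS: "finite S" using S finite_subset by blast
  have w0: "?w \<ge> 0" by (simp add: cut_weight_def)
  have le: "cut_edge_weight n S (add_edge c d E) \<le> ?w * (of_bool (c \<in> S) * of_bool (d \<in> S))" for c d
  proof (cases "c \<in> S \<and> d \<in> S")
    case True
    have "cut_weight n S (add_edge c d E) \<le> ?w"
      using iso_count_add_edge_le[of n c d E] cut_free_add_edge_imp[of S c d E]
      by (auto simp: cut_weight_def intro!: divide_right_mono mult_left_mono)
    then show ?thesis using cut_edge_weight_le[of n S "add_edge c d E"] True by simp
  next
    case 2: False
    have "\<not> (\<exists>e\<in>add_edge c d E. e \<subseteq> S)" using False 2 by (auto simp: add_edge_def)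
    then show ?thesis using w0 by (simp add: cut_edge_weight_def)
  qed
  have sum_le: "(\<Sum>c\<in>T. \<Sum>d\<in>T. cut_edge_weight n S (add_edge c d E)) \<le> ?w * s ^ 2" if "finite T" for T
  proof -
    have "(\<Sum>c\<in>T. \<Sum>d\<in>T. cut_edge_weight n S (add_edge c d E)) \<le> (\<Sum>c\<in>T. \<Sum>d\<in>T. ?w * (of_bool (c \<in> S) * of_bool (d \<in> S)))"
      by (intro sum_mono le)
    also have "\<dots> = ?w * ((\<Sum>c\<in>T. of_bool (c \<in> S)) * (\<Sum>c\<in>T. of_bool (c \<in> S)))"
      by (simp add: sum_distrib_left sum_distrib_right mult_ac)
    also have "(\<Sum>c\<in>T. of_bool (c \<in> S) :: real) = real (card (T \<inter> S))"
      using that by (simp add: Int_def)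
    also have "?w * (real (card (T \<inter> S)) * real (card (T \<inter> S))) \<le> ?w * (s * s)"
      using w0 finS by (intro mult_left_mono mult_mono) (auto simp: s_def intro!: card_mono)
    finally show ?thesis by (simp add: power2_eq_square)
  qed
  have x: "(real (iso_count n E) / real n) ^ 2 \<le> 1"
    using iso_count_le[of n E] n by (intro power_le_one) auto
  have "BF_avg n (cut_edge_weight n S) E \<le> ?w * s ^ 2 / real n ^ 2 + 1 * (?w * s ^ 2 / real n ^ 2)"
    unfolding BF_avg_eq[OF n]
    using x w0 by (intro add_mono divide_right_mono mult_mono sum_le)
      (auto intro!: divide_nonneg_nonneg sum_nonneg simp: cut_edge_weight_def cut_weight_def)
  moreover have "cut_edge_weight n S E = 0" using False by (simp add: cut_edge_weight_def)
  ultimately show ?thesis by (simp add: s_def mult_ac)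
qed

lemma expectation_cut_weight:
  assumes n: "n \<ge> 1" and S: "S \<subseteq> {1..n}"
  shows "(\<integral>\<omega>. cut_weight n S (BF_graph \<omega> N) \<partial>BF_space n) \<le> exp (real (card S)) * cut_rate n (card S) ^ N"
proof (induction N)
  case 0
  interpret prob_space "BF_space n" using n by (rule prob_space_BF)
  show ?case using n by (simp add: cut_weight_def cut_free_def)
next
  case (Suc N)
  have "(\<integral>\<omega>. cut_weight n S (BF_graph \<omega> (Suc N)) \<partial>BF_space n) = (\<integral>\<omega>. BF_avg n (cut_weight n S) (BF_graph \<omega> N) \<partial>BF_space n)"
    by (rule BF_Markov[OF n])
  also have "\<dots> \<le> (\<integral>\<omega>. cut_rate n (card S) * cut_weight n S (BF_graph \<omega> N) \<partial>BF_space n)"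
    by (intro integral_mono BF_avg_cut_weight n S)
      (rule BF_graph_integrable[OF n, where f = "BF_avg n (cut_weight n S)"],
       rule BF_graph_integrable[OF n, where f = "\<lambda>E. cut_rate n (card S) * cut_weight n S E"])
  also have "\<dots> = cut_rate n (card S) * (\<integral>\<omega>. cut_weight n S (BF_graph \<omega> N) \<partial>BF_space n)" by simp
  also have "\<dots> \<le> cut_rate n (card S) * (exp (real (card S)) * cut_rate n (card S) ^ N)"
    by (intro mult_left_mono Suc.IH cut_rate_nonneg n)
  finally show ?case by (simp add: mult_ac)
qed

text \<open>The factor \<open>N\<close> counts the possible rounds for the first edge inside
  \<open>S\<close>; that round costs \<open>2 * card S ^ 2 / n ^ 2\<close> and each of the other
  \<open>N - 1\<close> rounds costs \<open>cut_rate\<close>. For \<open>N\<close> near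
  \<open>n * ln n / 2\<close> this is the gain of order \<open>ln n / n\<close> over the plain cut
  bound. At \<open>N = 0\<close> the truncated exponent is multiplied by zero.\<close>

lemma expectation_cut_edge_weight:
  assumes n: "n \<ge> 1" and S: "S \<subseteq> {1..n}"
  shows "(\<integral>\<omega>. cut_edge_weight n S (BF_graph \<omega> N) \<partial>BF_space n) \<le>
    real N * (2 * real (card S) ^ 2 / real n ^ 2) * exp (real (card S)) * cut_rate n (card S) ^ (N - 1)"
proof (induction N)
  case 0
  show ?case by (simp add: cut_edge_weight_def)
next
  case (Suc N)
  let ?r = "cut_rate n (card S)" and ?c = "2 * real (card S) ^ 2 / real n ^ 2" and ?e = "exp (real (card S))"
  note int = BF_graph_integrable[OF n, where N = N]
  have "(\<integral>\<omega>. cut_edge_weight n S (BF_graph \<omega> (Suc N)) \<partial>BF_space n) = (\<integral>\<omega>. BF_avg n (cut_edge_weight n S) (BF_graph \<omega> N) \<partial>BF_space n)"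
    by (rule BF_Markov[OF n])
  also have "\<dots> \<le> (\<integral>\<omega>. ?r * cut_edge_weight n S (BF_graph \<omega> N) + ?c * cut_weight n S (BF_graph \<omega> N) \<partial>BF_space n)"
    by (intro integral_mono BF_avg_cut_edge_weight n S)
      (rule int[where f = "BF_avg n (cut_edge_weight n S)"],
       rule int[where f = "\<lambda>E. ?r * cut_edge_weight n S E + ?c * cut_weight n S E"])
  also have "\<dots> = ?r * (\<integral>\<omega>. cut_edge_weight n S (BF_graph \<omega> N) \<partial>BF_space n) + ?c * (\<integral>\<omega>. cut_weight n S (BF_graph \<omega> N) \<partial>BF_space n)"
    using int[where f = "\<lambda>E. ?r * cut_edge_weight n S E"] int[where f = "\<lambda>E. ?c * cut_weight n S E"] by simp
  also have "\<dots> \<le> ?r * (real N * ?c * ?e * ?r ^ (N - 1)) + ?c * (?e * ?r ^ N)"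
    by (intro add_mono mult_left_mono Suc.IH cut_rate_nonneg n expectation_cut_weight S) simp
  also have "\<dots> = real (Suc N) * ?c * ?e * ?r ^ (Suc N - 1)"
  proof (cases N)
    case (Suc M)
    have "?r * (real N * ?c * ?e * ?r ^ (N - 1)) = real N * ?c * ?e * ?r ^ N"
      unfolding Suc by (simp only: diff_Suc_1 power_Suc mult_ac)
    then show ?thesis by (simp only: diff_Suc_1 of_nat_Suc distrib_left distrib_right mult_1 mult_ac add.commute)
  qed simp
  finally show ?case .
qed

section \<open>The rate function\<close>

text \<open>The straightening function solves \<open>h' / h = 1 / (x * (1 + x - x^2)) = 1 / x + (x -
  1) / (1 + x - x^2)\<close>, and \<open>BF_gfun\<close> is the solution of the second summand with
  value 1 at 0. The denominator factors as
  \<open>(1 - x / golden_ratio) * (1 + x * golden_ratio)\<close>, with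
  \<open>1 / golden_ratio = golden_ratio - 1\<close>; partial fractions give the two exponents with
  denominator \<open>sqrt 5\<close>. This is how the golden ratio enters.\<close>

definition BF_gfun :: "real \<Rightarrow> real" where
  "BF_gfun x = exp (- ((golden_ratio - 1) / sqrt 5) * ln (1 - x * (golden_ratio - 1))
                    - (golden_ratio / sqrt 5) * ln (1 + x * golden_ratio))"

definition BF_h :: "real \<Rightarrow> real" where
  "BF_h x = x * BF_gfun x"

definition BF_K :: real where
  "BF_K = golden_ratio powr (- 2 / sqrt 5)"

lemma golden_ratio_sq: "golden_ratio ^ 2 = golden_ratio + 1"
  by (simp add: golden_ratio_def power2_eq_square field_simps)

lemma golden_ratio_bounds: "1 < golden_ratio" "golden_ratio < 2"
proof -
  have "1 < sqrt 5" by (rule real_less_rsqrt) simp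
  moreover have "sqrt 5 < 3" by (rule real_less_lsqrt) simp_all
  ultimately show "1 < golden_ratio" "golden_ratio < 2" by (simp_all add: golden_ratio_def)
qed

lemma sqrt5_golden: "sqrt 5 = 2 * golden_ratio - 1"
  by (simp add: golden_ratio_def add_divide_distrib)

lemma BF_gfun_pos: "BF_gfun x > 0"
  by (simp add: BF_gfun_def)

lemma BF_denom_ge_1: "0 \<le> x \<Longrightarrow> x \<le> 1 \<Longrightarrow> 1 \<le> 1 + x - x ^ 2" for x :: real
  using mult_left_mono[of x 1 x] by (simp add: power2_eq_square)

lemma exp_ln_combination_deriv:
  fixes a b u v x :: real
  assumes "1 - x * u > 0" "1 + x * v > 0"
  shows "((\<lambda>x. exp (- a * ln (1 - x * u) - b * ln (1 + x * v))) has_real_derivative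
    exp (- a * ln (1 - x * u) - b * ln (1 + x * v)) * (a * u / (1 - x * u) - b * v / (1 + x * v))) (at x)"
proof -
  have "((\<lambda>x. - a * ln (1 - x * u) - b * ln (1 + x * v)) has_real_derivative
     - a * (1 / (1 - x * u) * (- u)) - b * (1 / (1 + x * v) * v)) (at x)"
    using assms by (auto intro!: derivative_eq_intros simp del: times_divide_eq_left times_divide_eq_right)
  from DERIV_fun_exp[OF this] show ?thesis by simp
qed

lemma BF_gfun_deriv:
  assumes "0 \<le> x" "x \<le> 1"
  shows "(BF_gfun has_real_derivative BF_gfun x * (x - 1) / (1 + x - x ^ 2)) (at x)"
proof -
  let ?p = golden_ratio
  have s: "sqrt 5 = 2 * ?p - 1" by (rule sqrt5_golden)
  have s0: "2 * ?p - 1 > 0" using golden_ratio_bounds by simp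
  have "x * (?p - 1) \<le> 1 * (?p - 1)" using assms golden_ratio_bounds by (intro mult_right_mono) auto
  also have "1 * (?p - 1) < 1" using golden_ratio_bounds by simp
  finally have 1: "1 - x * (?p - 1) > 0" by simp
  have 2: "1 + x * ?p > 0" using assms golden_ratio_bounds by (simp add: add_pos_nonneg)
  have D: "(1 - x * (?p - 1)) * (1 + x * ?p) = 1 + x - x ^ 2"
  proof -
    have "(1 - x * (?p - 1)) * (1 + x * ?p) = 1 + x - x ^ 2 * (?p * (?p - 1))"
      by (simp add: algebra_simps power2_eq_square)
    also have "?p * (?p - 1) = 1" using golden_ratio_sq by (simp add: algebra_simps power2_eq_square)
    finally show ?thesis by simp
  qed
  have frac: "c / r * c / A - d / r * d / B = ((c ^ 2 * B - d ^ 2 * A) / r) / (A * B)"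
    if "A > 0" "B > 0" "r > 0" for A B c d r :: real
    using that by (simp add: field_simps power2_eq_square)
  have "(BF_gfun has_real_derivative BF_gfun x *
     ((?p - 1) / (2 * ?p - 1) * (?p - 1) / (1 - x * (?p - 1)) - ?p / (2 * ?p - 1) * ?p / (1 + x * ?p))) (at x)"
    unfolding BF_gfun_def[abs_def] s by (rule exp_ln_combination_deriv[OF 1 2])
  also have "(?p - 1) / (2 * ?p - 1) * (?p - 1) / (1 - x * (?p - 1)) - ?p / (2 * ?p - 1) * ?p / (1 + x * ?p)
    = (((?p - 1) ^ 2 * (1 + x * ?p) - ?p ^ 2 * (1 - x * (?p - 1))) / (2 * ?p - 1)) / ((1 - x * (?p - 1)) * (1 + x * ?p))"
    by (rule frac[OF 1 2 s0])
  also have "(?p - 1) ^ 2 * (1 + x * ?p) - ?p ^ 2 * (1 - x * (?p - 1)) = (x - 1) * (2 * ?p - 1)"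
  proof -
    have "(?p - 1) ^ 2 = 2 - ?p" using golden_ratio_sq by (simp add: power2_eq_square algebra_simps)
    then have "(?p - 1) ^ 2 * (1 + x * ?p) - ?p ^ 2 * (1 - x * (?p - 1)) =
       (2 - ?p) * (1 + x * ?p) - (?p + 1) * (1 - x * (?p - 1))" by (simp only: golden_ratio_sq)
    also have "\<dots> = 1 - 2 * ?p + x * (2 * ?p - 1)" by (simp add: algebra_simps)
    finally show ?thesis by (simp add: algebra_simps)
  qed
  also have "(x - 1) * (2 * ?p - 1) / (2 * ?p - 1) = x - 1" using s0 by simp
  finally show ?thesis unfolding D by simp
qed

lemma BF_gfun_0: "BF_gfun 0 = 1"
  by (simp add: BF_gfun_def)

text \<open>The linear factors at 1 are \<open>golden_ratio\<close> to the powers -2 and 2, so the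
  exponents add up to \<open>(2 * (golden_ratio - 1) - 2 * golden_ratio) / sqrt 5 = - 2 / sqrt
  5\<close>. The point 1 is the empty graph, where the process starts.\<close>

lemma BF_gfun_1: "BF_gfun 1 = BF_K"
proof -
  let ?p = golden_ratio
  have p: "?p > 1" "?p < 2" by (rule golden_ratio_bounds)+
  have 1: "1 - 1 * (?p - 1) = 1 / ?p ^ 2"
  proof -
    have "(2 - ?p) * (?p + 1) = 1" using golden_ratio_sq by (simp add: algebra_simps power2_eq_square)
    then have "(2 - ?p) = 1 / (?p + 1)" using p by (simp add: eq_divide_eq)
    then show ?thesis by (simp add: golden_ratio_sq)
  qed
  have 2: "1 + 1 * ?p = ?p ^ 2" by (simp add: golden_ratio_sq)
  have l: "ln (1 / ?p ^ 2) = - (2 * ln ?p)" "ln (?p ^ 2) = 2 * ln ?p"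
    using p by (simp_all add: ln_div ln_realpow)
  have "BF_gfun 1 = exp (- 2 / sqrt 5 * ln ?p)"
    unfolding BF_gfun_def 1 2 l by (simp add: field_simps)
  then show ?thesis using p by (simp add: BF_K_def powr_def)
qed

lemma BF_K_pos: "BF_K > 0"
  by (metis BF_gfun_1 BF_gfun_pos)

lemma BF_gfun_antimono:
  assumes "0 \<le> x" "x \<le> y" "y \<le> 1"
  shows "BF_gfun y \<le> BF_gfun x"
proof (rule DERIV_nonpos_imp_nonincreasing[OF assms(2)])
  fix z assume z: "x \<le> z" "z \<le> y"
  then have "0 \<le> z" "z \<le> 1" using assms by auto
  then show "\<exists>w. (BF_gfun has_real_derivative w) (at z) \<and> w \<le> 0"
    using BF_gfun_deriv[of z] BF_gfun_pos[of z] BF_denom_ge_1[of z]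
    by (intro exI[of _ "BF_gfun z * (z - 1) / (1 + z - z ^ 2)"]) (auto intro!: divide_nonpos_nonneg mult_nonneg_nonpos)
qed

lemma BF_gfun_le_1: "0 \<le> x \<Longrightarrow> x \<le> 1 \<Longrightarrow> BF_gfun x \<le> 1"
  using BF_gfun_antimono[of 0 x] by (simp add: BF_gfun_0)

lemma BF_gfun_ge:
  assumes "0 \<le> x" "x \<le> 1" shows "1 - x \<le> BF_gfun x"
proof -
  let ?f = "\<lambda>z. BF_gfun z + z"
  have "?f 0 \<le> ?f x"
  proof (rule DERIV_nonneg_imp_nondecreasing[OF assms(1)])
    fix z assume z: "0 \<le> z" "z \<le> x"
    then have z1: "z \<le> 1" using assms by simp
    have D: "1 \<le> 1 + z - z ^ 2" by (rule BF_denom_ge_1[OF z(1) z1])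
    have "BF_gfun z * (1 - z) \<le> 1 * 1"
      using BF_gfun_le_1[OF z(1) z1] z z1 BF_gfun_pos[of z] by (intro mult_mono) auto
    then have "BF_gfun z * (1 - z) / (1 + z - z ^ 2) \<le> 1" using D by (simp add: divide_le_eq)
    moreover have "BF_gfun z * (z - 1) / (1 + z - z ^ 2) = - (BF_gfun z * (1 - z) / (1 + z - z ^ 2))"
      by (simp add: algebra_simps diff_divide_distrib)
    ultimately have "0 \<le> BF_gfun z * (z - 1) / (1 + z - z ^ 2) + 1" by linarith
    moreover have "(?f has_real_derivative BF_gfun z * (z - 1) / (1 + z - z ^ 2) + 1) (at z)"
      using BF_gfun_deriv[OF z(1) z1] by (auto intro!: derivative_eq_intros)
    ultimately show "\<exists>y. (?f has_real_derivative y) (at z) \<and> 0 \<le> y" by blast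
  qed
  then show ?thesis by (simp add: BF_gfun_0)
qed

text \<open>In this form the differential equation
  \<open>2 * x * (1 + x - x^2) * BF_h' x = 2 * BF_h x\<close> is a cancellation, valid also at
  \<open>x = 0\<close>.\<close>

definition BF_h' :: "real \<Rightarrow> real" where
  "BF_h' x = BF_gfun x / (1 + x - x ^ 2)"

lemma BF_h_deriv:
  assumes "0 \<le> x" "x \<le> 1"
  shows "(BF_h has_real_derivative BF_h' x) (at x)"
proof -
  have D: "1 + x - x ^ 2 > 0" using BF_denom_ge_1[OF assms] by simp
  have "(BF_h has_real_derivative 1 * BF_gfun x + x * (BF_gfun x * (x - 1) / (1 + x - x ^ 2))) (at x)"
    unfolding BF_h_def[abs_def] using BF_gfun_deriv[OF assms]
    by (auto intro!: derivative_eq_intros)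
  also have "1 * BF_gfun x + x * (BF_gfun x * (x - 1) / (1 + x - x ^ 2)) = BF_h' x"
    using D by (simp add: BF_h'_def field_simps power2_eq_square)
  finally show ?thesis .
qed

lemma BF_h'_deriv:
  assumes "0 \<le> x" "x \<le> 1"
  shows "(BF_h' has_real_derivative BF_gfun x * (3 * x - 2) / (1 + x - x ^ 2) ^ 2) (at x)"
proof -
  have D: "1 + x - x ^ 2 > 0" using BF_denom_ge_1[OF assms] by simp
  have "(BF_h' has_real_derivative (BF_gfun x * (x - 1) / (1 + x - x ^ 2) * (1 + x - x ^ 2) - BF_gfun x * (1 - 2 * x)) /
     ((1 + x - x ^ 2) * (1 + x - x ^ 2))) (at x)"
    unfolding BF_h'_def[abs_def] using BF_gfun_deriv[OF assms] D
    by (auto intro!: derivative_eq_intros)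
  also have "BF_gfun x * (x - 1) / (1 + x - x ^ 2) * (1 + x - x ^ 2) - BF_gfun x * (1 - 2 * x) = BF_gfun x * (3 * x - 2)"
    using D by (simp add: right_diff_distrib[symmetric])
  also have "(1 + x - x ^ 2) * (1 + x - x ^ 2) = (1 + x - x ^ 2) ^ 2" by (simp only: power2_eq_square)
  finally show ?thesis .
qed

lemma BF_h'_bounds:
  assumes "0 \<le> x" "x \<le> 1"
  shows "0 \<le> BF_h' x" "BF_h' x \<le> 1"
  using BF_denom_ge_1[OF assms] BF_gfun_le_1[OF assms] BF_gfun_pos[of x]
  by (auto simp: BF_h'_def divide_le_eq)

lemma BF_h_diff_bounds:
  assumes "0 \<le> y" "y \<le> x" "x \<le> 1"
  shows "0 \<le> BF_h x - BF_h y" "BF_h x - BF_h y \<le> x - y"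
    "\<bar>BF_h x - BF_h y - (x - y) * BF_h' x\<bar> \<le> 2 * (x - y) ^ 2"
proof -
  have "0 \<le> BF_h x - BF_h y \<and> BF_h x - BF_h y \<le> x - y \<and> \<bar>BF_h x - BF_h y - (x - y) * BF_h' x\<bar> \<le> 2 * (x - y) ^ 2"
  proof (cases "y = x")
    case False
    then have "y < x" using assms by simp
    then obtain z where z: "y < z" "z < x" "BF_h x - BF_h y = (x - y) * BF_h' z"
      using MVT2[of y x BF_h BF_h'] BF_h_deriv assms by auto
    then obtain w where w: "z < w" "w < x"
      "BF_h' x - BF_h' z = (x - z) * (BF_gfun w * (3 * w - 2) / (1 + w - w ^ 2) ^ 2)"
      using MVT2[of z x BF_h' "\<lambda>w. BF_gfun w * (3 * w - 2) / (1 + w - w ^ 2) ^ 2"] BF_h'_deriv assms by auto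
    have w01: "0 \<le> w" "w \<le> 1" using w z assms by auto
    have D: "1 \<le> (1 + w - w ^ 2) ^ 2" using BF_denom_ge_1[OF w01] by (intro one_le_power) auto
    have "\<bar>BF_gfun w * (3 * w - 2)\<bar> \<le> 1 * 2"
      unfolding abs_mult using BF_gfun_le_1[OF w01] BF_gfun_pos[of w] w01 by (intro mult_mono) auto
    then have "\<bar>BF_gfun w * (3 * w - 2) / (1 + w - w ^ 2) ^ 2\<bar> \<le> 2"
      using D by (simp add: abs_divide divide_le_eq)
    then have "\<bar>BF_h' x - BF_h' z\<bar> \<le> (x - y) * 2"
      unfolding w(3) abs_mult using z w by (intro mult_mono) auto
    then have "(x - y) * \<bar>BF_h' x - BF_h' z\<bar> \<le> (x - y) * ((x - y) * 2)" using \<open>y < x\<close> by (intro mult_left_mono) auto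
    moreover have "\<bar>BF_h x - BF_h y - (x - y) * BF_h' x\<bar> = (x - y) * \<bar>BF_h' x - BF_h' z\<bar>"
    proof -
      have "BF_h x - BF_h y - (x - y) * BF_h' x = - ((x - y) * (BF_h' x - BF_h' z))"
        unfolding z(3) by (simp add: algebra_simps)
      then show ?thesis using \<open>y < x\<close> by (simp add: abs_mult)
    qed
    moreover have "0 \<le> BF_h' z" "BF_h' z \<le> 1" using BF_h'_bounds[of z] z assms by auto
    moreover have "(x - y) * BF_h' z \<le> (x - y) * 1"
      using \<open>BF_h' z \<le> 1\<close> \<open>y < x\<close> by (intro mult_left_mono) auto
    ultimately show ?thesis using \<open>y < x\<close> unfolding z(3) by (simp add: power2_eq_square mult_ac)
  qed simp
  then show "0 \<le> BF_h x - BF_h y" "BF_h x - BF_h y \<le> x - y"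
    "\<bar>BF_h x - BF_h y - (x - y) * BF_h' x\<bar> \<le> 2 * (x - y) ^ 2" by auto
qed

lemma BF_h_0: "BF_h 0 = 0" and BF_h_1: "BF_h 1 = BF_K"
  by (simp_all add: BF_h_def BF_gfun_1)

lemma BF_h_bounds:
  assumes "0 \<le> x" "x \<le> 1"
  shows "0 \<le> BF_h x" "BF_h x \<le> x" "x - BF_h x \<le> x ^ 2"
proof -
  show "0 \<le> BF_h x" "BF_h x \<le> x"
    using BF_h_diff_bounds[of 0 x] assms by (auto simp: BF_h_0)
  have "x * (1 - BF_gfun x) \<le> x * x" using BF_gfun_ge[OF assms] assms by (intro mult_left_mono) auto
  then show "x - BF_h x \<le> x ^ 2" by (simp add: BF_h_def algebra_simps power2_eq_square)
qed

section \<open>One-step estimates for the two near-martingales\<close>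

lemma exp_remainder:
  assumes "0 \<le> u" "u \<le> (2::real)"
  shows "\<bar>exp u - 1 - u\<bar> \<le> 2 * u ^ 2"
proof -
  define v where "v = u / 2"
  have v: "0 \<le> v" "v \<le> 1" using assms by (auto simp: v_def)
  have "exp u = exp v ^ 2" by (simp add: v_def exp_double[symmetric])
  also have "\<dots> \<le> (1 + v + v ^ 2) ^ 2"
    using exp_bound[OF v] by (intro power_mono) auto
  also have "\<dots> = 1 + 2 * v + 3 * v ^ 2 + 2 * v ^ 3 + v ^ 4"
    by (simp add: power2_eq_square power3_eq_cube power4_eq_xxxx algebra_simps)
  also have "\<dots> \<le> 1 + 2 * v + 3 * v ^ 2 + 2 * v ^ 2 + v ^ 2"
    using v power_decreasing[of 2 3 v] power_decreasing[of 2 4 v] by simp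
  finally have "exp u \<le> 1 + u + 3 * u ^ 2 / 2" by (simp add: v_def power_divide)
  then have "exp u - 1 - u \<le> 2 * u ^ 2" using zero_le_power2[of u] by linarith
  moreover have "exp u - 1 - u \<ge> 0" using exp_ge_add_one_self[of u] by linarith
  ultimately show ?thesis by simp
qed

lemma power_add_remainder:
  fixes z d :: real
  assumes "0 \<le> z" "0 \<le> d" "z + d \<le> 1"
  shows "\<bar>(z + d) ^ k - z ^ k - real k * d * z ^ (k - 1)\<bar> \<le> real k ^ 2 * d ^ 2 / 2"
proof -
  have "0 \<le> (z + d) ^ k - z ^ k - real k * d * z ^ (k - 1) \<and>
    (z + d) ^ k - z ^ k - real k * d * z ^ (k - 1) \<le> real k ^ 2 * d ^ 2 / 2"
  proof (induction k)
    case (Suc k)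
    define r where "r = (z + d) ^ k - z ^ k - real k * d * z ^ (k - 1)"
    have r: "0 \<le> r" "r \<le> real k ^ 2 * d ^ 2 / 2" using Suc by (auto simp: r_def)
    have zk: "z * (real k * z ^ (k - 1)) = real k * z ^ k" by (cases k) auto
    have "(z + d) ^ Suc k = (z + d) * (z ^ k + real k * d * z ^ (k - 1) + r)" by (simp add: r_def)
    also have "\<dots> = z ^ Suc k + real (Suc k) * d * z ^ k + (real k * d ^ 2 * z ^ (k - 1) + (z + d) * r)"
      using zk by (simp add: algebra_simps power2_eq_square)
    finally have eq: "(z + d) ^ Suc k - z ^ Suc k - real (Suc k) * d * z ^ (Suc k - 1) = real k * d ^ 2 * z ^ (k - 1) + (z + d) * r"
      by simp
    have "real k * d ^ 2 * z ^ (k - 1) \<le> real k * d ^ 2 * 1" "(z + d) * r \<le> 1 * (real k ^ 2 * d ^ 2 / 2)"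
      using assms r by (intro mult_left_mono mult_mono power_le_one; simp)+
    then have "real k * d ^ 2 * z ^ (k - 1) + (z + d) * r \<le> (real k + real k ^ 2 / 2) * d ^ 2"
      by (simp add: algebra_simps)
    also have "\<dots> \<le> (real (Suc k) ^ 2 / 2) * d ^ 2"
      by (intro mult_right_mono) (auto simp: power2_eq_square field_simps)
    finally show ?case unfolding eq using assms r by auto
  qed simp
  then show ?thesis by simp
qed

text \<open>The number of isolated vertices is itself a Markov chain, and this is its transition
  operator. The one-step estimates thus become statements about a single number
  \<open>k\<close>.\<close>

definition iso_step :: "nat \<Rightarrow> (nat \<Rightarrow> real) \<Rightarrow> nat \<Rightarrow> real" where
  "iso_step n f k = (let x = real k / real n in
    f k + 2 * x * (1 - x) * (1 - x ^ 2) * (f (k - 1) - f k) +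
    x * (x - 1 / real n) * (2 - x ^ 2) * (f (k - 2) - f k))"

definition phase1_fun :: "nat \<Rightarrow> real \<Rightarrow> nat \<Rightarrow> real" where
  "phase1_fun n t k = exp (- t * (real n * BF_h (real k / real n)))"

text \<open>Replacing \<open>t\<close> by \<open>t * (1 - 2 / n)\<close> multiplies the value by
  \<open>exp (2 * t * BF_h x)\<close>, and to first order the average over a round does the same.
  Three errors of order \<open>t * x / n\<close> remain, from the curvature of \<open>BF_h\<close>
  for jumps by one and by two and from loops (24 = 4 + 16 + 4), and three of order
  \<open>t^2 * x\<close>, from expanding the exponentials (28 = 4 + 16 + 8).\<close>

lemma phase1_step:
  assumes n: "n \<ge> 1" and k: "k \<le> n" and t: "0 \<le> t" "t \<le> 1"
  defines "x \<equiv> real k / real n"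
  shows "\<bar>iso_step n (phase1_fun n t) k - phase1_fun n (t * (1 - 2 / real n)) k\<bar> \<le> 24 * t * x / real n + 28 * t ^ 2 * x"
proof (cases "k = 0")
  case True
  then show ?thesis by (simp add: iso_step_def x_def phase1_fun_def BF_h_0)
next
  case False
  define H where "H j = real n * BF_h (real j / real n)" for j
  define V where "V = exp (- t * H k)"
  have k1: "1 \<le> real k" using False by simp
  have x: "0 < x" "x \<le> 1" "1 / real n \<le> x" using False k n by (auto simp: x_def field_simps)
  have V: "0 < V" "V \<le> 1"
    using BF_h_bounds(1)[of x] x t by (auto simp: V_def H_def x_def)
  have h01: "0 \<le> BF_h' x" "BF_h' x \<le> 1" using BF_h'_bounds[of x] x by auto
  have inc: "\<exists>e r. phase1_fun n t (k - j) - phase1_fun n t k = V * (t * (real j * BF_h' x + e) + r) \<and>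
      \<bar>e\<bar> \<le> 2 * real j ^ 2 / real n \<and> \<bar>r\<bar> \<le> 2 * t ^ 2 * real j ^ 2" if j: "j \<le> k" "j \<le> 2" for j
  proof -
    define D where "D = H k - H (k - j)"
    define y where "y = real (k - j) / real n"
    have y: "0 \<le> y" "y \<le> x" "x - y = real j / real n"
      using n j by (auto simp: y_def x_def of_nat_diff field_simps)
    have D_eq: "D = real n * (BF_h x - BF_h y)" by (simp add: D_def H_def x_def y_def algebra_simps)
    have nj: "real n * (x - y) = real j" using n by (simp add: y)
    have D0: "0 \<le> D" "D \<le> real j"
      using BF_h_diff_bounds(1,2)[OF y(1,2) x(2)] mult_left_mono[of "BF_h x - BF_h y" "x - y" "real n"] nj
      by (auto simp: D_eq)
    define e where "e = D - real j * BF_h' x"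
    have "e = real n * (BF_h x - BF_h y - (x - y) * BF_h' x)"
      unfolding e_def D_eq nj[symmetric] by (simp add: algebra_simps)
    then have "\<bar>e\<bar> \<le> real n * (2 * (x - y) ^ 2)"
      using BF_h_diff_bounds(3)[OF y(1,2) x(2)] by (simp add: abs_mult mult_left_mono)
    also have "\<dots> = 2 * real j ^ 2 / real n" using n by (simp add: y power2_eq_square)
    finally have e: "\<bar>e\<bar> \<le> 2 * real j ^ 2 / real n" .
    define r where "r = exp (t * D) - 1 - t * D"
    have tD: "0 \<le> t * D" "t * D \<le> 2" "(t * D) ^ 2 \<le> t ^ 2 * real j ^ 2"
    proof -
      show "0 \<le> t * D" using t D0 by simp
      have "t * D \<le> 1 * 2" using t D0 j by (intro mult_mono) auto
      then show "t * D \<le> 2" by simp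
      show "(t * D) ^ 2 \<le> t ^ 2 * real j ^ 2" unfolding power_mult_distrib
        using D0 by (intro mult_left_mono power_mono) auto
    qed
    have r: "\<bar>r\<bar> \<le> 2 * t ^ 2 * real j ^ 2"
      using exp_remainder[OF tD(1,2)] tD(3) by (simp add: r_def)
    have "phase1_fun n t (k - j) = V * exp (t * D)"
      by (simp add: phase1_fun_def V_def D_def H_def exp_add[symmetric] algebra_simps)
    moreover have "phase1_fun n t k = V" by (simp add: phase1_fun_def V_def H_def)
    ultimately have "phase1_fun n t (k - j) - phase1_fun n t k = V * (t * (real j * BF_h' x + e) + r)"
      by (simp add: r_def e_def algebra_simps)
    then show ?thesis using e r by blast
  qed
  define c1 where "c1 = 2 * x * (1 - x) * (1 - x ^ 2)"
  define c2 where "c2 = x * (x - 1 / real n) * (2 - x ^ 2)"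
  have x2: "0 \<le> x ^ 2" "x ^ 2 \<le> 1" using x by (auto intro: power_le_one)
  have c1: "0 \<le> c1" "c1 \<le> 2 * x"
  proof -
    show "0 \<le> c1" unfolding c1_def using x x2 by simp
    have "2 * x * (1 - x) * (1 - x ^ 2) \<le> 2 * x * 1 * 1" using x x2 by (intro mult_mono) auto
    then show "c1 \<le> 2 * x" by (simp add: c1_def)
  qed
  have c2: "0 \<le> c2" "c2 \<le> 2 * x"
  proof -
    show "0 \<le> c2" unfolding c2_def using x x2 by (auto intro!: mult_nonneg_nonneg)
    have "x * (x - 1 / real n) * (2 - x ^ 2) \<le> x * 1 * 2" using x x2 n
      by (intro mult_mono) (auto intro: order_trans[OF diff_left_mono[of 0]])
    then show "c2 \<le> 2 * x" by (simp add: c2_def)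
  qed
  obtain e1 r1 where 1: "phase1_fun n t (k - 1) - phase1_fun n t k = V * (t * (BF_h' x + e1) + r1)"
    "\<bar>e1\<bar> \<le> 2 / real n" "\<bar>r1\<bar> \<le> 2 * t ^ 2"
    using inc[of 1] k1 by auto
  \<comment> \<open>The factor \<open>c2\<close> stays on both sides because of
    \<open>k = 1\<close>: there \<open>k - 2\<close> truncates to 0, which is not a jump by two, but
    \<open>c2\<close> vanishes.\<close>
  obtain e2 r2 where 2: "c2 * (phase1_fun n t (k - 2) - phase1_fun n t k) = c2 * (V * (t * (2 * BF_h' x + e2) + r2))"
    "\<bar>e2\<bar> \<le> 8 / real n" "\<bar>r2\<bar> \<le> 8 * t ^ 2"
  proof (cases "k \<ge> 2")
    case True
    then show ?thesis using inc[of 2] that by auto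
  next
    case False
    then have "k = 1" using \<open>k \<noteq> 0\<close> by simp
    then have "c2 = 0" by (simp add: c2_def x_def)
    then show ?thesis using that[of 0 0] by simp
  qed
  \<comment> \<open>The mean decrease \<open>c1 + 2 * c2\<close> is
    \<open>2 * x * (1 + x - x^2)\<close> up to loops, so the equation for \<open>BF_h\<close> turns
    the drift into \<open>2 * BF_h x\<close>.\<close>
  have m: "(c1 + 2 * c2) * BF_h' x = 2 * BF_h x - 2 * x * (2 - x ^ 2) * BF_h' x / real n"
  proof -
    have D: "1 + x - x ^ 2 > 0" using BF_denom_ge_1[of x] x by simp
    have "c1 + 2 * c2 = 2 * x * (1 + x - x ^ 2) - 2 * x * (2 - x ^ 2) / real n"
      unfolding c1_def c2_def by (simp add: algebra_simps power2_eq_square diff_divide_distrib)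
    moreover have "2 * x * (1 + x - x ^ 2) * BF_h' x = 2 * BF_h x"
      using D by (simp add: BF_h'_def BF_h_def)
    ultimately show ?thesis by (simp only: left_diff_distrib times_divide_eq_left)
  qed
  define R where "R = exp (2 * t * BF_h x) - 1 - 2 * t * BF_h x"
  have hx: "0 \<le> BF_h x" "BF_h x \<le> x" using BF_h_bounds[of x] x by auto
  have R: "\<bar>R\<bar> \<le> 8 * t ^ 2 * x"
  proof -
    have "t * BF_h x \<le> 1 * 1" using t hx x by (intro mult_mono) auto
    then have "\<bar>R\<bar> \<le> 2 * (2 * t * BF_h x) ^ 2"
      unfolding R_def using exp_remainder[of "2 * t * BF_h x"] t hx by (simp add: mult.assoc)
    also have "\<dots> = 8 * t ^ 2 * (BF_h x * BF_h x)" by (simp add: power2_eq_square)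
    also have "BF_h x * BF_h x \<le> x * 1" using hx x by (intro mult_mono) auto
    finally show ?thesis by (simp add: mult_left_mono)
  qed
  have V': "phase1_fun n (t * (1 - 2 / real n)) k = V * (1 + 2 * t * BF_h x + R)"
  proof -
    have "phase1_fun n (t * (1 - 2 / real n)) k = V * exp (2 * t * BF_h x)"
      using n by (simp add: phase1_fun_def V_def H_def x_def exp_add[symmetric] field_simps)
    then show ?thesis by (simp add: R_def)
  qed
  define err where "err = t * (c1 * e1 + c2 * e2 - 2 * x * (2 - x ^ 2) * BF_h' x / real n) + (c1 * r1 + c2 * r2) - R"
  have "iso_step n (phase1_fun n t) k = V + c1 * (phase1_fun n t (k - 1) - phase1_fun n t k)
      + c2 * (phase1_fun n t (k - 2) - phase1_fun n t k)"
    unfolding iso_step_def Let_def x_def[symmetric] c1_def c2_def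
    by (simp add: phase1_fun_def V_def H_def)
  also have "\<dots> = V * (1 + t * ((c1 + 2 * c2) * BF_h' x) + t * (c1 * e1 + c2 * e2) + (c1 * r1 + c2 * r2))"
    unfolding 1(1) 2(1) by (simp add: algebra_simps)
  finally have "iso_step n (phase1_fun n t) k - phase1_fun n (t * (1 - 2 / real n)) k = V * err"
    unfolding m V' err_def by (simp add: algebra_simps)
  moreover have "\<bar>err\<bar> \<le> 24 * t * x / real n + 28 * t ^ 2 * x"
  proof -
    have a1: "\<bar>c1 * e1\<bar> \<le> (2 * x) * (2 / real n)" unfolding abs_mult using c1 1(2) x by (intro mult_mono) auto
    have a2: "\<bar>c2 * e2\<bar> \<le> (2 * x) * (8 / real n)" unfolding abs_mult using c2 2(2) x by (intro mult_mono) auto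
    have a3: "\<bar>2 * x * (2 - x ^ 2) * BF_h' x / real n\<bar> \<le> 2 * x * 2 * 1 / real n"
    proof -
      have "0 \<le> 2 * x * (2 - x ^ 2) * BF_h' x / real n" using x x2 h01 by simp
      moreover have "2 * x * (2 - x ^ 2) * BF_h' x / real n \<le> 2 * x * 2 * 1 / real n"
        using x x2 h01 by (intro divide_right_mono mult_mono) auto
      ultimately show ?thesis by linarith
    qed
    have a4: "\<bar>c1 * r1\<bar> \<le> (2 * x) * (2 * t ^ 2)" unfolding abs_mult using c1 1(3) x by (intro mult_mono) auto
    have a5: "\<bar>c2 * r2\<bar> \<le> (2 * x) * (8 * t ^ 2)" unfolding abs_mult using c2 2(3) x by (intro mult_mono) auto
    have "\<bar>c1 * e1 + c2 * e2 - 2 * x * (2 - x ^ 2) * BF_h' x / real n\<bar> \<le> (2 * x) * (2 / real n) + (2 * x) * (8 / real n) + 2 * x * 2 * 1 / real n"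
      using a1 a2 a3 by linarith
    also have "\<dots> = 24 * x / real n" using n by (simp add: field_simps)
    finally have a0: "\<bar>t * (c1 * e1 + c2 * e2 - 2 * x * (2 - x ^ 2) * BF_h' x / real n)\<bar> \<le> t * (24 * x / real n)"
      unfolding abs_mult using t by (intro mult_mono) auto
    have err_le: "\<bar>err\<bar> \<le> t * (24 * x / real n) + ((2 * x) * (2 * t ^ 2) + (2 * x) * (8 * t ^ 2)) + 8 * t ^ 2 * x"
    proof -
      have "\<bar>u + (v + w) - r\<bar> \<le> a + (b + c) + d" if "\<bar>u\<bar> \<le> a" "\<bar>v\<bar> \<le> b" "\<bar>w\<bar> \<le> c" "\<bar>r\<bar> \<le> d"
        for u v w r a b c d :: real using that by linarith
      from this[OF a0 a4 a5 R] show ?thesis unfolding err_def .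
    qed
    then show ?thesis by (simp add: algebra_simps)
  qed
  moreover have "V * \<bar>err\<bar> \<le> 1 * \<bar>err\<bar>" using V by (intro mult_right_mono) auto
  ultimately show ?thesis using V by (simp add: abs_mult)
qed

text \<open>If every isolated vertex disappeared independently with probability
  \<open>2 / n\<close>, the average over a round would be exactly
  \<open>(1 - q * (1 - 2 / n)) ^ k\<close>. The deviation comes from \<open>c1\<close> differing
  from \<open>2 * x\<close> (4), from losing two vertices at once (2), and from the second-order
  remainder of the power (2); the sum is 8.\<close>

lemma phase2_step:
  assumes n: "n \<ge> 2" and k: "k \<le> n" and q: "0 \<le> q" "q \<le> 1"
  defines "x \<equiv> real k / real n"
  shows "\<bar>iso_step n (\<lambda>k. (1 - q) ^ k) k - (1 - q * (1 - 2 / real n)) ^ k\<bar> \<le> 8 * x ^ 2"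
proof (cases "k = 0")
  case True
  then show ?thesis by (simp add: iso_step_def x_def)
next
  case False
  define z where "z = 1 - q"
  define d where "d = 2 / real n * q"
  have z: "0 \<le> z" "z \<le> 1" using q by (auto simp: z_def)
  have d: "0 \<le> d" "d \<le> 2 / real n" "z + d \<le> 1"
  proof -
    have "2 / real n * q \<le> 1 * q" "2 / real n * q \<le> 2 / real n * 1"
      using q n by (intro mult_right_mono mult_left_mono; simp)+
    then show "0 \<le> d" "d \<le> 2 / real n" "z + d \<le> 1" using q by (auto simp: d_def z_def)
  qed
  have x: "0 < x" "x \<le> 1" "1 / real n \<le> x" using False k n by (auto simp: x_def field_simps)
  have x2: "0 \<le> x ^ 2" "x ^ 2 \<le> 1" using x by (auto intro: power_le_one)
  define c1 where "c1 = 2 * x * (1 - x) * (1 - x ^ 2)"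
  define c2 where "c2 = x * (x - 1 / real n) * (2 - x ^ 2)"
  have c1: "\<bar>c1 - 2 * x\<bar> \<le> 4 * x ^ 2"
  proof -
    have "2 * x - c1 = 2 * x * (x + x ^ 2 - x ^ 2 * x)" by (simp add: c1_def algebra_simps power2_eq_square)
    moreover have "0 \<le> x + x ^ 2 - x ^ 2 * x" "x + x ^ 2 - x ^ 2 * x \<le> 2 * x"
    proof -
      have "x ^ 2 * x \<le> x ^ 2 * 1" using x by (intro mult_left_mono) auto
      then show "0 \<le> x + x ^ 2 - x ^ 2 * x" using x by linarith
      have "x ^ 2 \<le> x" "0 \<le> x ^ 2 * x" using x mult_left_mono[of x 1 x] by (auto simp: power2_eq_square)
      then show "x + x ^ 2 - x ^ 2 * x \<le> 2 * x" by simp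
    qed
    ultimately have "0 \<le> 2 * x - c1" "2 * x - c1 \<le> 2 * x * (2 * x)"
      using x by (auto intro!: mult_left_mono)
    then show ?thesis by (simp add: power2_eq_square)
  qed
  have c2: "0 \<le> c2" "c2 \<le> 2 * x ^ 2"
  proof -
    show "0 \<le> c2" unfolding c2_def using x x2 by (auto intro!: mult_nonneg_nonneg)
    have "x * (x - 1 / real n) * (2 - x ^ 2) \<le> x * x * 2" using x x2 n
      by (intro mult_mono) auto
    then show "c2 \<le> 2 * x ^ 2" by (simp add: c2_def power2_eq_square)
  qed
  have diff: "\<bar>z ^ i - z ^ k\<bar> \<le> 1" for i
    using z power_le_one[of z i] power_le_one[of z k] zero_le_power[of z i] zero_le_power[of z k] by linarith
  have main: "2 * x * (z ^ (k - 1) - z ^ k) = real k * d * z ^ (k - 1)"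
  proof -
    define w where "w = z ^ (k - 1)"
    have "z ^ k = z * w" using False by (cases k) (auto simp: w_def)
    then have "w - z ^ k = q * w" by (simp add: z_def algebra_simps)
    then show ?thesis unfolding w_def[symmetric] by (simp add: x_def d_def)
  qed
  have rem: "\<bar>(z + d) ^ k - z ^ k - real k * d * z ^ (k - 1)\<bar> \<le> 2 * x ^ 2"
  proof -
    have "\<bar>(z + d) ^ k - z ^ k - real k * d * z ^ (k - 1)\<bar> \<le> real k ^ 2 * d ^ 2 / 2"
      by (rule power_add_remainder[OF z(1) d(1,3)])
    also have "\<dots> \<le> real k ^ 2 * (2 / real n) ^ 2 / 2"
      using d by (intro divide_right_mono mult_left_mono power_mono) auto
    finally show ?thesis by (simp add: x_def power_divide)
  qed
  have eq: "iso_step n (\<lambda>k. (1 - q) ^ k) k - (1 - q * (1 - 2 / real n)) ^ k =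
     (c1 - 2 * x) * (z ^ (k - 1) - z ^ k) + c2 * (z ^ (k - 2) - z ^ k) - ((z + d) ^ k - z ^ k - real k * d * z ^ (k - 1))"
  proof -
    have zd: "1 - q * (1 - 2 / real n) = z + d" by (simp add: z_def d_def algebra_simps)
    have step_eq: "iso_step n (\<lambda>k. (1 - q) ^ k) k = z ^ k + c1 * (z ^ (k - 1) - z ^ k) + c2 * (z ^ (k - 2) - z ^ k)"
      unfolding iso_step_def Let_def x_def[symmetric] c1_def c2_def z_def ..
    show ?thesis unfolding zd step_eq main[symmetric] by (simp add: algebra_simps)
  qed
  have b1: "\<bar>(c1 - 2 * x) * (z ^ (k - 1) - z ^ k)\<bar> \<le> 4 * x ^ 2 * 1"
    unfolding abs_mult by (intro mult_mono c1 diff) auto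
  have b2: "\<bar>c2 * (z ^ (k - 2) - z ^ k)\<bar> \<le> 2 * x ^ 2 * 1"
    unfolding abs_mult using c2 diff by (intro mult_mono) auto
  show ?thesis unfolding eq using b1 b2 rem by linarith
qed

section \<open>Moments of the number of isolated vertices\<close>

lemma BF_avg_iso_step:
  "n \<ge> 1 \<Longrightarrow> BF_avg n (\<lambda>E. f (iso_count n E)) E = iso_step n f (iso_count n E)"
  by (simp add: BF_avg_iso_count iso_step_def Let_def)

text \<open>A near-martingale drifts by at most the sum of its expected one-step errors. The bound
  \<open>e\<close> may depend on the graph, so that small moments of the number of isolated vertices
  can be exploited.\<close>

lemma BF_telescope:
  fixes f e :: "nat \<Rightarrow> nat set set \<Rightarrow> real"
  assumes n: "n \<ge> 1" and "L \<le> M"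
    and step: "\<And>N E. L \<le> N \<Longrightarrow> N < M \<Longrightarrow> \<bar>BF_avg n (f (Suc N)) E - f N E\<bar> \<le> e N E"
  shows "\<bar>(\<integral>\<omega>. f M (BF_graph \<omega> M) \<partial>BF_space n) - (\<integral>\<omega>. f L (BF_graph \<omega> L) \<partial>BF_space n)\<bar>
    \<le> (\<Sum>N\<in>{L..<M}. \<integral>\<omega>. e N (BF_graph \<omega> N) \<partial>BF_space n)"
  using \<open>L \<le> M\<close> step
proof (induction M rule: dec_induct)
  case (step M)
  let ?E = "\<lambda>N f. \<integral>\<omega>. f (BF_graph \<omega> N) \<partial>BF_space n"
  note int = BF_graph_integrable[OF n, where N = M]
  have "?E (Suc M) (f (Suc M)) - ?E M (f M) = ?E M (\<lambda>E. BF_avg n (f (Suc M)) E - f M E)"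
    using BF_Markov[OF n, of "f (Suc M)" M] int[of "BF_avg n (f (Suc M))"] int[of "f M"] by simp
  also have "\<bar>\<dots>\<bar> \<le> ?E M (\<lambda>E. \<bar>BF_avg n (f (Suc M)) E - f M E\<bar>)"
    by (rule integral_abs_bound)
  also have "\<dots> \<le> ?E M (e M)"
    using step.hyps by (intro integral_mono int[where f = "e M"] int[where f = "\<lambda>E. \<bar>BF_avg n (f (Suc M)) E - f M E\<bar>"] step.prems) auto
  finally have 1: "\<bar>?E (Suc M) (f (Suc M)) - ?E M (f M)\<bar> \<le> ?E M (e M)" .
  have "\<bar>?E M (f M) - ?E L (f L)\<bar> \<le> (\<Sum>N\<in>{L..<M}. ?E N (e N))"
    using step by auto
  then show ?case using 1 step.hyps by (simp add: sum.atLeastLessThan_Suc)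
qed simp

lemma isolated_cut_free: "isolated E u \<Longrightarrow> isolated E v \<Longrightarrow> cut_free {u, v} E"
  by (auto simp: isolated_def cut_free_def)

lemma iso_count_eq: "real (iso_count n E) = (\<Sum>v\<in>{1..n}. of_bool (isolated E v))"
  by (simp add: iso_count_def iso_set_def Int_def)

lemma cut_weight_ge: "of_bool (cut_free S E) \<le> cut_weight n S E"
  by (simp add: cut_weight_def)

lemma expectation_iso_count:
  assumes n: "n \<ge> 1"
  shows "(\<integral>\<omega>. real (iso_count n (BF_graph \<omega> N)) \<partial>BF_space n) \<le> real n * (exp 1 * cut_rate n 1 ^ N)"
proof -
  note int = BF_graph_integrable[OF n, where N = N]
  have le: "real (iso_count n E) \<le> (\<Sum>v\<in>{1..n}. cut_weight n {v} E)" for E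
    unfolding iso_count_eq
  proof (intro sum_mono)
    fix v
    have "of_bool (isolated E v) \<le> (of_bool (cut_free {v} E) :: real)"
      using isolated_cut_free[of E v v] by simp
    then show "of_bool (isolated E v) \<le> cut_weight n {v} E" using cut_weight_ge order_trans by blast
  qed
  have "(\<integral>\<omega>. real (iso_count n (BF_graph \<omega> N)) \<partial>BF_space n) \<le> (\<integral>\<omega>. (\<Sum>v\<in>{1..n}. cut_weight n {v} (BF_graph \<omega> N)) \<partial>BF_space n)"
    by (intro integral_mono le int[where f = "\<lambda>E. real (iso_count n E)"] int[where f = "\<lambda>E. \<Sum>v\<in>{1..n}. cut_weight n {v} E"])
  also have "\<dots> = (\<Sum>v\<in>{1..n}. \<integral>\<omega>. cut_weight n {v} (BF_graph \<omega> N) \<partial>BF_space n)"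
    by (intro Bochner_Integration.integral_sum int)
  also have "\<dots> \<le> (\<Sum>v\<in>{1..n}. exp 1 * cut_rate n 1 ^ N)"
  proof (intro sum_mono)
    fix v assume "v \<in> {1..n}"
    then show "(\<integral>\<omega>. cut_weight n {v} (BF_graph \<omega> N) \<partial>BF_space n) \<le> exp 1 * cut_rate n 1 ^ N"
      using expectation_cut_weight[OF n, of "{v}" N] by simp
  qed
  finally show ?thesis by simp
qed

text \<open>The factorial moment counts ordered pairs of distinct isolated vertices, and each such
  pair is a two-element set without boundary edges. Leaving out the diagonal matters: the decay for
  \<open>s = 2\<close> is about the square of that for \<open>s = 1\<close>, and diagonal terms
  would decay only at the slower rate.\<close>

lemma expectation_iso_pairs:
  assumes n: "n \<ge> 1"
  shows "(\<integral>\<omega>. real (iso_count n (BF_graph \<omega> N)) * (real (iso_count n (BF_graph \<omega> N)) - 1) \<partial>BF_space n)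
    \<le> real n ^ 2 * (exp 2 * cut_rate n 2 ^ N)"
proof -
  let ?V = "{1..n}" and ?w = "\<lambda>u v E. if u = v then 0 else cut_weight n {u, v} E"
  note int = BF_graph_integrable[OF n, where N = N]
  have le: "real (iso_count n E) * (real (iso_count n E) - 1) \<le> (\<Sum>u\<in>?V. \<Sum>v\<in>?V. ?w u v E)" for E
  proof -
    have "real (iso_count n E) * (real (iso_count n E) - 1) =
       (\<Sum>u\<in>?V. \<Sum>v\<in>?V. of_bool (isolated E u) * of_bool (isolated E v)) - (\<Sum>u\<in>?V. of_bool (isolated E u))"
      unfolding iso_count_eq by (simp only: sum_distrib_left sum_distrib_right right_diff_distrib mult_1_right)
        (subst sum.swap, rule refl)
    also have "(\<Sum>u\<in>?V. of_bool (isolated E u)) = (\<Sum>u\<in>?V. \<Sum>v\<in>?V. if u = v then of_bool (isolated E u) else (0::real))"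
      by (intro sum.cong refl) (simp add: sum.delta)
    also have "(\<Sum>u\<in>?V. \<Sum>v\<in>?V. of_bool (isolated E u) * of_bool (isolated E v)) - \<dots> =
       (\<Sum>u\<in>?V. \<Sum>v\<in>?V. of_bool (isolated E u) * of_bool (isolated E v) - (if u = v then of_bool (isolated E u) else (0::real)))"
      by (simp only: sum_subtractf)
    also have "\<dots> \<le> (\<Sum>u\<in>?V. \<Sum>v\<in>?V. ?w u v E)"
    proof (intro sum_mono)
      fix u v
      have "of_bool (isolated E u \<and> isolated E v) \<le> (of_bool (cut_free {u, v} E) :: real)"
        using isolated_cut_free[of E u v] by simp
      then have "of_bool (isolated E u \<and> isolated E v) \<le> cut_weight n {u, v} E" using cut_weight_ge order_trans by blast
      then show "of_bool (isolated E u) * of_bool (isolated E v) - (if u = v then of_bool (isolated E u) else 0) \<le> ?w u v E"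
        by (auto simp: of_bool_conj)
    qed
    finally show ?thesis .
  qed
  have "(\<integral>\<omega>. real (iso_count n (BF_graph \<omega> N)) * (real (iso_count n (BF_graph \<omega> N)) - 1) \<partial>BF_space n)
      \<le> (\<integral>\<omega>. (\<Sum>u\<in>?V. \<Sum>v\<in>?V. ?w u v (BF_graph \<omega> N)) \<partial>BF_space n)"
    by (intro integral_mono le int[where f = "\<lambda>E. real (iso_count n E) * (real (iso_count n E) - 1)"] int[where f = "\<lambda>E. \<Sum>u\<in>?V. \<Sum>v\<in>?V. ?w u v E"])
  also have "\<dots> = (\<Sum>u\<in>?V. \<integral>\<omega>. (\<Sum>v\<in>?V. ?w u v (BF_graph \<omega> N)) \<partial>BF_space n)"
    by (intro Bochner_Integration.integral_sum int[where f = "\<lambda>E. \<Sum>v\<in>?V. ?w u v E" for u])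
  also have "\<dots> = (\<Sum>u\<in>?V. \<Sum>v\<in>?V. \<integral>\<omega>. ?w u v (BF_graph \<omega> N) \<partial>BF_space n)"
    by (intro sum.cong refl Bochner_Integration.integral_sum int[where f = "\<lambda>E. ?w u v E" for u v])
  also have "\<dots> \<le> (\<Sum>u\<in>?V. \<Sum>v\<in>?V. exp 2 * cut_rate n 2 ^ N)"
  proof (intro sum_mono)
    fix u v assume uv: "u \<in> ?V" "v \<in> ?V"
    show "(\<integral>\<omega>. ?w u v (BF_graph \<omega> N) \<partial>BF_space n) \<le> exp 2 * cut_rate n 2 ^ N"
      using expectation_cut_weight[OF n, of "{u, v}" N] uv cut_rate_nonneg[OF n, of 2] by (cases "u = v") (auto simp: numeral_2_eq_2)
  qed
  finally show ?thesis by (simp add: power2_eq_square)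
qed

text \<open>The exponent \<open>2 * s * N * (n - s - 1) / n^2\<close> falls short of
  \<open>2 * s * N / n\<close> by \<open>2 * s * (s + 1) * N / n^2\<close>, which is bounded as long
  as \<open>N \<le> n^2\<close>. The resulting constant is harmless for fixed \<open>s\<close>; the
  union bound over large sets keeps the exact exponent instead.\<close>

lemma cut_rate_power_le:
  assumes n: "n \<ge> 1" and N: "real N \<le> real n ^ 2"
  shows "cut_rate n s ^ N \<le> exp (2 * real s * (real s + 1)) * exp (- (2 * real s * real N / real n))"
proof -
  have "cut_rate n s \<le> exp (- (2 * real s * (real n - real s - 1) / real n ^ 2))"
    using exp_ge_add_one_self[of "- (2 * real s * (real n - real s - 1) / real n ^ 2)"] by (simp add: cut_rate_def)
  then have "cut_rate n s ^ N \<le> exp (- (2 * real s * (real n - real s - 1) / real n ^ 2)) ^ N"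
    by (intro power_mono cut_rate_nonneg n)
  also have "\<dots> = exp (2 * real s * (real s + 1) * (real N / real n ^ 2) + - (2 * real s * real N / real n))"
    using n by (simp add: exp_of_nat_mult[symmetric] field_simps power2_eq_square)
  also have "\<dots> \<le> exp (2 * real s * (real s + 1) * 1 + - (2 * real s * real N / real n))"
  proof -
    have "real N / real n ^ 2 \<le> 1" using N n by (simp add: divide_le_eq)
    then have "2 * real s * (real s + 1) * (real N / real n ^ 2) \<le> 2 * real s * (real s + 1) * 1"
      by (intro mult_left_mono) auto
    then show ?thesis by simp
  qed
  finally show ?thesis by (simp only: exp_add mult_1_right)
qed

text \<open>The constants are 5 = 1 + 4 and 14 = 2 + 12: the cut weight of \<open>s\<close> vertices
  costs \<open>exp s\<close>, and \<open>cut_rate_power_le\<close> costs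
  \<open>exp (2 * s * (s + 1))\<close>.\<close>

lemma expectation_iso_fraction:
  assumes n: "n \<ge> 1" and N: "real N \<le> real n ^ 2"
  shows "(\<integral>\<omega>. real (iso_count n (BF_graph \<omega> N)) / real n \<partial>BF_space n) \<le> exp 5 * exp (- (2 * real N / real n))"
    and "(\<integral>\<omega>. (real (iso_count n (BF_graph \<omega> N)) / real n) ^ 2 \<partial>BF_space n) \<le>
      exp 5 * exp (- (2 * real N / real n)) / real n + exp 14 * exp (- (4 * real N / real n))"
proof -
  note int = BF_graph_integrable[OF n, where N = N]
  let ?X = "\<lambda>\<omega>. real (iso_count n (BF_graph \<omega> N))"
  have "(\<integral>\<omega>. ?X \<omega> \<partial>BF_space n) \<le> real n * (exp 1 * cut_rate n 1 ^ N)" by (rule expectation_iso_count[OF n])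
  also have "\<dots> \<le> real n * (exp 1 * (exp 4 * exp (- (2 * real N / real n))))"
    using cut_rate_power_le[OF n N, of 1] by (intro mult_left_mono) auto
  also have "\<dots> = real n * (exp 5 * exp (- (2 * real N / real n)))"
    by (simp add: mult.assoc[symmetric] exp_add[symmetric])
  finally have 1: "(\<integral>\<omega>. ?X \<omega> \<partial>BF_space n) \<le> real n * (exp 5 * exp (- (2 * real N / real n)))" .
  then show "(\<integral>\<omega>. ?X \<omega> / real n \<partial>BF_space n) \<le> exp 5 * exp (- (2 * real N / real n))"
    using n by (simp add: divide_le_eq mult_ac)
  have "(\<integral>\<omega>. ?X \<omega> * (?X \<omega> - 1) \<partial>BF_space n) \<le> real n ^ 2 * (exp 2 * cut_rate n 2 ^ N)"
    by (rule expectation_iso_pairs[OF n])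
  also have "\<dots> \<le> real n ^ 2 * (exp 2 * (exp 12 * exp (- (4 * real N / real n))))"
    using cut_rate_power_le[OF n N, of 2] by (intro mult_left_mono) auto
  also have "\<dots> = real n ^ 2 * (exp 14 * exp (- (4 * real N / real n)))"
    by (simp add: mult.assoc[symmetric] exp_add[symmetric])
  finally have 2: "(\<integral>\<omega>. ?X \<omega> * (?X \<omega> - 1) \<partial>BF_space n) \<le> real n ^ 2 * (exp 14 * exp (- (4 * real N / real n)))" .
  have "(\<integral>\<omega>. (?X \<omega> / real n) ^ 2 \<partial>BF_space n) = (\<integral>\<omega>. (?X \<omega> * (?X \<omega> - 1) + ?X \<omega>) / real n ^ 2 \<partial>BF_space n)"
    by (simp add: power_divide power2_eq_square algebra_simps)
  also have "\<dots> = ((\<integral>\<omega>. ?X \<omega> * (?X \<omega> - 1) \<partial>BF_space n) + (\<integral>\<omega>. ?X \<omega> \<partial>BF_space n)) / real n ^ 2"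
    using int[of "\<lambda>E. real (iso_count n E) * (real (iso_count n E) - 1)"] int[of "\<lambda>E. real (iso_count n E)"] by simp
  also have "\<dots> \<le> (real n ^ 2 * (exp 14 * exp (- (4 * real N / real n))) + real n * (exp 5 * exp (- (2 * real N / real n)))) / real n ^ 2"
    by (intro divide_right_mono add_mono 1 2) simp
  also have "\<dots> = exp 5 * exp (- (2 * real N / real n)) / real n + exp 14 * exp (- (4 * real N / real n))"
    using n by (simp add: field_simps power2_eq_square)
  finally show "(\<integral>\<omega>. (?X \<omega> / real n) ^ 2 \<partial>BF_space n) \<le>
      exp 5 * exp (- (2 * real N / real n)) / real n + exp 14 * exp (- (4 * real N / real n))" .
qed

section \<open>The law of the number of isolated vertices\<close>

lemma one_minus_power_le_exp:
  assumes "n \<ge> 2"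
  shows "(1 - 2 / real n) ^ j \<le> exp (- (2 * real j / real n))"
proof -
  have "(1 - 2 / real n) ^ j \<le> exp (- (2 / real n)) ^ j"
    using assms exp_ge_add_one_self[of "- (2 / real n)"] by (intro power_mono) auto
  then show ?thesis by (simp add: exp_of_nat_mult[symmetric] mult_ac)
qed

lemma geometric_exp_sum:
  assumes "n \<ge> 1"
  shows "(\<Sum>N<M. exp (- (2 * real (M - N) / real n))) \<le> real n / 2"
proof -
  define z where "z = exp (- (2 / real n))"
  have z: "0 < z" "z < 1" using assms by (auto simp: z_def)
  have "(\<Sum>N<M. exp (- (2 * real (M - N) / real n))) = (\<Sum>N<M. z ^ (M - N))"
    by (simp add: z_def exp_of_nat_mult[symmetric] mult_ac)
  also have "\<dots> = (\<Sum>j<M. z ^ Suc j)"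
    by (rule sum.reindex_bij_witness[of _ "\<lambda>j. M - Suc j" "\<lambda>N. M - Suc N"]) (auto simp: Suc_diff_Suc)
  also have "\<dots> = z * (\<Sum>j<M. z ^ j)" by (simp add: sum_distrib_left)
  also have "\<dots> = z * ((1 - z ^ M) / (1 - z))" using z by (simp add: sum_gp_strict)
  also have "\<dots> \<le> z * (1 / (1 - z))" using z by (intro mult_left_mono divide_right_mono) auto
  also have "\<dots> \<le> real n / 2"
  proof -
    have "1 + 2 / real n \<le> exp (2 / real n)" using exp_ge_add_one_self by simp
    also have "exp (2 / real n) = 1 / z" by (simp add: z_def exp_minus field_simps)
    finally have "z * (1 + 2 / real n) \<le> 1" using z by (simp add: field_simps)
    then have "z * 2 / real n \<le> 1 - z" by (simp add: algebra_simps)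
    then show ?thesis using z assms by (simp add: field_simps)
  qed
  finally show ?thesis .
qed

text \<open>The parameter at time \<open>N\<close> is \<open>t * (1 - 2 / n) ^ (M - N)\<close>,
  growing to \<open>t\<close> at time \<open>M\<close>; at time 0 the value is deterministic because
  all vertices are isolated. The parameter is about \<open>t * exp (- 2 * (M - N) / n)\<close> and
  the expected fraction \<open>x\<close> at most of order \<open>exp (- 2 * N / n)\<close>, so their
  product is the same in each round. Hence the errors linear in \<open>t\<close> sum to the term
  with \<open>M / n\<close>, while those in \<open>t^2\<close> carry one more geometric factor,
  whose sum is at most \<open>n / 2\<close>.\<close>

lemma phase1:
  assumes n: "n \<ge> 2" and M: "real M \<le> real n ^ 2" and t: "0 \<le> t" "t \<le> 1"
  shows "\<bar>(\<integral>\<omega>. phase1_fun n t (iso_count n (BF_graph \<omega> M)) \<partial>BF_space n) - exp (- (t * (1 - 2 / real n) ^ M * (real n * BF_K)))\<bar>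
    \<le> 24 * exp 7 * exp (- (2 * real M / real n)) * (t ^ 2 * real n + t * (real M / real n))"
proof -
  have n1: "n \<ge> 1" using n by simp
  interpret prob_space "BF_space n" using n1 by (rule prob_space_BF)
  define p where "p = 1 - 2 / real n"
  have p: "0 \<le> p" "p \<le> 1" using n by (auto simp: p_def)
  define f where "f N E = phase1_fun n (t * p ^ (M - N)) (iso_count n E)" for N E
  define T where "T N = t * p ^ (M - Suc N)" for N
  define e where "e N E = (24 * T N / real n + 28 * T N ^ 2) * (real (iso_count n E) / real n)" for N E
  have T: "0 \<le> T N" "T N \<le> 1" for N
    using t p mult_mono[of t 1 "p ^ (M - Suc N)" 1] by (auto simp: T_def power_le_one)
  have "\<bar>(\<integral>\<omega>. f M (BF_graph \<omega> M) \<partial>BF_space n) - (\<integral>\<omega>. f 0 (BF_graph \<omega> 0) \<partial>BF_space n)\<bar>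
    \<le> (\<Sum>N\<in>{0..<M}. \<integral>\<omega>. e N (BF_graph \<omega> N) \<partial>BF_space n)"
  proof (rule BF_telescope[OF n1])
    fix N E assume "N < M"
    then have *: "T N * (1 - 2 / real n) = t * p ^ (M - N)"
      by (simp add: T_def p_def mult.assoc power_Suc2[symmetric] Suc_diff_Suc del: power_Suc)
    show "\<bar>BF_avg n (f (Suc N)) E - f N E\<bar> \<le> e N E"
      using phase1_step[OF n1 iso_count_le[of n E] T[of N], unfolded *]
      unfolding f_def BF_avg_iso_step[OF n1] e_def T_def[symmetric] by (simp add: algebra_simps)
  qed simp
  also have "(\<integral>\<omega>. f 0 (BF_graph \<omega> 0) \<partial>BF_space n) = exp (- (t * (1 - 2 / real n) ^ M * (real n * BF_K)))"
    using n by (simp add: f_def phase1_fun_def BF_h_1 p_def prob_space)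
  also have "(\<integral>\<omega>. f M (BF_graph \<omega> M) \<partial>BF_space n) = (\<integral>\<omega>. phase1_fun n t (iso_count n (BF_graph \<omega> M)) \<partial>BF_space n)"
    by (simp add: f_def)
  also have "(\<Sum>N\<in>{0..<M}. \<integral>\<omega>. e N (BF_graph \<omega> N) \<partial>BF_space n) \<le>
    (\<Sum>N<M. exp (- (2 * real M / real n)) * (24 * exp 7 * t / real n + 28 * exp 7 * t ^ 2 * exp (- (2 * real (M - N) / real n))))"
    unfolding atLeast0LessThan
  proof (intro sum_mono)
    fix N assume "N \<in> {..<M}"
    then have NM: "N < M" by simp
    then have N: "real N \<le> real n ^ 2" using M by linarith
    define a where "a = exp (- (2 * real (M - N) / real n))"
    have an: "exp (- (2 * real N / real n)) * a = exp (- (2 * real M / real n))"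
      using NM n by (simp add: a_def exp_add[symmetric] of_nat_diff field_simps)
    have "T N \<le> t * exp (- (2 * real (M - Suc N) / real n))"
      unfolding T_def p_def using t one_minus_power_le_exp[OF n] by (intro mult_left_mono) auto
    also have "exp (- (2 * real (M - Suc N) / real n)) = exp (2 / real n) * a"
      using NM n by (simp add: a_def exp_add[symmetric] of_nat_diff field_simps)
    also have "t * (exp (2 / real n) * a) \<le> t * (exp 1 * a)"
      using t n by (intro mult_left_mono mult_right_mono) (auto simp: a_def)
    finally have TN: "T N \<le> t * exp 1 * a" by simp
    then have TN2: "T N ^ 2 \<le> t ^ 2 * exp 2 * a ^ 2"
      using power_mono[OF TN T(1), of 2] by (simp add: power_mult_distrib exp_double[of 1, simplified, symmetric])
    have "(\<integral>\<omega>. e N (BF_graph \<omega> N) \<partial>BF_space n) = (24 * T N / real n + 28 * T N ^ 2) * (\<integral>\<omega>. real (iso_count n (BF_graph \<omega> N)) / real n \<partial>BF_space n)"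
      unfolding e_def by (rule integral_mult_right_zero)
    also have "\<dots> \<le> (24 * (t * exp 1 * a) / real n + 28 * (t ^ 2 * exp 2 * a ^ 2)) * (exp 5 * exp (- (2 * real N / real n)))"
      using TN TN2 T t
      by (intro mult_mono expectation_iso_fraction n1 N add_mono divide_right_mono mult_left_mono)
        (auto simp: a_def intro!: Bochner_Integration.integral_nonneg)
    also have "\<dots> = (24 * exp 6 * t / real n + 28 * exp 7 * t ^ 2 * a) * (exp (- (2 * real N / real n)) * a)"
    proof -
      have "exp 6 = exp 1 * exp (5::real)" "exp 7 = exp 2 * exp (5::real)" by (simp_all add: exp_add[symmetric])
      then show ?thesis by (simp add: algebra_simps power2_eq_square)
    qed
    also have "\<dots> \<le> (24 * exp 7 * t / real n + 28 * exp 7 * t ^ 2 * a) * (exp (- (2 * real N / real n)) * a)"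
      using t by (intro mult_right_mono add_mono divide_right_mono mult_left_mono) (auto simp: a_def)
    finally show "(\<integral>\<omega>. e N (BF_graph \<omega> N) \<partial>BF_space n) \<le>
       exp (- (2 * real M / real n)) * (24 * exp 7 * t / real n + 28 * exp 7 * t ^ 2 * exp (- (2 * real (M - N) / real n)))"
      unfolding an a_def[symmetric] by (simp only: mult.commute)
  qed
  also have "\<dots> = exp (- (2 * real M / real n)) * (24 * exp 7 * t * (real M / real n) + 28 * exp 7 * t ^ 2 * (\<Sum>N<M. exp (- (2 * real (M - N) / real n))))"
    by (simp add: sum_distrib_left[symmetric] sum.distrib)
  also have "\<dots> \<le> exp (- (2 * real M / real n)) * (24 * exp 7 * t * (real M / real n) + 28 * exp 7 * t ^ 2 * (real n / 2))"
    using geometric_exp_sum[OF n1, of M] by (intro mult_left_mono add_left_mono) auto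
  also have "\<dots> \<le> exp (- (2 * real M / real n)) * (24 * exp 7 * (t * (real M / real n)) + 24 * exp 7 * (t ^ 2 * real n))"
    by (intro mult_left_mono add_mono) (auto simp: mult.assoc)
  finally show ?thesis by (simp add: algebra_simps)
qed

text \<open>Each round costs the second moment of \<open>x\<close>, whose bound decreases in time,
  so its value at the starting time \<open>L\<close> serves for all rounds.\<close>

lemma phase2:
  assumes n: "n \<ge> 2" and M: "real M \<le> real n ^ 2" and L: "L \<le> M"
  shows "\<bar>(\<integral>\<omega>. of_bool (iso_count n (BF_graph \<omega> M) = 0) \<partial>BF_space n)
      - (\<integral>\<omega>. (1 - (1 - 2 / real n) ^ (M - L)) ^ iso_count n (BF_graph \<omega> L) \<partial>BF_space n)\<bar>
    \<le> 8 * real M * (exp 5 * exp (- (2 * real L / real n)) / real n + exp 14 * exp (- (4 * real L / real n)))"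
proof -
  have n1: "n \<ge> 1" using n by simp
  define p where "p = 1 - 2 / real n"
  have p: "0 \<le> p" "p \<le> 1" using n by (auto simp: p_def)
  define f where "f N E = (1 - p ^ (M - N)) ^ iso_count n E" for N E
  define e where "e N E = 8 * (real (iso_count n E) / real n) ^ 2" for N :: nat and E
  let ?B = "exp 5 * exp (- (2 * real L / real n)) / real n + exp 14 * exp (- (4 * real L / real n))"
  have "\<bar>(\<integral>\<omega>. f M (BF_graph \<omega> M) \<partial>BF_space n) - (\<integral>\<omega>. f L (BF_graph \<omega> L) \<partial>BF_space n)\<bar>
    \<le> (\<Sum>N\<in>{L..<M}. \<integral>\<omega>. e N (BF_graph \<omega> N) \<partial>BF_space n)"
  proof (rule BF_telescope[OF n1 L])
    fix N E assume "N < M"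
    then have *: "p ^ (M - Suc N) * (1 - 2 / real n) = p ^ (M - N)"
      by (simp add: p_def power_Suc2[symmetric] Suc_diff_Suc del: power_Suc)
    have "BF_avg n (f (Suc N)) E = iso_step n (\<lambda>k. (1 - p ^ (M - Suc N)) ^ k) (iso_count n E)"
      unfolding f_def by (rule BF_avg_iso_step[OF n1])
    then show "\<bar>BF_avg n (f (Suc N)) E - f N E\<bar> \<le> e N E"
      using phase2_step[OF n iso_count_le[of n E], of "p ^ (M - Suc N)"] p
      unfolding f_def e_def * by (simp add: power_le_one)
  qed
  \<comment> \<open>At time \<open>M\<close> the base is \<open>1 - p ^ 0 = 0\<close>, and the
    convention \<open>0 ^ 0 = 1\<close> makes the power an indicator.\<close>
  also have "(\<lambda>\<omega>. f M (BF_graph \<omega> M)) = (\<lambda>\<omega>. of_bool (iso_count n (BF_graph \<omega> M) = 0))"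
    by (auto simp: f_def)
  also have "(\<Sum>N\<in>{L..<M}. \<integral>\<omega>. e N (BF_graph \<omega> N) \<partial>BF_space n) \<le> (\<Sum>N\<in>{L..<M}. 8 * ?B)"
  proof (intro sum_mono)
    fix N assume N: "N \<in> {L..<M}"
    have "(\<integral>\<omega>. e N (BF_graph \<omega> N) \<partial>BF_space n) = 8 * (\<integral>\<omega>. (real (iso_count n (BF_graph \<omega> N)) / real n) ^ 2 \<partial>BF_space n)"
      unfolding e_def by (rule integral_mult_right_zero)
    also have "\<dots> \<le> 8 * (exp 5 * exp (- (2 * real N / real n)) / real n + exp 14 * exp (- (4 * real N / real n)))"
      using N M by (intro mult_left_mono expectation_iso_fraction n1) auto
    also have "\<dots> \<le> 8 * ?B"
      using N by (intro mult_left_mono add_mono divide_right_mono) (auto simp: divide_right_mono)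
    finally show "(\<integral>\<omega>. e N (BF_graph \<omega> N) \<partial>BF_space n) \<le> 8 * ?B" .
  qed
  also have "\<dots> = real (M - L) * (8 * ?B)" by simp
  also have "\<dots> \<le> real M * (8 * ?B)" by (intro mult_right_mono) auto
  finally show ?thesis by (simp add: f_def p_def mult_ac)
qed

lemma exp_minus_diff_le: "\<lbrakk>0 \<le> b; b \<le> a\<rbrakk> \<Longrightarrow> \<bar>exp (- a) - exp (- b)\<bar> \<le> a - (b::real)"
proof -
  assume ab: "0 \<le> b" "b \<le> a"
  have "exp (- b) - exp (- a) = exp (- b) * (1 - exp (- (a - b)))" by (simp add: algebra_simps exp_add[symmetric])
  also have "\<dots> \<le> 1 * (a - b)"
  proof (rule mult_mono)
    show "1 - exp (- (a - b)) \<le> a - b" using exp_ge_add_one_self[of "- (a - b)"] by linarith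
  qed (use ab in auto)
  finally show ?thesis using ab by simp
qed

text \<open>The passage goes through \<open>exp (- q * k)\<close>: replacing \<open>1 - q\<close> by
  \<open>exp (- q)\<close> costs \<open>k * q^2\<close>, and replacing \<open>x\<close> by
  \<open>BF_h x\<close> in the exponent costs \<open>q * n * x^2\<close>, since \<open>BF_h\<close>
  is tangent to the identity at 0.\<close>

lemma switch_phases:
  assumes n: "n \<ge> 1" and q: "0 \<le> q" "q \<le> 1" and k: "k \<le> n"
  shows "\<bar>(1 - q) ^ k - phase1_fun n q k\<bar> \<le> q ^ 2 * real n * (real k / real n) + q * real n * (real k / real n) ^ 2"
proof -
  define x where "x = real k / real n"
  have x: "0 \<le> x" "x \<le> 1" "real n * x = real k" using k n by (auto simp: x_def)
  have "\<bar>(1 - q) ^ k - exp (- q) ^ k\<bar> \<le> real k * \<bar>(1 - q) - exp (- q)\<bar>"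
    using norm_power_diff[of "1 - q" "exp (- q)" k] q by simp
  also have "\<bar>(1 - q) - exp (- q)\<bar> \<le> q ^ 2"
    using exp_minus_le[OF q(1)] exp_ge_add_one_self[of "- q"] zero_le_power2[of q] by simp
  finally have 1: "\<bar>(1 - q) ^ k - exp (- q) ^ k\<bar> \<le> real k * q ^ 2" by (simp add: mult_left_mono)
  have "\<bar>exp (- (q * real k)) - exp (- (q * (real n * BF_h x)))\<bar> \<le> q * real k - q * (real n * BF_h x)"
    using BF_h_bounds[OF x(1,2)] q x(3) mult_left_mono[OF BF_h_bounds(2)[OF x(1,2)], of "real n"] by (intro exp_minus_diff_le) (auto intro: mult_left_mono)
  also have "\<dots> = q * real n * (x - BF_h x)" by (simp add: x(3)[symmetric] algebra_simps)
  also have "\<dots> \<le> q * real n * x ^ 2" using BF_h_bounds[OF x(1,2)] q by (intro mult_left_mono) auto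
  finally have 2: "\<bar>exp (- (q * real k)) - exp (- (q * (real n * BF_h x)))\<bar> \<le> q * real n * x ^ 2" .
  have "exp (- q) ^ k = exp (- (q * real k))" by (simp add: exp_of_nat_mult[symmetric] mult.commute)
  moreover have "phase1_fun n q k = exp (- (q * (real n * BF_h x)))" by (simp add: phase1_fun_def x_def)
  moreover have "real k * q ^ 2 = q ^ 2 * real n * x" by (simp only: x(3)[symmetric] mult_ac)
  ultimately show ?thesis using 1 2 unfolding x_def[symmetric] by linarith
qed

text \<open>The second phase, run back from \<open>M\<close> to \<open>L\<close>, ends with
  parameter \<open>q\<close>, which is then the parameter \<open>t\<close> of the first phase up to
  \<open>L\<close>. As \<open>q * (1 - 2 / n) ^ L = (1 - 2 / n) ^ M\<close>, the switching time
  \<open>L\<close> enters only the error.\<close>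

lemma no_isolated_estimate:
  assumes n: "n \<ge> 2" and M: "real M \<le> real n ^ 2" and L: "L \<le> M"
  defines "q \<equiv> (1 - 2 / real n) ^ (M - L)"
  defines "m \<equiv> exp (- (2 * real L / real n))"
  shows "\<bar>(\<integral>\<omega>. of_bool (iso_count n (BF_graph \<omega> M) = 0) \<partial>BF_space n) - exp (- ((1 - 2 / real n) ^ M * (real n * BF_K)))\<bar>
    \<le> 8 * real M * (exp 5 * m / real n + exp 14 * m ^ 2)
      + (q ^ 2 * real n * (exp 5 * m) + q * real n * (exp 5 * m / real n + exp 14 * m ^ 2))
      + 24 * exp 7 * m * (q ^ 2 * real n + q * (real M / real n))"
proof -
  have n1: "n \<ge> 1" using n by simp
  have q: "0 \<le> q" "q \<le> 1" using n by (auto simp: q_def intro!: power_le_one)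
  have L2: "real L \<le> real n ^ 2" using L M by linarith
  have m2: "exp (- (4 * real L / real n)) = m ^ 2" by (simp add: m_def exp_double[symmetric])
  note int = BF_graph_integrable[OF n1, where N = L]
  let ?x = "\<lambda>\<omega>. real (iso_count n (BF_graph \<omega> L)) / real n"
  let ?A = "\<integral>\<omega>. of_bool (iso_count n (BF_graph \<omega> M) = 0) \<partial>BF_space n"
  let ?B = "\<integral>\<omega>. (1 - q) ^ iso_count n (BF_graph \<omega> L) \<partial>BF_space n"
  let ?C = "\<integral>\<omega>. phase1_fun n q (iso_count n (BF_graph \<omega> L)) \<partial>BF_space n"
  let ?D = "exp (- ((1 - 2 / real n) ^ M * (real n * BF_K)))"
  have 1: "\<bar>?A - ?B\<bar> \<le> 8 * real M * (exp 5 * m / real n + exp 14 * m ^ 2)"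
    using phase2[OF n M L] unfolding q_def[symmetric] m_def[symmetric] m2 .
  have "?B - ?C = (\<integral>\<omega>. (1 - q) ^ iso_count n (BF_graph \<omega> L) - phase1_fun n q (iso_count n (BF_graph \<omega> L)) \<partial>BF_space n)"
    using int[of "\<lambda>E. (1 - q) ^ iso_count n E"] int[of "\<lambda>E. phase1_fun n q (iso_count n E)"] by simp
  also have "\<bar>\<dots>\<bar> \<le> (\<integral>\<omega>. \<bar>(1 - q) ^ iso_count n (BF_graph \<omega> L) - phase1_fun n q (iso_count n (BF_graph \<omega> L))\<bar> \<partial>BF_space n)"
    by (rule integral_abs_bound)
  also have "\<dots> \<le> (\<integral>\<omega>. q ^ 2 * real n * ?x \<omega> + q * real n * (?x \<omega>) ^ 2 \<partial>BF_space n)"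
    by (intro integral_mono switch_phases n1 q iso_count_le
       int[where f = "\<lambda>E. \<bar>(1 - q) ^ iso_count n E - phase1_fun n q (iso_count n E)\<bar>"]
       int[where f = "\<lambda>E. q ^ 2 * real n * (real (iso_count n E) / real n) + q * real n * (real (iso_count n E) / real n) ^ 2"])
  also have "\<dots> = q ^ 2 * real n * (\<integral>\<omega>. ?x \<omega> \<partial>BF_space n) + q * real n * (\<integral>\<omega>. (?x \<omega>) ^ 2 \<partial>BF_space n)"
    using int[of "\<lambda>E. q ^ 2 * real n * (real (iso_count n E) / real n)"] int[of "\<lambda>E. q * real n * (real (iso_count n E) / real n) ^ 2"]
    by (simp only: Bochner_Integration.integral_add integral_mult_right_zero)
  also have "\<dots> \<le> q ^ 2 * real n * (exp 5 * m) + q * real n * (exp 5 * m / real n + exp 14 * m ^ 2)"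
    using expectation_iso_fraction[OF n1 L2] q unfolding m2 m_def[symmetric] by (intro add_mono mult_left_mono) auto
  finally have 2: "\<bar>?B - ?C\<bar> \<le> q ^ 2 * real n * (exp 5 * m) + q * real n * (exp 5 * m / real n + exp 14 * m ^ 2)" .
  have "q * (1 - 2 / real n) ^ L = (1 - 2 / real n) ^ M" using L by (simp add: q_def power_add[symmetric])
  then have "\<bar>?C - ?D\<bar> \<le> 24 * exp 7 * m * (q ^ 2 * real n + q * (real L / real n))"
    using phase1[OF n L2 q] unfolding m_def[symmetric] by simp
  also have "\<dots> \<le> 24 * exp 7 * m * (q ^ 2 * real n + q * (real M / real n))"
    using q L by (intro mult_left_mono add_left_mono divide_right_mono) (auto simp: m_def)
  finally show ?thesis using 1 2 by linarith
qed

section \<open>Probabilities of graph properties at a fixed time\<close>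

definition BF_prob :: "nat \<Rightarrow> nat \<Rightarrow> (nat set set \<Rightarrow> bool) \<Rightarrow> real" where
  "BF_prob n N P = measure (BF_space n) {\<omega> \<in> space (BF_space n). P (BF_graph \<omega> N)}"

lemma BF_graph_sets [measurable]: "{\<omega> \<in> space (BF_space n). P (BF_graph \<omega> N)} \<in> sets (BF_space n)"
proof -
  have "(\<lambda>\<omega>. BF_graph \<omega> N) -` Collect P \<inter> space (BF_space n) \<in> sets (BF_space n)"
    by (rule measurable_sets[OF BF_graph_measurable]) simp
  also have "(\<lambda>\<omega>. BF_graph \<omega> N) -` Collect P \<inter> space (BF_space n) = {\<omega> \<in> space (BF_space n). P (BF_graph \<omega> N)}"
    by auto
  finally show ?thesis .
qed

lemma BF_prob_eq:
  assumes "n \<ge> 1"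
  shows "BF_prob n N P = (\<integral>\<omega>. of_bool (P (BF_graph \<omega> N)) \<partial>BF_space n)"
proof -
  interpret prob_space "BF_space n" using assms by (rule prob_space_BF)
  have "BF_prob n N P = (\<integral>\<omega>. indicator {\<omega> \<in> space (BF_space n). P (BF_graph \<omega> N)} \<omega> \<partial>BF_space n)"
    unfolding BF_prob_def by simp
  also have "\<dots> = (\<integral>\<omega>. of_bool (P (BF_graph \<omega> N)) \<partial>BF_space n)"
    by (intro Bochner_Integration.integral_cong) (auto simp: indicator_def)
  finally show ?thesis .
qed

lemma BF_prob_nonneg [simp]: "BF_prob n N P \<ge> 0"
  by (simp add: BF_prob_def)

lemma BF_prob_le_1: "n \<ge> 1 \<Longrightarrow> BF_prob n N P \<le> 1"
  unfolding BF_prob_def using prob_space.prob_le_1[OF prob_space_BF] by blast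

lemma BF_prob_not: "n \<ge> 1 \<Longrightarrow> BF_prob n N (\<lambda>E. \<not> P E) = 1 - BF_prob n N P"
proof -
  assume n: "n \<ge> 1"
  interpret prob_space "BF_space n" using n by (rule prob_space_BF)
  have "{\<omega> \<in> space (BF_space n). \<not> P (BF_graph \<omega> N)} = space (BF_space n) - {\<omega> \<in> space (BF_space n). P (BF_graph \<omega> N)}"
    by auto
  then show ?thesis unfolding BF_prob_def by (simp add: prob_compl)
qed

lemma BF_prob_mono:
  assumes n: "n \<ge> 1" and "\<And>E. E \<in> BF_states n \<Longrightarrow> P E \<Longrightarrow> Q E"
  shows "BF_prob n N P \<le> BF_prob n N Q"
proof -
  interpret prob_space "BF_space n" using n by (rule prob_space_BF)
  show ?thesis unfolding BF_prob_def using assms BF_graph_states by (intro finite_measure_mono) auto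
qed

lemma BF_prob_disj_le:
  assumes n: "n \<ge> 1"
  shows "BF_prob n N (\<lambda>E. P E \<or> Q E) \<le> BF_prob n N P + BF_prob n N Q"
proof -
  interpret prob_space "BF_space n" using n by (rule prob_space_BF)
  have "{\<omega> \<in> space (BF_space n). P (BF_graph \<omega> N) \<or> Q (BF_graph \<omega> N)} =
    {\<omega> \<in> space (BF_space n). P (BF_graph \<omega> N)} \<union> {\<omega> \<in> space (BF_space n). Q (BF_graph \<omega> N)}" by auto
  then show ?thesis unfolding BF_prob_def by (simp add: measure_Un_le)
qed

lemma BF_prob_le_expectation:
  assumes n: "n \<ge> 1" and "\<And>E. of_bool (P E) \<le> f E"
  shows "BF_prob n N P \<le> (\<integral>\<omega>. f (BF_graph \<omega> N) \<partial>BF_space n)"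
  unfolding BF_prob_eq[OF n] using assms(2)
  by (intro integral_mono BF_graph_integrable[OF n, where f = f] BF_graph_integrable[OF n, where f = "\<lambda>E. of_bool (P E)"])

section \<open>Disconnected graphs without isolated vertices\<close>

lemma BF_states_edgeE:
  assumes "E \<in> BF_states n" "e \<in> E"
  obtains a b where "a \<in> {1..n}" "b \<in> {1..n}" "a \<noteq> b" "e = {a, b}"
proof -
  have "\<forall>e\<in>E. \<exists>u\<in>{1..n}. \<exists>v\<in>{1..n}. u \<noteq> v \<and> e = {u, v}"
    using assms(1) by (simp only: BF_states_def mem_Collect_eq)
  from bspec[OF this assms(2)] show ?thesis by (elim bexE conjE) (rule that)
qed

lemma disconnected_cut:
  assumes E: "E \<in> BF_states n" and nc: "\<not> graph_connected n E"
  obtains S where "S \<subseteq> {1..n}" "S \<noteq> {}" "2 * card S \<le> n" "cut_free S E"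
proof -
  let ?R = "{(x, y). {x, y} \<in> E}\<^sup>*"
  obtain u v where uv: "u \<in> {1..n}" "v \<in> {1..n}" "(u, v) \<notin> ?R"
    using nc by (auto simp: graph_connected_def)
  define C where "C = {w \<in> {1..n}. (u, w) \<in> ?R}"
  have step: "b \<in> C" if "{a, b} \<in> E" "a \<in> C" "b \<in> {1..n}" for a b
  proof -
    have "(u, a) \<in> ?R" using that by (simp add: C_def)
    moreover have "(a, b) \<in> {(x, y). {x, y} \<in> E}" using that by simp
    ultimately have "(u, b) \<in> ?R" by (rule rtrancl_into_rtrancl)
    then show ?thesis using that by (simp add: C_def)
  qed
  have edge: "e \<subseteq> C \<or> e \<subseteq> {1..n} - C" if e: "e \<in> E" for e
  proof -
    obtain a b where ab: "a \<in> {1..n}" "b \<in> {1..n}" "e = {a, b}" by (rule BF_states_edgeE[OF E e])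
    have "{a, b} \<in> E" "{b, a} \<in> E" using ab e by (simp_all add: insert_commute)
    then have "a \<in> C \<longleftrightarrow> b \<in> C" using step[of a b] step[of b a] ab(1,2) by auto
    then show ?thesis using ab by (cases "a \<in> C") auto
  qed
  have C: "C \<subseteq> {1..n}" "u \<in> C" "v \<in> {1..n} - C" using uv by (auto simp: C_def)
  have cf1: "cut_free C E" unfolding cut_free_def
  proof
    fix e assume "e \<in> E" then show "e \<subseteq> C \<or> e \<inter> C = {}" by (rule edge[THEN disjE]) auto
  qed
  have cf2: "cut_free ({1..n} - C) E" unfolding cut_free_def
  proof
    fix e assume "e \<in> E" then show "e \<subseteq> {1..n} - C \<or> e \<inter> ({1..n} - C) = {}" by (rule edge[THEN disjE]) auto
  qed
  have "card ({1..n} - C) = n - card C" "card C \<le> n"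
    using C card_mono[OF _ C(1)] finite_subset[OF C(1)] by (auto simp: card_Diff_subset)
  then have "2 * card C \<le> n \<or> 2 * card ({1..n} - C) \<le> n" by linarith
  then show ?thesis
  proof
    assume "2 * card C \<le> n"
    then show ?thesis using C cf1 by (intro that[of C]) auto
  next
    assume "2 * card ({1..n} - C) \<le> n"
    then show ?thesis using C cf2 by (intro that[of "{1..n} - C"]) auto
  qed
qed

text \<open>The inner edge is what makes this unlikely: two isolated vertices also form a set
  without boundary edges, and near the critical time such pairs are not rare. Isolated vertices
  elsewhere, or even in \<open>S\<close>, are allowed, so the notion can also be applied before the
  last one has vanished.\<close>

definition BF_bad :: "nat \<Rightarrow> nat set set \<Rightarrow> bool" where
  "BF_bad n E \<longleftrightarrow> (\<exists>S\<subseteq>{1..n}. 2 \<le> card S \<and> 2 * card S \<le> n \<and> cut_free S E \<and> (\<exists>e\<in>E. e \<subseteq> S))"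

lemma iso_count_eq_0_iff: "iso_count n E = 0 \<longleftrightarrow> (\<forall>v\<in>{1..n}. \<not> isolated E v)"
  by (auto simp: iso_count_def iso_set_def)

lemma disconnected_imp_bad:
  assumes E: "E \<in> BF_states n" and nc: "\<not> graph_connected n E" and iso: "iso_count n E = 0"
  shows "BF_bad n E"
proof -
  obtain S where S: "S \<subseteq> {1..n}" "S \<noteq> {}" "2 * card S \<le> n" "cut_free S E"
    by (rule disconnected_cut[OF E nc])
  obtain v where v: "v \<in> S" using S by blast
  then have "\<not> isolated E v" using S iso iso_count_eq_0_iff by blast
  then obtain e where e: "e \<in> E" "v \<in> e" by (auto simp: isolated_def)
  then have eS: "e \<subseteq> S" using S v by (auto simp: cut_free_def)
  obtain a b where ab: "a \<noteq> b" "e = {a, b}" by (rule BF_states_edgeE[OF E e(1)])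
  have "finite S" using S finite_subset by blast
  then have "card {a, b} \<le> card S" using eS ab by (intro card_mono) auto
  then have "2 \<le> card S" using ab by simp
  then show ?thesis using S e eS by (auto simp: BF_bad_def)
qed

lemma connected_imp_no_isolated:
  assumes n: "n \<ge> 2" and c: "graph_connected n E"
  shows "iso_count n E = 0"
  unfolding iso_count_eq_0_iff
proof
  fix v assume v: "v \<in> {1..n}"
  define w where "w = (if v = 1 then 2 else 1 :: nat)"
  have w: "w \<in> {1..n}" "w \<noteq> v" using n by (auto simp: w_def)
  have "(v, w) \<in> {(x, y). {x, y} \<in> E}\<^sup>*" using c v w by (auto simp: graph_connected_def)
  then obtain y where "{v, y} \<in> E" using w by (cases rule: converse_rtranclE) auto
  then show "\<not> isolated E v" by (auto simp: isolated_def)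
qed

lemma bad_union_bound:
  assumes n: "n \<ge> 1"
  shows "BF_prob n N (BF_bad n) \<le> (\<Sum>s\<in>{2..n div 2}. real (n choose s) *
    (real N * (2 * real s ^ 2 / real n ^ 2) * exp (real s) * cut_rate n s ^ (N - 1)))"
proof -
  define F where "F = {S. S \<subseteq> {1..n} \<and> 2 \<le> card S \<and> 2 * card S \<le> n}"
  define g where "g s = real N * (2 * real s ^ 2 / real n ^ 2) * exp (real s) * cut_rate n s ^ (N - 1)" for s
  have finF: "finite F" unfolding F_def by (rule finite_subset[of _ "Pow {1..n}"]) auto
  have "BF_prob n N (BF_bad n) \<le> (\<integral>\<omega>. (\<Sum>S\<in>F. cut_edge_weight n S (BF_graph \<omega> N)) \<partial>BF_space n)"
  proof (rule BF_prob_le_expectation[OF n, where f = "\<lambda>E. \<Sum>S\<in>F. cut_edge_weight n S E"])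
    fix E
    have nonneg: "cut_edge_weight n S E \<ge> 0" for S by (simp add: cut_edge_weight_def cut_weight_def)
    show "of_bool (BF_bad n E) \<le> (\<Sum>S\<in>F. cut_edge_weight n S E)"
    proof (cases "BF_bad n E")
      case True
      then obtain S where S: "S \<in> F" "cut_free S E" "\<exists>e\<in>E. e \<subseteq> S" by (auto simp: BF_bad_def F_def)
      then have "1 \<le> cut_edge_weight n S E" by (simp add: cut_edge_weight_def cut_weight_def)
      also have "\<dots> \<le> (\<Sum>S\<in>F. cut_edge_weight n S E)" by (rule member_le_sum[OF S(1)]) (auto simp: nonneg finF)
      finally show ?thesis by simp
    qed (simp add: sum_nonneg nonneg)
  qed
  also have "\<dots> = (\<Sum>S\<in>F. \<integral>\<omega>. cut_edge_weight n S (BF_graph \<omega> N) \<partial>BF_space n)"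
    by (intro Bochner_Integration.integral_sum BF_graph_integrable[OF n])
  also have "\<dots> \<le> (\<Sum>S\<in>F. g (card S))"
    unfolding g_def by (intro sum_mono expectation_cut_edge_weight n) (auto simp: F_def)
  also have "\<dots> = (\<Sum>s\<in>{2..n div 2}. \<Sum>S\<in>{S \<in> F. card S = s}. g (card S))"
    by (rule sum.group[symmetric]) (auto simp: finF F_def)
  also have "\<dots> = (\<Sum>s\<in>{2..n div 2}. real (n choose s) * g s)"
  proof (intro sum.cong refl)
    fix s assume "s \<in> {2..n div 2}"
    then have "{S \<in> F. card S = s} = {S. S \<subseteq> {1..n} \<and> card S = s}" by (auto simp: F_def)
    then have "card {S \<in> F. card S = s} = n choose s" using n_subsets[of "{1..n}" s] by simp
    then show "(\<Sum>S\<in>{S \<in> F. card S = s}. g (card S)) = real (n choose s) * g s" by simp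
  qed
  finally show ?thesis by (simp add: g_def)
qed

section \<open>Summing the union bound over the set sizes\<close>

lemma power_self_le_exp_fact: "real s ^ s \<le> exp (real s) * fact s"
proof -
  have "summable (\<lambda>k. real s ^ k /\<^sub>R fact k)" by (rule summable_exp_generic)
  then have "(\<Sum>k\<in>{s}. real s ^ k /\<^sub>R fact k) \<le> (\<Sum>k. real s ^ k /\<^sub>R fact k)"
    by (intro sum_le_suminf) auto
  then have "real s ^ s / fact s \<le> exp (real s)" by (simp add: exp_def divide_inverse mult.commute)
  then show ?thesis by (simp add: field_simps)
qed

text \<open>The sum over all set sizes of the bound in \<open>bad_term_bound\<close>. The binomial
  coefficient provides \<open>1 / fact s\<close>; half of it, in the exponent, is spent on powers of
  \<open>sqrt s\<close>, and the remaining \<open>1 / sqrt (fact s)\<close> beats every geometric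
  factor.\<close>

definition bad_const :: "real \<Rightarrow> real" where
  "bad_const D = (\<Sum>s. exp (6 + D) ^ s / sqrt (fact s))"

lemma bad_const_summable: "summable (\<lambda>s. exp (6 + D) ^ s / sqrt (fact s :: real))"
proof -
  define B where "B = exp (6 + D)"
  obtain m where m: "real m > (2 * B) ^ 2" using reals_Archimedean2 by blast
  show ?thesis unfolding B_def[symmetric]
  proof (rule summable_ratio_test[of "1 / 2" m])
    fix s assume s: "m \<le> s"
    have "(2 * B) ^ 2 \<le> real (Suc s)" using m s by simp
    then have "2 * B \<le> sqrt (real (Suc s))" by (rule real_le_rsqrt)
    then have "B / sqrt (real (Suc s)) \<le> 1 / 2" by (simp add: divide_le_eq)
    then have 1: "B / sqrt (real (Suc s)) * (B ^ s / sqrt (fact s)) \<le> 1 / 2 * (B ^ s / sqrt (fact s))"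
      by (intro mult_right_mono) (auto simp: B_def)
    have 2: "B ^ Suc s / sqrt (fact (Suc s)) = B / sqrt (real (Suc s)) * (B ^ s / sqrt (fact s))"
      by (simp add: real_sqrt_mult)
    have abs_B: "\<bar>B ^ k / sqrt (fact k)\<bar> = B ^ k / sqrt (fact k)" for k
      by (rule abs_of_nonneg) (simp add: B_def)
    show "norm (B ^ Suc s / sqrt (fact (Suc s))) \<le> 1 / 2 * norm (B ^ s / sqrt (fact s))"
      unfolding real_norm_def abs_B using 1 2 by linarith
  qed simp
qed

lemma bad_const_nonneg: "bad_const D \<ge> 0"
  unfolding bad_const_def by (intro suminf_nonneg bad_const_summable) auto

text \<open>The factor \<open>n powr (s / n)\<close> comes from the pairs of vertices inside a vertex set of size \<open>s\<close>,
  which cannot cross its boundary.\<close>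

lemma powr_fraction_le:
  assumes "1 \<le> s" "2 * s \<le> n"
  shows "exp (real s / real n * ln (real n)) \<le> 2 * sqrt (real s)"
proof -
  \<comment> \<open>With \<open>n = u * s\<close> the exponent is
    \<open>ln u / u + ln s / u\<close>. The first term is at most \<open>ln 2\<close>, the second at
    most \<open>ln s / 2\<close> since \<open>u \<ge> 2\<close>; they give the factors 2 and
    \<open>sqrt s\<close>.\<close>
  define u where "u = real n / real s"
  have u: "u \<ge> 2" using assms by (simp add: u_def field_simps)
  have n: "real n = u * real s" using assms by (simp add: u_def)
  have lnu: "ln u \<le> u * ln 2"
  proof -
    have "ln (u / 2) \<le> u / 2 - 1" using u ln_le_minus_one[of "u / 2"] by simp
    then have "ln u \<le> ln 2 + (u / 2 - 1)" using u by (simp add: ln_div)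
    moreover have "(u - 2) * (1 / 2) \<le> (u - 2) * ln 2"
      using u ln2_ge_two_thirds by (intro mult_left_mono) auto
    moreover have "(u - 2) * ln 2 = u * ln 2 - 2 * ln 2" by (simp add: algebra_simps)
    ultimately show ?thesis using ln2_ge_two_thirds by (simp add: field_simps)
  qed
  have s0: "ln (real s) \<ge> 0" using assms by simp
  have "real s / real n * ln (real n) = (ln u + ln (real s)) / u"
    using assms u unfolding n by (simp add: ln_mult field_simps)
  also have "\<dots> = ln u / u + ln (real s) / u" by (simp add: add_divide_distrib)
  also have "\<dots> \<le> ln 2 + ln (real s) / 2"
    using lnu u s0 by (intro add_mono divide_left_mono) (auto simp: divide_le_eq mult.commute)
  also have "\<dots> = ln (2 * sqrt (real s))" using assms by (simp add: ln_mult ln_sqrt)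
  finally have "exp (real s / real n * ln (real n)) \<le> exp (ln (2 * sqrt (real s)))" by simp
  then show ?thesis using assms by simp
qed

text \<open>Here \<open>d\<close> is the offset of \<open>2 * (N - 1) / n\<close> from
  \<open>ln n\<close>. The decay is \<open>exp (- a * (ln n + d))\<close> with
  \<open>a = s - s * (s + 1) / n\<close>, so \<open>n powr (- a)\<close> cancels the
  \<open>n ^ s\<close> of the binomial coefficient up to the power \<open>s + 1\<close> of
  \<open>n powr (s / n)\<close>. The 6 in the exponent collects \<open>s ^ 2\<close> (2), the cut
  weight (1), \<open>2 ^ (s + 1)\<close> (2) and Stirling's factor (1).\<close>

lemma bad_term_bound:
  assumes s: "2 \<le> s" "2 * s \<le> n" and n: "n \<ge> 4" and N: "N \<ge> 1" and D: "D \<ge> 0"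
  defines "d \<equiv> 2 * (real N - 1) / real n - ln (real n)"
  assumes d: "d \<ge> - D"
  shows "real (n choose s) * real s ^ 2 * exp (real s) * cut_rate n s ^ (N - 1) \<le> exp (- d / 2) * (exp (6 + D) ^ s / sqrt (fact s))"
proof -
  have n1: "n \<ge> 1" and n0: "real n > 0" using n by auto
  have sn: "real s \<le> real n / 2" "real s \<ge> 2" using s by simp_all
  define a where "a = real s * (1 - (real s + 1) / real n)"
  have a: "1 / 2 \<le> a" "a \<le> real s"
  proof -
    have "(real s + 1) / real n \<le> 3 / 4" using sn n n0 by (simp add: divide_le_eq)
    then have "2 * (1 / 4) \<le> a" unfolding a_def using sn by (intro mult_mono) auto
    then show "1 / 2 \<le> a" by simp
    show "a \<le> real s" unfolding a_def using n0 by (simp add: mult_left_le)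
  qed
  have "cut_rate n s \<le> exp (- (2 * real s * (real n - real s - 1) / real n ^ 2))"
    using exp_ge_add_one_self[of "- (2 * real s * (real n - real s - 1) / real n ^ 2)"] by (simp add: cut_rate_def)
  then have "cut_rate n s ^ (N - 1) \<le> exp (- (2 * real s * (real n - real s - 1) / real n ^ 2)) ^ (N - 1)"
    by (intro power_mono cut_rate_nonneg n1)
  also have "\<dots> = exp (- (a * (ln (real n) + d)))"
  proof -
    have "(real N - 1) * (2 * real s * (real n - real s - 1) / real n ^ 2) = a * (ln (real n) + d)"
      using n0 by (simp add: a_def d_def field_simps power2_eq_square)
    then show ?thesis using N by (simp add: exp_of_nat_mult[symmetric] of_nat_diff)
  qed
  also have "\<dots> = exp (- (a * ln (real n))) * exp (- (a * d))" by (simp add: exp_add[symmetric] algebra_simps)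
  \<comment> \<open>For positive \<open>d\<close> the decay must not depend on \<open>s\<close>, so
    only \<open>1 / 2 \<le> a\<close> is used there. For \<open>d\<close> down to \<open>- D\<close>
    the loss is at most \<open>exp (D * s)\<close>, which is geometric in \<open>s\<close> and can
    be summed.\<close>
  also have "exp (- (a * d)) \<le> exp (D * real s) * exp (- d / 2)"
  proof -
    have "(a - 1 / 2) * (- d) \<le> (a - 1 / 2) * D" using a d by (intro mult_left_mono) auto
    also have "\<dots> \<le> real s * D" using a D by (intro mult_right_mono) auto
    finally have "- (a * d) \<le> D * real s + - d / 2" by (simp add: algebra_simps)
    then show ?thesis by (simp add: exp_add[symmetric])
  qed
  also have "exp (- (a * ln (real n))) = exp (real s / real n * ln (real n)) ^ (s + 1) / real n ^ s"
  proof -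
    have "exp (real s / real n * ln (real n)) ^ (s + 1) = exp (- (a * ln (real n)) + real s * ln (real n))"
    proof -
      have "real (s + 1) * (real s / real n * ln (real n)) = - (a * ln (real n)) + real s * ln (real n)"
        using n0 by (simp add: a_def field_simps)
      then show ?thesis by (simp only: exp_of_nat_mult[symmetric])
    qed
    also have "\<dots> = exp (- (a * ln (real n))) * real n ^ s" using n0 by (simp only: exp_add) (simp add: exp_of_nat_mult)
    finally show ?thesis using n0 by simp
  qed
  also have "exp (real s / real n * ln (real n)) ^ (s + 1) \<le> (2 * sqrt (real s)) ^ (s + 1)"
    using s by (intro power_mono powr_fraction_le) auto
  finally have r: "cut_rate n s ^ (N - 1) \<le> (2 * sqrt (real s)) ^ (s + 1) / real n ^ s * (exp (D * real s) * exp (- d / 2))"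
    by (simp add: mult_right_mono divide_right_mono)
  have ch: "real (n choose s) \<le> real n ^ s / fact s"
  proof -
    have "real ((n choose s) * fact s) \<le> real (n ^ s)" using binomial_fact_pow[of n s] of_nat_le_iff by blast
    then show ?thesis by (simp add: field_simps)
  qed
  have "real (n choose s) * cut_rate n s ^ (N - 1) \<le>
     (real n ^ s / fact s) * ((2 * sqrt (real s)) ^ (s + 1) / real n ^ s * (exp (D * real s) * exp (- d / 2)))"
    using ch r cut_rate_nonneg[OF n1, of s] by (intro mult_mono) auto
  also have "\<dots> = (2 * sqrt (real s)) ^ (s + 1) / fact s * (exp (D * real s) * exp (- d / 2))"
    using n0 by simp
  finally have 1: "real (n choose s) * cut_rate n s ^ (N - 1) \<le> (2 * sqrt (real s)) ^ (s + 1) / fact s * (exp (D * real s) * exp (- d / 2))" .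
  have es: "real s \<le> exp (real s)" using exp_ge_add_one_self[of "real s"] by linarith
  have e1: "real s ^ 2 \<le> exp (2 * real s)"
    using power_mono[OF es, of 2] by (simp add: exp_of_nat_mult[symmetric])
  have e2: "2 ^ (s + 1) \<le> exp (2 * real s)"
  proof -
    have "(2::real) ^ (s + 1) \<le> exp 1 ^ (s + 1)" using exp_ge_add_one_self[of 1] by (intro power_mono) auto
    also have "\<dots> = exp (real s + 1)" by (simp add: exp_of_nat_mult[symmetric] exp_add)
    also have "\<dots> \<le> exp (2 * real s)" using sn by simp
    finally show ?thesis .
  qed
  have e3: "sqrt (real s) ^ (s + 1) \<le> exp (real s) * sqrt (fact s)"
  proof -
    have "sqrt (real s) ^ (s + 1) = sqrt (real s * real s ^ s)"
      by (simp add: real_sqrt_power[symmetric] real_sqrt_mult)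
    also have "\<dots> \<le> sqrt (exp (real s) * (exp (real s) * fact s))"
      using es power_self_le_exp_fact[of s] by (intro real_sqrt_le_mono mult_mono) auto
    also have "\<dots> = exp (real s) * sqrt (fact s)" by (simp add: real_sqrt_mult)
    finally show ?thesis .
  qed
  have "real (n choose s) * real s ^ 2 * exp (real s) * cut_rate n s ^ (N - 1)
     = (real s ^ 2 * exp (real s)) * (real (n choose s) * cut_rate n s ^ (N - 1))" by (simp only: mult_ac)
  also have "\<dots> \<le> (exp (2 * real s) * exp (real s)) * ((2 * sqrt (real s)) ^ (s + 1) / fact s * (exp (D * real s) * exp (- d / 2)))"
    using cut_rate_nonneg[OF n1, of s] by (intro mult_mono[OF mult_right_mono[OF e1] 1]) auto
  also have "(2 * sqrt (real s)) ^ (s + 1) / fact s = (2 ^ (s + 1) * sqrt (real s) ^ (s + 1)) / fact s"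
    by (simp only: power_mult_distrib)
  also have "\<dots> \<le> (exp (2 * real s) * (exp (real s) * sqrt (fact s))) / fact s"
    using e2 e3 by (intro divide_right_mono mult_mono) auto
  also have "\<dots> = (exp (2 * real s) * exp (real s)) / sqrt (fact s)"
  proof -
    have "sqrt (fact s) / fact s = 1 / (sqrt (fact s) :: real)" by (simp add: field_simps)
    then show ?thesis by (simp only: times_divide_eq_right[symmetric] mult.assoc mult_1_right divide_inverse mult_1_left)
  qed
  also have "exp (2 * real s) * exp (real s) * ((exp (2 * real s) * exp (real s)) / sqrt (fact s) * (exp (D * real s) * exp (- d / 2)))
     = exp (- d / 2) * ((exp (2 * real s) * exp (real s) * (exp (2 * real s) * exp (real s)) * exp (D * real s)) / sqrt (fact s))"
    by simp
  also have "exp (2 * real s) * exp (real s) * (exp (2 * real s) * exp (real s)) * exp (D * real s) = exp (6 + D) ^ s"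
    by (simp add: exp_of_nat_mult[symmetric] exp_add[symmetric] algebra_simps)
  finally show ?thesis by (simp add: mult_left_mono mult_right_mono)
qed

lemma bad_probability:
  assumes n: "n \<ge> 4" and N: "N \<ge> 1" and D: "D \<ge> 0"
  defines "d \<equiv> 2 * (real N - 1) / real n - ln (real n)"
  assumes d: "d \<ge> - D"
  shows "BF_prob n N (BF_bad n) \<le> 2 * real N / real n ^ 2 * exp (- d / 2) * bad_const D"
proof -
  let ?b = "\<lambda>s. exp (6 + D) ^ s / sqrt (fact s :: real)"
  have "BF_prob n N (BF_bad n) \<le> (\<Sum>s\<in>{2..n div 2}. real (n choose s) *
    (real N * (2 * real s ^ 2 / real n ^ 2) * exp (real s) * cut_rate n s ^ (N - 1)))"
    using n by (intro bad_union_bound) auto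
  also have "\<dots> = (\<Sum>s\<in>{2..n div 2}. 2 * real N / real n ^ 2 * (real (n choose s) * real s ^ 2 * exp (real s) * cut_rate n s ^ (N - 1)))"
    by (intro sum.cong refl) simp
  also have "\<dots> \<le> (\<Sum>s\<in>{2..n div 2}. 2 * real N / real n ^ 2 * (exp (- d / 2) * ?b s))"
  proof (intro sum_mono mult_left_mono)
    fix s assume "s \<in> {2..n div 2}"
    then have "2 \<le> s" "2 * s \<le> n" by auto
    then show "real (n choose s) * real s ^ 2 * exp (real s) * cut_rate n s ^ (N - 1) \<le> exp (- d / 2) * ?b s"
      unfolding d_def using n N D d[unfolded d_def] by (intro bad_term_bound) auto
  qed simp
  also have "\<dots> = 2 * real N / real n ^ 2 * exp (- d / 2) * (\<Sum>s\<in>{2..n div 2}. ?b s)"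
    by (simp add: sum_distrib_left mult_ac)
  also have "\<dots> \<le> 2 * real N / real n ^ 2 * exp (- d / 2) * bad_const D"
    unfolding bad_const_def by (intro mult_left_mono sum_le_suminf bad_const_summable) auto
  finally show ?thesis .
qed

section \<open>The time scale\<close>

text \<open>An integer time lies below a nonnegative real bound iff it lies below its floor.
  Negative bounds become time 0, where the graph is disconnected for \<open>n \<ge> 2\<close>, which
  is the right value for the tail of the connectivity time.\<close>

definition BF_time :: "nat \<Rightarrow> real \<Rightarrow> nat" where
  "BF_time n c = nat \<lfloor>(real n * ln (real n) + c * real n) / 2\<rfloor>"

lemma BF_time_bounds:
  assumes "ln (real n) + c \<ge> 0"
  shows "real (BF_time n c) \<le> real n * (ln (real n) + c) / 2" "real (BF_time n c) > real n * (ln (real n) + c) / 2 - 1"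
proof -
  define y where "y = (real n * ln (real n) + c * real n) / 2"
  have y: "y = real n * (ln (real n) + c) / 2" by (simp add: y_def algebra_simps)
  have "y \<ge> 0" unfolding y using assms by (intro divide_nonneg_nonneg mult_nonneg_nonneg) auto
  then have "real (BF_time n c) = real_of_int \<lfloor>y\<rfloor>" by (simp add: BF_time_def y_def[symmetric])
  then show "real (BF_time n c) \<le> real n * (ln (real n) + c) / 2" "real (BF_time n c) > real n * (ln (real n) + c) / 2 - 1"
    unfolding y[symmetric] by linarith+
qed

lemma bad_probability_time:
  assumes n: "n \<ge> 4" and L: "L \<ge> 0" "c \<ge> - L" and nc: "ln (real n) + c \<ge> 0"
  shows "BF_prob n (BF_time n c) (BF_bad n) \<le> (ln (real n) + c) / real n * exp ((1 - c) / 2) * bad_const (L + 1)"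
proof (cases "BF_time n c = 0")
  case True
  have "BF_prob n (BF_time n c) (BF_bad n) = 0" by (simp add: True BF_prob_def BF_bad_def)
  then show ?thesis using nc bad_const_nonneg by simp
next
  case False
  define N where "N = BF_time n c"
  have N1: "N \<ge> 1" using False by (simp add: N_def)
  have Nb: "real N \<le> real n * (ln (real n) + c) / 2" "real N > real n * (ln (real n) + c) / 2 - 1"
    unfolding N_def by (rule BF_time_bounds[OF nc])+
  define d where "d = 2 * (real N - 1) / real n - ln (real n)"
  \<comment> \<open>The floor and the exponent \<open>N - 1\<close> cost up to one round each, hence
    at most \<open>4 / n \<le> 1\<close> in \<open>d\<close>.\<close>
  have dc: "d \<ge> c - 1"
  proof -
    have "real n * (ln (real n) + c - 1) \<le> 2 * (real N - 1)" using Nb n by (simp add: algebra_simps)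
    then have "ln (real n) + c - 1 \<le> 2 * (real N - 1) / real n" using n by (simp add: le_divide_eq mult.commute)
    then show ?thesis by (simp add: d_def)
  qed
  have "BF_prob n N (BF_bad n) \<le> 2 * real N / real n ^ 2 * exp (- d / 2) * bad_const (L + 1)"
    unfolding d_def using n N1 L dc by (intro bad_probability) (auto simp: d_def)
  also have "\<dots> \<le> (ln (real n) + c) / real n * exp ((1 - c) / 2) * bad_const (L + 1)"
  proof (intro mult_right_mono mult_mono bad_const_nonneg)
    have "2 * real N / real n ^ 2 \<le> real n * (ln (real n) + c) / real n ^ 2" using Nb by (intro divide_right_mono) auto
    then show "2 * real N / real n ^ 2 \<le> (ln (real n) + c) / real n" using n by (simp add: power2_eq_square)
  qed (use dc nc in auto)
  finally show ?thesis by (simp add: N_def)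
qed

lemma bad_probability_tendsto: "(\<lambda>n. BF_prob n (BF_time n c) (BF_bad n)) \<longlonglongrightarrow> 0"
proof (rule tendsto_sandwich[of "\<lambda>_. 0"])
  show "\<forall>\<^sub>F n in sequentially. BF_prob n (BF_time n c) (BF_bad n) \<le>
    (ln (real n) + c) / real n * (exp ((1 - c) / 2) * bad_const (\<bar>c\<bar> + 1))"
  proof -
    have "\<forall>\<^sub>F n::nat in sequentially. ln (real n) + c \<ge> 0" by real_asymp
    then show ?thesis using eventually_ge_at_top[of 4]
    proof eventually_elim
      case (elim n)
      then show ?case using bad_probability_time[of n "\<bar>c\<bar>" c] by (simp add: mult.assoc)
    qed
  qed
  have "(\<lambda>n. (ln (real n) + c) / real n) \<longlonglongrightarrow> 0" by real_asymp
  from tendsto_mult_right[OF this] show "(\<lambda>n. (ln (real n) + c) / real n * (exp ((1 - c) / 2) * bad_const (\<bar>c\<bar> + 1))) \<longlonglongrightarrow> 0"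
    by simp
qed simp_all

lemma survival_power_tendsto: "(\<lambda>n. (1 - 2 / real n) ^ BF_time n c * real n) \<longlonglongrightarrow> exp (- c)"
proof (rule tendsto_sandwich)
  have ev: "\<forall>\<^sub>F n::nat in sequentially. ln (real n) + c \<ge> 0 \<and> n \<ge> 3"
    by (intro eventually_conj eventually_ge_at_top) real_asymp
  show "\<forall>\<^sub>F n in sequentially. (1 - 2 / real n) powr (real n * (ln (real n) + c) / 2) * real n \<le> (1 - 2 / real n) ^ BF_time n c * real n"
    using ev
  proof eventually_elim
    case (elim n)
    then have p: "0 < 1 - 2 / real n" "1 - 2 / real n \<le> 1" by auto
    have "(1 - 2 / real n) powr (real n * (ln (real n) + c) / 2) \<le> (1 - 2 / real n) powr real (BF_time n c)"
      using p BF_time_bounds[of n c] elim by (intro powr_mono') auto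
    then show ?case using p by (simp add: powr_realpow mult_right_mono)
  qed
  show "\<forall>\<^sub>F n in sequentially. (1 - 2 / real n) ^ BF_time n c * real n \<le> (1 - 2 / real n) powr (real n * (ln (real n) + c) / 2 - 1) * real n"
    using ev
  proof eventually_elim
    case (elim n)
    then have p: "0 < 1 - 2 / real n" "1 - 2 / real n \<le> 1" by auto
    have "(1 - 2 / real n) powr real (BF_time n c) \<le> (1 - 2 / real n) powr (real n * (ln (real n) + c) / 2 - 1)"
      using p BF_time_bounds[of n c] elim by (intro powr_mono') auto
    then show ?case using p by (simp add: powr_realpow mult_right_mono)
  qed
  show "(\<lambda>n. (1 - 2 / real n) powr (real n * (ln (real n) + c) / 2) * real n) \<longlonglongrightarrow> exp (- c)" by real_asymp
  show "(\<lambda>n. (1 - 2 / real n) powr (real n * (ln (real n) + c) / 2 - 1) * real n) \<longlonglongrightarrow> exp (- c)" by real_asymp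
qed

lemma no_isolated_limit:
  "(\<lambda>n. BF_prob n (BF_time n c) (\<lambda>E. iso_count n E = 0)) \<longlonglongrightarrow> exp (- (BF_K * exp (- c)))"
proof -
  define err :: "nat \<Rightarrow> real \<Rightarrow> real \<Rightarrow> real \<Rightarrow> real" where "err n M m q = 8 * M * (exp 5 * m / real n + exp 14 * m ^ 2)
      + (q ^ 2 * real n * (exp 5 * m) + q * real n * (exp 5 * m / real n + exp 14 * m ^ 2))
      + 24 * exp 7 * m * (q ^ 2 * real n + q * (M / real n))" for n M m q
  have err_mono: "err n M m q \<le> err n M' m' q'"
    if "0 \<le> M" "M \<le> M'" "0 \<le> m" "m \<le> m'" "0 \<le> q" "q \<le> q'" for n M M' m m' q q'
    unfolding err_def using that
    by (intro add_mono mult_mono divide_right_mono power_mono mult_nonneg_nonneg add_nonneg_nonneg divide_nonneg_nonneg zero_le_power order_refl) auto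
  define A where "A = exp (1 - c)"
  have A: "A > 0" by (simp add: A_def)
  \<comment> \<open>At the switching time \<open>m\<close> is at most of order
    \<open>n powr (- 4/5)\<close> and \<open>q\<close> at most of order
    \<open>n powr (- 1/5)\<close>; the factors \<open>exp 1\<close> and \<open>A\<close> absorb the
    rounding of the two times.\<close>
  define bound where "bound n = err n (real n * (ln (real n) + c) / 2) (exp 1 * exp (- (4 / 5 * ln (real n)))) (A * exp (- (1 / 5 * ln (real n))))" for n
  have bound0: "bound \<longlonglongrightarrow> 0"
  proof -
    let ?m = "\<lambda>n. exp 1 * exp (- (4 / 5 * ln (real n)))" and ?q = "\<lambda>n. A * exp (- (1 / 5 * ln (real n)))"
    let ?M = "\<lambda>n. real n * (ln (real n) + c) / 2"
    have "(\<lambda>n. 8 * ?M n * (exp 5 * ?m n / real n + exp 14 * ?m n ^ 2)) \<longlonglongrightarrow> 0"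
      "(\<lambda>n. ?q n ^ 2 * real n * (exp 5 * ?m n)) \<longlonglongrightarrow> 0"
      "(\<lambda>n. ?q n * real n * (exp 5 * ?m n / real n + exp 14 * ?m n ^ 2)) \<longlonglongrightarrow> 0"
      "(\<lambda>n. 24 * exp 7 * ?m n * (?q n ^ 2 * real n + ?q n * (?M n / real n))) \<longlonglongrightarrow> 0"
      using A by real_asymp+
    from tendsto_add[OF tendsto_add[OF this(1) tendsto_add[OF this(2,3)]] this(4)]
    show ?thesis unfolding bound_def err_def by (simp only: add_0_right)
  qed
  let ?P = "\<lambda>n. BF_prob n (BF_time n c) (\<lambda>E. iso_count n E = 0)"
  let ?D = "\<lambda>n. exp (- ((1 - 2 / real n) ^ BF_time n c * (real n * BF_K)))"
  have "\<forall>\<^sub>F n::nat in sequentially. 1 / 5 * ln (real n) + c \<ge> 1 \<and> n \<ge> 3 \<and> real n * (ln (real n) + c) / 2 \<le> real n ^ 2"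
    by (intro eventually_conj eventually_ge_at_top) real_asymp+
  then have "\<forall>\<^sub>F n in sequentially. \<bar>?P n - ?D n\<bar> \<le> bound n"
  proof eventually_elim
    case (elim n)
    then have n: "n \<ge> 2" "n \<ge> 1" "real n > 0" and ln0: "ln (real n) \<ge> 0" by auto
    define M where "M = BF_time n c"
    \<comment> \<open>With \<open>a * n * ln n\<close> in place of \<open>2 / 5 * n * ln n\<close>,
      \<open>m\<close> has order \<open>n powr (- 2 * a)\<close> and \<open>q\<close> has order
      \<open>n powr (2 * a - 1)\<close>. The second phase needs \<open>n * ln n * m^2\<close> to
      vanish, so \<open>a > 1/4\<close>; the first needs \<open>q^2 * n * m\<close> to vanish, so
      \<open>a < 1/2\<close>.\<close>
    define L where "L = nat \<lfloor>2 / 5 * (real n * ln (real n))\<rfloor>"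
    have Lb: "real L \<le> 2 / 5 * (real n * ln (real n))" "real L > 2 / 5 * (real n * ln (real n)) - 1"
    proof -
      have "2 / 5 * (real n * ln (real n)) \<ge> 0" using ln0 by simp
      then have "real L = real_of_int \<lfloor>2 / 5 * (real n * ln (real n))\<rfloor>" by (simp add: L_def)
      then show "real L \<le> 2 / 5 * (real n * ln (real n))" "real L > 2 / 5 * (real n * ln (real n)) - 1" by linarith+
    qed
    have nc: "ln (real n) + c \<ge> 0" using elim ln0 by linarith
    have Mb: "real M \<le> real n * (ln (real n) + c) / 2" "real M > real n * (ln (real n) + c) / 2 - 1"
      unfolding M_def by (rule BF_time_bounds[OF nc])+
    have M2: "real M \<le> real n ^ 2" using Mb elim by linarith
    define w where "w = 1 / 5 * ln (real n) + c"
    have w1: "2 * (real M - real L) \<ge> real n * w - 2"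
      using Mb Lb by (simp add: w_def algebra_simps)
    have "3 * 1 \<le> real n * w" using elim by (intro mult_mono) (auto simp: w_def)
    then have "0 \<le> real n * w - 2" by simp
    with w1 have "0 \<le> 2 * (real M - real L)" by (rule order_trans[rotated])
    then have "real L \<le> real M" by simp
    have "(real n * w - 2) / real n \<le> 2 * (real M - real L) / real n"
      using w1 by (intro divide_right_mono) auto
    moreover have "(real n * w - 2) / real n = w - 2 / real n"
      using n by (simp add: diff_divide_distrib)
    ultimately have LM: "2 * (real M - real L) / real n \<ge> 1 / 5 * ln (real n) + c - 2 / real n" "L \<le> M"
      using \<open>real L \<le> real M\<close> by (auto simp: w_def)
    have n2: "2 / real n \<le> 1" using n by simp
    define m where "m = exp (- (2 * real L / real n))"
    define q where "q = (1 - 2 / real n) ^ (M - L)"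
    have m: "0 \<le> m" "m \<le> exp 1 * exp (- (4 / 5 * ln (real n)))"
    proof -
      have "(real n * (4 / 5 * ln (real n)) - 2) / real n \<le> 2 * real L / real n"
        using Lb by (intro divide_right_mono) auto
      moreover have "(real n * (4 / 5 * ln (real n)) - 2) / real n = 4 / 5 * ln (real n) - 2 / real n"
        using n by (simp add: diff_divide_distrib)
      ultimately have "2 * real L / real n \<ge> 4 / 5 * ln (real n) - 2 / real n" by simp
      then have "- (2 * real L / real n) \<le> 1 + - (4 / 5 * ln (real n))" using n2 by linarith
      then show "m \<le> exp 1 * exp (- (4 / 5 * ln (real n)))" unfolding m_def exp_add[symmetric] exp_le_cancel_iff .
    qed (simp add: m_def)
    have q: "0 \<le> q" "q \<le> A * exp (- (1 / 5 * ln (real n)))"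
    proof -
      show "0 \<le> q" using n by (simp add: q_def)
      have "q \<le> exp (- (2 * real (M - L) / real n))" unfolding q_def by (rule one_minus_power_le_exp[OF n(1)])
      also have "- (2 * real (M - L) / real n) \<le> (1 - c) + - (1 / 5 * ln (real n))"
        using LM n2 by (simp add: of_nat_diff)
      finally show "q \<le> A * exp (- (1 / 5 * ln (real n)))" unfolding A_def exp_add[symmetric] by simp
    qed
    have "\<bar>?P n - ?D n\<bar> \<le> err n (real M) m q"
      using no_isolated_estimate[OF n(1) M2 LM(2)] unfolding BF_prob_eq[OF n(2)] M_def[symmetric] err_def m_def q_def .
    also have "\<dots> \<le> bound n" unfolding bound_def using Mb m q by (intro err_mono) auto
    finally show ?case .
  qed
  then have diff: "(\<lambda>n. ?P n - ?D n) \<longlonglongrightarrow> 0"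
    by (intro Lim_null_comparison[OF _ bound0]) simp
  have "?D \<longlonglongrightarrow> exp (- (exp (- c) * BF_K))"
    using tendsto_exp[OF tendsto_minus[OF tendsto_mult_right[OF survival_power_tendsto[of c], of BF_K]]] by (simp add: mult.assoc)
  from tendsto_add[OF diff this] show ?thesis by (simp add: mult.commute)
qed

section \<open>The two hitting times\<close>

lemma Inf_enat_image_le_iff: "Inf (enat ` A) \<le> enat N \<longleftrightarrow> (\<exists>M\<in>A. M \<le> N)"
proof
  show "\<exists>M\<in>A. M \<le> N" if "Inf (enat ` A) \<le> enat N"
  proof (rule ccontr)
    assume "\<not> (\<exists>M\<in>A. M \<le> N)"
    then have "enat (Suc N) \<le> Inf (enat ` A)" by (intro Inf_greatest) (auto simp: not_le)
    then have "enat (Suc N) \<le> enat N" using that by (rule order_trans)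
    then show False by simp
  qed
  show "Inf (enat ` A) \<le> enat N" if "\<exists>M\<in>A. M \<le> N"
    using that by (auto intro: Inf_lower2)
qed

lemma BF_graph_mono: "M \<le> N \<Longrightarrow> BF_graph \<omega> M \<subseteq> BF_graph \<omega> N"
proof (induction N rule: dec_induct)
  case (step N)
  have "BF_graph \<omega> N \<subseteq> BF_graph \<omega> (Suc N)" by (auto simp: BF_step_def add_edge_def)
  then show ?case using step by blast
qed simp

lemma graph_connected_mono:
  assumes "E \<subseteq> E'" "graph_connected n E" shows "graph_connected n E'"
proof -
  have "{(x, y). {x, y} \<in> E}\<^sup>* \<subseteq> {(x, y). {x, y} \<in> E'}\<^sup>*" using assms(1) by (intro rtrancl_mono) auto
  then show ?thesis using assms(2) unfolding graph_connected_def by blast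
qed

lemma no_isolated_mono: "E \<subseteq> E' \<Longrightarrow> iso_count n E = 0 \<Longrightarrow> iso_count n E' = 0"
  unfolding iso_count_eq_0_iff isolated_def by blast

lemma BF_T_con_le_iff: "BF_T_con n \<omega> \<le> enat N \<longleftrightarrow> graph_connected n (BF_graph \<omega> N)"
  unfolding BF_T_con_def Inf_enat_image_le_iff
  by (auto intro: graph_connected_mono[OF BF_graph_mono])

lemma BF_T_iso_le_iff: "BF_T_iso n \<omega> \<le> enat N \<longleftrightarrow> iso_count n (BF_graph \<omega> N) = 0"
proof -
  have "BF_T_iso n \<omega> \<le> enat N \<longleftrightarrow> (\<exists>M\<in>{N. iso_count n (BF_graph \<omega> N) = 0}. M \<le> N)"
    unfolding BF_T_iso_def Inf_enat_image_le_iff by (simp add: iso_count_eq_0_iff)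
  then show ?thesis by (auto intro: no_isolated_mono[OF BF_graph_mono])
qed

lemma enat_eq_iff_le: "a = b \<longleftrightarrow> (\<forall>N. a \<le> enat N \<longleftrightarrow> b \<le> enat N)" for a b :: enat
  by (cases a; cases b) (auto intro: antisym)

lemma BF_T_con_eq_T_iso_iff:
  "BF_T_con n \<omega> = BF_T_iso n \<omega> \<longleftrightarrow> (\<forall>N. graph_connected n (BF_graph \<omega> N) = (iso_count n (BF_graph \<omega> N) = 0))"
  unfolding enat_eq_iff_le[of "BF_T_con n \<omega>"] BF_T_con_le_iff BF_T_iso_le_iff ..

lemma BF_T_con_measurable [measurable]: "BF_T_con n \<in> BF_space n \<rightarrow>\<^sub>M count_space UNIV"
proof -
  have le: "{\<omega> \<in> space (BF_space n). BF_T_con n \<omega> \<le> enat N} \<in> sets (BF_space n)" for N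
    unfolding BF_T_con_le_iff by (rule BF_graph_sets)
  have "BF_T_con n -` {a} \<inter> space (BF_space n) \<in> sets (BF_space n)" for a
  proof -
    have "BF_T_con n -` {a} \<inter> space (BF_space n) = {\<omega> \<in> space (BF_space n). BF_T_con n \<omega> = a}" by auto
    also have "\<dots> = {\<omega> \<in> space (BF_space n). \<forall>N. BF_T_con n \<omega> \<le> enat N \<longleftrightarrow> a \<le> enat N}"
      by (simp only: enat_eq_iff_le[of _ a])
    also have "\<dots> \<in> sets (BF_space n)"
    proof (rule sets.sets_Collect_countable_All)
      fix N
      show "{\<omega> \<in> space (BF_space n). BF_T_con n \<omega> \<le> enat N \<longleftrightarrow> a \<le> enat N} \<in> sets (BF_space n)"
        unfolding BF_T_con_le_iff by (rule BF_graph_sets[of n "\<lambda>E. graph_connected n E \<longleftrightarrow> a \<le> enat N"])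
    qed
    finally show ?thesis .
  qed
  moreover have "countable (UNIV :: enat set)" by simp
  ultimately show ?thesis by (subst measurable_count_space_eq2_countable) auto
qed

lemma ereal_of_enat_le_ereal_iff:
  assumes "y \<ge> 0"
  shows "ereal_of_enat a \<le> ereal y \<longleftrightarrow> a \<le> enat (nat \<lfloor>y\<rfloor>)"
  using assms by (cases a) (simp_all add: le_nat_iff le_floor_iff)

lemma connected_probability_bounds:
  assumes n: "n \<ge> 2"
  shows "BF_prob n N (graph_connected n) \<le> BF_prob n N (\<lambda>E. iso_count n E = 0)"
    and "BF_prob n N (\<lambda>E. iso_count n E = 0) \<le> BF_prob n N (graph_connected n) + BF_prob n N (BF_bad n)"
proof -
  have n1: "n \<ge> 1" using n by simp
  show "BF_prob n N (graph_connected n) \<le> BF_prob n N (\<lambda>E. iso_count n E = 0)"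
    using connected_imp_no_isolated[OF n] by (intro BF_prob_mono n1)
  have "BF_prob n N (\<lambda>E. iso_count n E = 0) \<le> BF_prob n N (\<lambda>E. graph_connected n E \<or> BF_bad n E)"
    using disconnected_imp_bad by (intro BF_prob_mono n1) blast
  also have "\<dots> \<le> BF_prob n N (graph_connected n) + BF_prob n N (BF_bad n)" by (rule BF_prob_disj_le[OF n1])
  finally show "BF_prob n N (\<lambda>E. iso_count n E = 0) \<le> BF_prob n N (graph_connected n) + BF_prob n N (BF_bad n)" .
qed

lemma connected_limit:
  "(\<lambda>n. BF_prob n (BF_time n c) (graph_connected n)) \<longlonglongrightarrow> exp (- (BF_K * exp (- c)))"
proof (rule tendsto_sandwich)
  show "\<forall>\<^sub>F n in sequentially. BF_prob n (BF_time n c) (\<lambda>E. iso_count n E = 0) - BF_prob n (BF_time n c) (BF_bad n)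
      \<le> BF_prob n (BF_time n c) (graph_connected n)"
    using eventually_ge_at_top[of 2]
  proof eventually_elim
    case (elim n)
    show ?case using connected_probability_bounds(2)[OF elim, of "BF_time n c"] by simp
  qed
  show "\<forall>\<^sub>F n in sequentially. BF_prob n (BF_time n c) (graph_connected n) \<le> BF_prob n (BF_time n c) (\<lambda>E. iso_count n E = 0)"
    using eventually_ge_at_top[of 2] by eventually_elim (rule connected_probability_bounds(1))
  show "(\<lambda>n. BF_prob n (BF_time n c) (\<lambda>E. iso_count n E = 0) - BF_prob n (BF_time n c) (BF_bad n)) \<longlonglongrightarrow> exp (- (BF_K * exp (- c)))"
    using tendsto_diff[OF no_isolated_limit bad_probability_tendsto] by simp
qed (rule no_isolated_limit)

lemma T_con_limit:
  "(\<lambda>n. measure (BF_space n) {\<omega> \<in> space (BF_space n).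
      ereal_of_enat (BF_T_con n \<omega>) \<le> ereal ((real n * ln (real n) + c * real n) / 2)})
    \<longlonglongrightarrow> exp (- (BF_K * exp (- c)))"
proof (rule Lim_transform_eventually[OF connected_limit[of c]])
  have "\<forall>\<^sub>F n::nat in sequentially. (real n * ln (real n) + c * real n) / 2 \<ge> 0" by real_asymp
  then show "\<forall>\<^sub>F n in sequentially. BF_prob n (BF_time n c) (graph_connected n) =
    measure (BF_space n) {\<omega> \<in> space (BF_space n).
      ereal_of_enat (BF_T_con n \<omega>) \<le> ereal ((real n * ln (real n) + c * real n) / 2)}"
  proof eventually_elim
    case (elim n)
    show ?case
      unfolding ereal_of_enat_le_ereal_iff[OF elim] BF_time_def[symmetric] BF_T_con_le_iff BF_prob_def ..
  qed
qed

section \<open>Connectivity coincides with the disappearance of isolated vertices\<close>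

text \<open>The only way in which a bad set can arise from a graph that is not bad. In the critical
  window a given round does this with probability of order \<open>1 / n^2\<close>, so all rounds of
  the window can be excluded at once.\<close>

definition joins_isolated :: "nat set set \<Rightarrow> nat set set \<Rightarrow> bool" where
  "joins_isolated E E' \<longleftrightarrow> (\<exists>u v. u \<noteq> v \<and> isolated E u \<and> isolated E v \<and> {u, v} \<in> E')"

lemma BF_avg_joins_isolated:
  assumes n: "n \<ge> 1"
  shows "BF_avg n (\<lambda>E'. of_bool (joins_isolated E E')) E \<le> 2 / real n ^ 2 * (real (iso_count n E) * (real (iso_count n E) - 1))"
proof -
  let ?I = "iso_set n E" and ?V = "{1..n}" and ?k = "real (iso_count n E)"
  have le: "of_bool (joins_isolated E (add_edge a b E)) \<le> (of_bool (a \<in> ?I \<and> b \<in> ?I \<and> a \<noteq> b) :: real)"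
    if "a \<in> ?V" "b \<in> ?V" for a b
  proof (cases "joins_isolated E (add_edge a b E)")
    case True
    then obtain u v where uv: "u \<noteq> v" "isolated E u" "isolated E v" "{u, v} \<in> add_edge a b E"
      by (auto simp: joins_isolated_def)
    then have "{u, v} \<notin> E" by (auto simp: isolated_def)
    then have "a \<noteq> b" "{u, v} = {a, b}" using uv by (auto simp: add_edge_def split: if_splits)
    then have "isolated E a" "isolated E b" using uv by (auto simp: doubleton_eq_iff)
    then show ?thesis using that \<open>a \<noteq> b\<close> by (auto simp: iso_set_def)
  qed simp
  have II: "(\<Sum>a\<in>?I. \<Sum>b\<in>?I. of_bool (a \<in> ?I \<and> b \<in> ?I \<and> a \<noteq> b) :: real) = ?k * (?k - 1)"
  proof -
    have "(\<Sum>b\<in>?I. of_bool (a \<in> ?I \<and> b \<in> ?I \<and> a \<noteq> b) :: real) = ?k - 1" if "a \<in> ?I" for a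
    proof -
      have "card ?I \<ge> 1" using that card_gt_0_iff[of ?I] by (auto simp: Suc_le_eq)
      have "(\<Sum>b\<in>?I. of_bool (a \<in> ?I \<and> b \<in> ?I \<and> a \<noteq> b) :: real) = (\<Sum>b\<in>?I - {a}. 1)"
        using that by (intro sum.mono_neutral_cong_right) auto
      then show ?thesis using that \<open>card ?I \<ge> 1\<close> by (simp add: iso_count_def of_nat_diff)
    qed
    then show ?thesis by (simp add: iso_count_def)
  qed
  have VV: "(\<Sum>a\<in>?V. \<Sum>b\<in>?V. of_bool (a \<in> ?I \<and> b \<in> ?I \<and> a \<noteq> b) :: real) = ?k * (?k - 1)"
    unfolding II[symmetric]
    using iso_set_subset[of n E] by (intro sum.mono_neutral_cong_right) (auto intro!: sum.mono_neutral_right sum.neutral)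
  have kk: "?k * (?k - 1) \<ge> 0" by (cases "iso_count n E") auto
  have x: "(?k / real n) ^ 2 \<le> 1" using iso_count_le[of n E] n by (intro power_le_one) auto
  have "BF_avg n (\<lambda>E'. of_bool (joins_isolated E E')) E \<le>
     (\<Sum>a\<in>?I. \<Sum>b\<in>?I. of_bool (a \<in> ?I \<and> b \<in> ?I \<and> a \<noteq> b)) / real n ^ 2 +
     1 * ((\<Sum>a\<in>?V. \<Sum>b\<in>?V. of_bool (a \<in> ?I \<and> b \<in> ?I \<and> a \<noteq> b)) / real n ^ 2)"
    unfolding BF_avg_eq[OF n]
  proof (rule add_mono)
    show "(\<Sum>a\<in>?I. \<Sum>b\<in>?I. of_bool (joins_isolated E (add_edge a b E))) / real n ^ 2 \<le>
      (\<Sum>a\<in>?I. \<Sum>b\<in>?I. of_bool (a \<in> ?I \<and> b \<in> ?I \<and> a \<noteq> b) :: real) / real n ^ 2"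
      using iso_set_subset[of n E] by (intro divide_right_mono sum_mono le) auto
    show "(1 - (?k / real n) ^ 2) * ((\<Sum>a\<in>?V. \<Sum>b\<in>?V. of_bool (joins_isolated E (add_edge a b E))) / real n ^ 2) \<le>
      1 * ((\<Sum>a\<in>?V. \<Sum>b\<in>?V. of_bool (a \<in> ?I \<and> b \<in> ?I \<and> a \<noteq> b) :: real) / real n ^ 2)"
    proof (rule mult_mono)
      show "(\<Sum>a\<in>?V. \<Sum>b\<in>?V. of_bool (joins_isolated E (add_edge a b E)) :: real) / real n ^ 2 \<le>
         (\<Sum>a\<in>?V. \<Sum>b\<in>?V. of_bool (a \<in> ?I \<and> b \<in> ?I \<and> a \<noteq> b) :: real) / real n ^ 2"
        by (intro divide_right_mono sum_mono le) auto
    qed (use x in \<open>auto intro!: divide_nonneg_nonneg sum_nonneg\<close>)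
  qed
  then show ?thesis unfolding II VV by simp
qed

lemma joins_isolated_sets [measurable]:
  "{\<omega> \<in> space (BF_space n). joins_isolated (BF_graph \<omega> t) (BF_graph \<omega> (Suc t))} \<in> sets (BF_space n)"
proof -
  have "(\<lambda>\<omega>. joins_isolated (BF_graph \<omega> t) (BF_step (\<omega> (t, 1)) (\<omega> (t, 2)) (\<omega> (t, 3)) (\<omega> (t, 4)) (BF_graph \<omega> t)))
      \<in> BF_space n \<rightarrow>\<^sub>M count_space UNIV"
    by (rule BF_quad_measurable[OF BF_graph_measurable, where h = "\<lambda>a b c d E. joins_isolated E (BF_step a b c d E)"])
  then show ?thesis by (simp add: pred_def)
qed

lemma joins_isolated_probability:
  assumes n: "n \<ge> 1"
  shows "measure (BF_space n) {\<omega> \<in> space (BF_space n). joins_isolated (BF_graph \<omega> t) (BF_graph \<omega> (Suc t))}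
    \<le> 2 * (exp 2 * cut_rate n 2 ^ t)"
proof -
  interpret prob_space "BF_space n" using n by (rule prob_space_BF)
  let ?J = "{\<omega> \<in> space (BF_space n). joins_isolated (BF_graph \<omega> t) (BF_graph \<omega> (Suc t))}"
  note int = BF_graph_integrable[OF n, where N = t]
  have "measure (BF_space n) ?J = (\<integral>\<omega>. indicator ?J \<omega> \<partial>BF_space n)"
    by (auto intro!: arg_cong[where f = "measure (BF_space n)"])
  also have "\<dots> = (\<integral>\<omega>. of_bool (joins_isolated (BF_graph \<omega> t) (BF_graph \<omega> (Suc t))) \<partial>BF_space n)"
    by (intro Bochner_Integration.integral_cong) (auto simp: indicator_def)
  also have "\<dots> = (\<integral>\<omega>. BF_avg n (\<lambda>E'. of_bool (joins_isolated (BF_graph \<omega> t) E')) (BF_graph \<omega> t) \<partial>BF_space n)"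
    by (rule BF_Markov2[OF n])
  also have "\<dots> \<le> (\<integral>\<omega>. 2 / real n ^ 2 * (real (iso_count n (BF_graph \<omega> t)) * (real (iso_count n (BF_graph \<omega> t)) - 1)) \<partial>BF_space n)"
    by (intro integral_mono BF_avg_joins_isolated n
      int[where f = "\<lambda>E. BF_avg n (\<lambda>E'. of_bool (joins_isolated E E')) E"]
      int[where f = "\<lambda>E. 2 / real n ^ 2 * (real (iso_count n E) * (real (iso_count n E) - 1))"])
  also have "\<dots> = 2 / real n ^ 2 * (\<integral>\<omega>. real (iso_count n (BF_graph \<omega> t)) * (real (iso_count n (BF_graph \<omega> t)) - 1) \<partial>BF_space n)"
    by (rule integral_mult_right_zero)
  also have "\<dots> \<le> 2 / real n ^ 2 * (real n ^ 2 * (exp 2 * cut_rate n 2 ^ t))"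
    by (intro mult_left_mono expectation_iso_pairs n) simp
  finally show ?thesis using n by simp
qed

text \<open>A set \<open>S\<close> witnessing badness after the round had no boundary edges before
  it either. As the old graph is not bad, \<open>S\<close> then contained no edge at all, so all its
  vertices were isolated, and the new edge inside \<open>S\<close> joins two of them.\<close>

lemma not_bad_step:
  assumes E: "E' \<in> BF_states n" "E \<subseteq> E'" "\<not> BF_bad n E" "\<not> joins_isolated E E'"
  shows "\<not> BF_bad n E'"
proof
  assume "BF_bad n E'"
  then obtain S e where S: "S \<subseteq> {1..n}" "2 \<le> card S" "2 * card S \<le> n" "cut_free S E'" "e \<in> E'" "e \<subseteq> S"
    by (auto simp: BF_bad_def)
  have cf: "cut_free S E" using S E by (auto simp: cut_free_def)
  then have no: "\<not> (\<exists>e\<in>E. e \<subseteq> S)" using S E(3) by (auto simp: BF_bad_def)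
  have iso: "isolated E v" if "v \<in> S" for v
    using no cf that by (auto simp: isolated_def cut_free_def)
  obtain a b where "a \<noteq> b" "e = {a, b}" by (rule BF_states_edgeE[OF E(1) S(5)])
  then have "joins_isolated E E'" using iso S by (auto simp: joins_isolated_def)
  then show False using E by simp
qed

text \<open>Badness at the single time \<open>M\<close> controls the whole window: without joins of
  isolated vertices no graph up to time \<open>N\<close> is bad, so there connectedness and absence
  of isolated vertices coincide. Before \<open>M\<close> both fail, after \<open>N\<close> both
  hold, by monotonicity.\<close>

lemma T_con_eq_T_iso_sufficient:
  assumes n: "n \<ge> 2" and \<omega>: "\<omega> \<in> space (BF_space n)" and MN: "M \<le> N"
    and M: "\<not> BF_bad n (BF_graph \<omega> M)" "iso_count n (BF_graph \<omega> M) \<noteq> 0"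
    and N: "iso_count n (BF_graph \<omega> N) = 0"
    and J: "\<And>t. t \<in> {M..<N} \<Longrightarrow> \<not> joins_isolated (BF_graph \<omega> t) (BF_graph \<omega> (Suc t))"
  shows "BF_T_con n \<omega> = BF_T_iso n \<omega>"
  unfolding BF_T_con_eq_T_iso_iff
proof (intro allI iffI)
  fix t assume "graph_connected n (BF_graph \<omega> t)"
  then show "iso_count n (BF_graph \<omega> t) = 0" by (rule connected_imp_no_isolated[OF n])
next
  fix t assume t: "iso_count n (BF_graph \<omega> t) = 0"
  have nb: "\<not> BF_bad n (BF_graph \<omega> t)" if "M \<le> t" "t \<le> N" for t
    using that
  proof (induction t rule: dec_induct)
    case (step t)
    then show ?case using J[of t] BF_graph_mono[of t "Suc t"] BF_graph_states[OF \<omega>]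
      by (intro not_bad_step[of "BF_graph \<omega> (Suc t)" n "BF_graph \<omega> t"]) (auto simp del: BF_graph.simps)
  qed (rule M)
  have conn: "graph_connected n (BF_graph \<omega> s)" if "M \<le> s" "s \<le> N" "iso_count n (BF_graph \<omega> s) = 0" for s
    using disconnected_imp_bad[OF BF_graph_states[OF \<omega>]] nb that by blast
  have "M \<le> t" using no_isolated_mono[OF BF_graph_mono t] M(2) by (meson nat_le_linear)
  show "graph_connected n (BF_graph \<omega> t)"
  proof (cases "t \<le> N")
    case True
    then show ?thesis using conn t \<open>M \<le> t\<close> by blast
  next
    case False
    then have "BF_graph \<omega> N \<subseteq> BF_graph \<omega> t" by (intro BF_graph_mono) auto
    then show ?thesis using conn[of N] N MN graph_connected_mono by blast
  qed
qed

lemma T_con_eq_T_iso_sets [measurable]: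
  "{\<omega> \<in> space (BF_space n). BF_T_con n \<omega> = BF_T_iso n \<omega>} \<in> sets (BF_space n)"
  unfolding BF_T_con_eq_T_iso_iff
  by (rule sets.sets_Collect_countable_All)
    (rule BF_graph_sets[of n "\<lambda>E. graph_connected n E = (iso_count n E = 0)"])

lemma T_con_eq_T_iso_lower_bound:
  assumes n: "n \<ge> 2" and MN: "M \<le> N"
  shows "measure (BF_space n) {\<omega> \<in> space (BF_space n). BF_T_con n \<omega> = BF_T_iso n \<omega>} \<ge>
    1 - (BF_prob n M (BF_bad n) + BF_prob n M (\<lambda>E. iso_count n E = 0) + (1 - BF_prob n N (\<lambda>E. iso_count n E = 0)) +
      (\<Sum>t\<in>{M..<N}. 2 * (exp 2 * cut_rate n 2 ^ t)))"
proof -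
  have n1: "n \<ge> 1" using n by simp
  interpret prob_space "BF_space n" using n1 by (rule prob_space_BF)
  let ?W = "space (BF_space n)"
  let ?A = "{\<omega> \<in> ?W. BF_T_con n \<omega> = BF_T_iso n \<omega>}"
  let ?B1 = "{\<omega> \<in> ?W. BF_bad n (BF_graph \<omega> M)}" and ?B2 = "{\<omega> \<in> ?W. iso_count n (BF_graph \<omega> M) = 0}"
  let ?B3 = "{\<omega> \<in> ?W. \<not> iso_count n (BF_graph \<omega> N) = 0}"
  let ?J = "\<lambda>t. {\<omega> \<in> ?W. joins_isolated (BF_graph \<omega> t) (BF_graph \<omega> (Suc t))}"
  have sub: "?W \<subseteq> ?A \<union> (?B1 \<union> (?B2 \<union> (?B3 \<union> (\<Union>t\<in>{M..<N}. ?J t))))"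
    using T_con_eq_T_iso_sufficient[OF n _ MN] by blast
  have sA: "?A \<in> events" by (rule T_con_eq_T_iso_sets)
  have sB: "?B1 \<in> events" "?B2 \<in> events" "?B3 \<in> events"
    by (rule BF_graph_sets[of n "BF_bad n"], rule BF_graph_sets[of n "\<lambda>E. iso_count n E = 0"],
      rule BF_graph_sets[of n "\<lambda>E. \<not> iso_count n E = 0"])
  have sJ: "?J t \<in> events" for t by (rule joins_isolated_sets)
  then have sU: "(\<Union>t\<in>{M..<N}. ?J t) \<in> events" by (intro sets.finite_UN) simp_all
  note sB3 = sets.Un[OF sB(3) sU] and sB23 = sets.Un[OF sB(2) sets.Un[OF sB(3) sU]]
  note sB123 = sets.Un[OF sB(1) sB23]
  have "1 = prob ?W" by (simp only: prob_space)
  also have "\<dots> \<le> prob (?A \<union> (?B1 \<union> (?B2 \<union> (?B3 \<union> (\<Union>t\<in>{M..<N}. ?J t)))))"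
    by (rule finite_measure_mono[OF sub sets.Un[OF sA sB123]])
  also have "\<dots> \<le> prob ?A + prob (?B1 \<union> (?B2 \<union> (?B3 \<union> (\<Union>t\<in>{M..<N}. ?J t))))"
    by (rule measure_Un_le[OF sA sB123])
  also have "prob (?B1 \<union> (?B2 \<union> (?B3 \<union> (\<Union>t\<in>{M..<N}. ?J t)))) \<le> prob ?B1 + prob (?B2 \<union> (?B3 \<union> (\<Union>t\<in>{M..<N}. ?J t)))"
    by (rule measure_Un_le[OF sB(1) sB23])
  also have "prob (?B2 \<union> (?B3 \<union> (\<Union>t\<in>{M..<N}. ?J t))) \<le> prob ?B2 + prob (?B3 \<union> (\<Union>t\<in>{M..<N}. ?J t))"
    by (rule measure_Un_le[OF sB(2) sB3])
  also have "prob (?B3 \<union> (\<Union>t\<in>{M..<N}. ?J t)) \<le> prob ?B3 + prob (\<Union>t\<in>{M..<N}. ?J t)"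
    by (rule measure_Un_le[OF sB(3) sU])
  also have "prob (\<Union>t\<in>{M..<N}. ?J t) \<le> (\<Sum>t\<in>{M..<N}. prob (?J t))"
    using sJ by (intro finite_measure_subadditive_finite) auto
  also have "\<dots> \<le> (\<Sum>t\<in>{M..<N}. 2 * (exp 2 * cut_rate n 2 ^ t))"
    by (intro sum_mono joins_isolated_probability n1)
  also have "prob ?B3 = 1 - BF_prob n N (\<lambda>E. iso_count n E = 0)"
    using BF_prob_not[OF n1, of N "\<lambda>E. iso_count n E = 0"] by (simp only: BF_prob_def)
  finally show ?thesis unfolding BF_prob_def by simp
qed

lemma T_con_eq_T_iso_limit:
  "(\<lambda>n. measure (BF_space n) {\<omega> \<in> space (BF_space n). BF_T_con n \<omega> = BF_T_iso n \<omega>}) \<longlonglongrightarrow> 1"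
proof (rule LIMSEQ_I)
  fix e :: real assume e: "e > 0"
  let ?A = "\<lambda>n. measure (BF_space n) {\<omega> \<in> space (BF_space n). BF_T_con n \<omega> = BF_T_iso n \<omega>}"
  \<comment> \<open>The two summands are the limiting probabilities that the last isolated vertex
    has vanished by time scale \<open>- L\<close>, and that it is still present at time scale
    \<open>L\<close>.\<close>
  have "((\<lambda>L. exp (- (BF_K * exp L)) + (1 - exp (- (BF_K * exp (- L))))) \<longlongrightarrow> 0) at_top"
    using BF_K_pos by real_asymp
  then have "\<forall>\<^sub>F L in at_top. exp (- (BF_K * exp L)) + (1 - exp (- (BF_K * exp (- L)))) < e"
    using e by (intro order_tendstoD) auto
  then have "\<forall>\<^sub>F L in at_top. exp (- (BF_K * exp L)) + (1 - exp (- (BF_K * exp (- L)))) < e \<and> L \<ge> 0"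
    using eventually_ge_at_top[of 0] by (rule eventually_conj)
  then obtain L where L: "exp (- (BF_K * exp L)) + (1 - exp (- (BF_K * exp (- L)))) < e" "L \<ge> 0"
    using eventually_happens[of _ at_top] by (metis (no_types, lifting) trivial_limit_at_top_linorder)
  let ?M = "\<lambda>n. BF_time n (- L)" and ?N = "\<lambda>n. BF_time n L"
  let ?iso = "\<lambda>n. (\<lambda>E. iso_count n E = 0)"
  define f where "f n = BF_prob n (?M n) (BF_bad n) + BF_prob n (?M n) (?iso n) + (1 - BF_prob n (?N n) (?iso n)) +
    exp (18 + 2 * L) * ((ln (real n) + L) / real n)" for n
  have "(\<lambda>n. exp (18 + 2 * L) * ((ln (real n) + L) / real n)) \<longlonglongrightarrow> exp (18 + 2 * L) * 0"
    by (intro tendsto_mult_left) real_asymp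
  then have "f \<longlonglongrightarrow> 0 + exp (- (BF_K * exp (- (- L)))) + (1 - exp (- (BF_K * exp (- L)))) + exp (18 + 2 * L) * 0"
    unfolding f_def by (intro tendsto_add tendsto_diff tendsto_const bad_probability_tendsto no_isolated_limit)
  then have "\<forall>\<^sub>F n in sequentially. f n < e" using L by (intro order_tendstoD) auto
  moreover have "\<forall>\<^sub>F n::nat in sequentially. ln (real n) - L \<ge> 0 \<and> n \<ge> 2 \<and> real n * (ln (real n) + L) / 2 \<le> real n ^ 2"
    by (intro eventually_conj eventually_ge_at_top) real_asymp+
  ultimately have "\<forall>\<^sub>F n in sequentially. norm (?A n - 1) < e"
  proof eventually_elim
    case (elim n)
    then have n: "n \<ge> 2" "n \<ge> 1" "real n > 0" by auto
    have nL: "ln (real n) + L \<ge> 0" "ln (real n) + - L \<ge> 0" using elim L by linarith+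
    have Mb: "real (?M n) > real n * (ln (real n) + - L) / 2 - 1" using BF_time_bounds(2)[OF nL(2)] .
    have Nb: "real (?N n) \<le> real n * (ln (real n) + L) / 2" using BF_time_bounds(1)[OF nL(1)] .
    have MN: "?M n \<le> ?N n"
      unfolding BF_time_def using L by (intro nat_mono floor_mono divide_right_mono add_left_mono mult_right_mono) auto
    interpret prob_space "BF_space n" using n(2) by (rule prob_space_BF)
    have term_le: "2 * (exp 2 * cut_rate n 2 ^ t) \<le> 2 * exp (18 + 2 * L) / real n ^ 2" if t: "t \<in> {?M n..<?N n}" for t
    proof -
      have "real t \<le> real (?N n)" using t by simp
      also have "\<dots> \<le> real n * (ln (real n) + L) / 2" by (rule Nb)
      also have "\<dots> \<le> real n ^ 2" using elim by blast
      finally have t2: "real t \<le> real n ^ 2" .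
      have "cut_rate n 2 ^ t \<le> exp 12 * exp (- (4 * real t / real n))"
        using cut_rate_power_le[OF n(2) t2, of 2] by simp
      also have "- (4 * real t / real n) \<le> 4 + 2 * L - 2 * ln (real n)"
      proof -
        have "real t > real n * (ln (real n) + - L) / 2 - 1" using Mb t by auto
        then have "4 * real t \<ge> real n * (2 * (ln (real n) - L)) - 4" by (simp add: algebra_simps)
        then have "(real n * (2 * (ln (real n) - L)) - 4) / real n \<le> 4 * real t / real n" by (intro divide_right_mono) auto
        also have "(real n * (2 * (ln (real n) - L)) - 4) / real n = 2 * (ln (real n) - L) - 4 / real n"
          using n by (simp add: diff_divide_distrib)
        finally have 1: "2 * (ln (real n) - L) - 4 / real n \<le> 4 * real t / real n" .
        have 2: "4 / real n \<le> 4" using n by (simp add: divide_le_eq)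
        from 1 2 show ?thesis by (simp add: algebra_simps)
      qed
      finally have "cut_rate n 2 ^ t \<le> exp 12 * exp (4 + 2 * L - 2 * ln (real n))" by simp
      then have "exp 2 * cut_rate n 2 ^ t \<le> exp 2 * (exp 12 * exp (4 + 2 * L - 2 * ln (real n)))" by simp
      also have "\<dots> = exp (18 + 2 * L) * exp (- (2 * ln (real n)))" by (simp add: exp_add[symmetric])
      also have "exp (- (2 * ln (real n))) = 1 / real n ^ 2"
        using n by (simp add: exp_minus exp_double divide_inverse)
      finally show ?thesis by simp
    qed
    have "(\<Sum>t\<in>{?M n..<?N n}. 2 * (exp 2 * cut_rate n 2 ^ t)) \<le> (\<Sum>t\<in>{?M n..<?N n}. 2 * exp (18 + 2 * L) / real n ^ 2)"
      by (intro sum_mono term_le)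
    also have "\<dots> = real (?N n - ?M n) * (2 * exp (18 + 2 * L) / real n ^ 2)" by simp
    \<comment> \<open>The length of the window is bounded by its right end. This costs a factor of
      order \<open>ln n\<close>, affordable against \<open>n\<close> rounds of probability
      \<open>1 / n^2\<close>.\<close>
    also have "\<dots> \<le> (real n * (ln (real n) + L) / 2) * (2 * exp (18 + 2 * L) / real n ^ 2)"
      using Nb by (intro mult_right_mono) (auto simp: of_nat_diff MN)
    also have "\<dots> = exp (18 + 2 * L) * ((ln (real n) + L) / real n)"
      using n by (simp add: power2_eq_square)
    finally have "1 - f n \<le> ?A n" using T_con_eq_T_iso_lower_bound[OF n(1) MN] unfolding f_def by linarith
    moreover have "?A n \<le> 1" by (rule prob_le_1)
    ultimately show ?case using elim by simp
  qed
  then show "\<exists>no. \<forall>n\<ge>no. norm (?A n - 1) < e" by (simp add: eventually_sequentially)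
qed

section \<open>The expectation as a series\<close>

text \<open>The outcome \<open>(u, w, u, w)\<close> with \<open>u\<close> inside and
  \<open>w\<close> outside adds a crossing edge whichever pair is accepted. This crude rate serves
  only to make the expectation finite for each fixed \<open>n\<close>.\<close>

lemma BF_avg_cut_free:
  assumes n: "n \<ge> 1" and S: "S \<subseteq> {1..n}" "S \<noteq> {}" "S \<noteq> {1..n}"
  shows "BF_avg n (\<lambda>E. of_bool (cut_free S E)) E \<le> (1 - 1 / real n ^ 4) * of_bool (cut_free S E)"
proof (cases "cut_free S E")
  case False
  then have "\<not> cut_free S (add_edge c d E)" for c d using cut_free_add_edge_imp by blast
  then have "\<not> cut_free S (BF_step a b c d E)" for a b c d by (simp add: BF_step_def)
  then have "BF_avg n (\<lambda>E. of_bool (cut_free S E)) E = 0" unfolding BF_avg_def by simp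
  then show ?thesis using False by simp
next
  case True
  let ?V = "{1..n}"
  obtain u w where u: "u \<in> S" and w: "w \<in> ?V" "w \<notin> S" using S by blast
  have uV: "u \<in> ?V" using u S by blast
  let ?T = "?V \<times> ?V \<times> ?V \<times> ?V"
  let ?g = "\<lambda>(a, b, c, d). of_bool (cut_free S (BF_step a b c d E)) :: real"
  have "(\<Sum>a\<in>?V. \<Sum>b\<in>?V. \<Sum>c\<in>?V. \<Sum>d\<in>?V. of_bool (cut_free S (BF_step a b c d E)) :: real) = (\<Sum>p\<in>?T. ?g p)"
    by (simp only: sum.cartesian_product)
  also have "\<dots> = ?g (u, w, u, w) + (\<Sum>p\<in>?T - {(u, w, u, w)}. ?g p)"
    using uV w by (intro sum.remove) auto
  also have "?g (u, w, u, w) = 0"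
    using cut_free_add_edge_imp[of S u w E] u w by (auto simp: BF_step_def)
  also have "(\<Sum>p\<in>?T - {(u, w, u, w)}. ?g p) \<le> (\<Sum>p\<in>?T - {(u, w, u, w)}. 1)"
    by (intro sum_mono) auto
  also have "\<dots> = real n ^ 4 - 1"
  proof -
    have "card (?T - {(u, w, u, w)}) = n ^ 4 - 1"
      using uV w by (subst card_Diff_singleton) (auto simp: card_cartesian_product power4_eq_xxxx)
    then show ?thesis using n by (simp add: of_nat_diff)
  qed
  finally have "BF_avg n (\<lambda>E. of_bool (cut_free S E)) E \<le> (real n ^ 4 - 1) / real n ^ 4"
    unfolding BF_avg_def by (intro divide_right_mono) auto
  also have "\<dots> = 1 - 1 / real n ^ 4" using n by (simp add: diff_divide_distrib)
  finally show ?thesis using True by simp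
qed

lemma cut_free_probability:
  assumes n: "n \<ge> 1" and S: "S \<subseteq> {1..n}" "S \<noteq> {}" "S \<noteq> {1..n}"
  shows "BF_prob n N (cut_free S) \<le> (1 - 1 / real n ^ 4) ^ N"
proof (induction N)
  case 0
  show ?case using BF_prob_le_1[OF n] by simp
next
  case (Suc N)
  have r: "0 \<le> 1 - 1 / real n ^ 4" using n by (simp add: divide_le_eq)
  note int = BF_graph_integrable[OF n, where N = N]
  have "BF_prob n (Suc N) (cut_free S) = (\<integral>\<omega>. BF_avg n (\<lambda>E. of_bool (cut_free S E)) (BF_graph \<omega> N) \<partial>BF_space n)"
    unfolding BF_prob_eq[OF n] by (rule BF_Markov[OF n])
  also have "\<dots> \<le> (\<integral>\<omega>. (1 - 1 / real n ^ 4) * of_bool (cut_free S (BF_graph \<omega> N)) \<partial>BF_space n)"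
    by (intro integral_mono BF_avg_cut_free n S int[where f = "BF_avg n (\<lambda>E. of_bool (cut_free S E))"]
       int[where f = "\<lambda>E. (1 - 1 / real n ^ 4) * of_bool (cut_free S E)"])
  also have "\<dots> = (1 - 1 / real n ^ 4) * BF_prob n N (cut_free S)"
    unfolding BF_prob_eq[OF n] by (rule integral_mult_right_zero)
  also have "\<dots> \<le> (1 - 1 / real n ^ 4) * (1 - 1 / real n ^ 4) ^ N" by (intro mult_left_mono Suc r)
  finally show ?case by simp
qed

lemma disconnected_probability_summable:
  assumes n: "n \<ge> 1"
  shows "summable (\<lambda>N. BF_prob n N (\<lambda>E. \<not> graph_connected n E))"
proof (rule summable_comparison_test')
  let ?F = "{S. S \<subseteq> {1..n} \<and> S \<noteq> {} \<and> S \<noteq> {1..n}}"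
  have finF: "finite ?F" by (rule finite_subset[of _ "Pow {1..n}"]) auto
  have r: "0 \<le> 1 - 1 / real n ^ 4" "1 - 1 / real n ^ 4 < 1" using n by (auto simp: divide_le_eq)
  show "summable (\<lambda>N. real (card ?F) * (1 - 1 / real n ^ 4) ^ N)"
    using r by (intro summable_mult summable_geometric) auto
  fix N
  have "BF_prob n N (\<lambda>E. \<not> graph_connected n E) \<le> BF_prob n N (\<lambda>E. \<exists>S\<in>?F. cut_free S E)"
  proof (rule BF_prob_mono[OF n])
    fix E assume "E \<in> BF_states n" "\<not> graph_connected n E"
    then obtain S where S: "S \<subseteq> {1..n}" "S \<noteq> {}" "2 * card S \<le> n" "cut_free S E" by (rule disconnected_cut)
    then have "S \<noteq> {1..n}" using n by auto
    then show "\<exists>S\<in>?F. cut_free S E" using S by blast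
  qed
  also have "\<dots> \<le> (\<integral>\<omega>. (\<Sum>S\<in>?F. of_bool (cut_free S (BF_graph \<omega> N))) \<partial>BF_space n)"
  proof (rule BF_prob_le_expectation[OF n, where f = "\<lambda>E. \<Sum>S\<in>?F. of_bool (cut_free S E)"])
    fix E
    show "of_bool (\<exists>S\<in>?F. cut_free S E) \<le> (\<Sum>S\<in>?F. of_bool (cut_free S E) :: real)"
    proof (cases "\<exists>S\<in>?F. cut_free S E")
      case True
      then obtain S where S: "S \<in> ?F" "cut_free S E" by blast
      then have "1 \<le> (of_bool (cut_free S E) :: real)" by simp
      also have "\<dots> \<le> (\<Sum>S\<in>?F. of_bool (cut_free S E))" by (rule member_le_sum[OF S(1)]) (auto simp: finF)
      finally show ?thesis using True by simp
    qed (auto intro: sum_nonneg)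
  qed
  also have "\<dots> = (\<Sum>S\<in>?F. BF_prob n N (cut_free S))"
    unfolding BF_prob_eq[OF n] by (intro Bochner_Integration.integral_sum BF_graph_integrable[OF n])
  also have "\<dots> \<le> (\<Sum>S\<in>?F. (1 - 1 / real n ^ 4) ^ N)"
    by (intro sum_mono cut_free_probability n) auto
  finally show "norm (BF_prob n N (\<lambda>E. \<not> graph_connected n E)) \<le> real (card ?F) * (1 - 1 / real n ^ 4) ^ N" by simp
qed

lemma BF_expected_T_con_eq:
  assumes n: "n \<ge> 1"
  shows "BF_expected_T_con n = ennreal (\<Sum>N. BF_prob n N (\<lambda>E. \<not> graph_connected n E))"
proof -
  interpret prob_space "BF_space n" using n by (rule prob_space_BF)
  have "BF_expected_T_con n = (\<Sum>N. emeasure (BF_space n) {\<omega> \<in> space (BF_space n). enat N < BF_T_con n \<omega>})"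
    unfolding BF_expected_T_con_def by (rule nn_integral_enat_function[OF BF_T_con_measurable])
  also have "\<dots> = (\<Sum>N. ennreal (BF_prob n N (\<lambda>E. \<not> graph_connected n E)))"
    by (simp add: not_le[symmetric] BF_T_con_le_iff BF_prob_def emeasure_eq_measure)
  also have "\<dots> = ennreal (\<Sum>N. BF_prob n N (\<lambda>E. \<not> graph_connected n E))"
    by (intro suminf_ennreal2 disconnected_probability_summable n) simp
  finally show ?thesis .
qed

section \<open>The limiting integral\<close>

lemma exp_minus_le_inverse: "y > 0 \<Longrightarrow> exp (- y) \<le> 1 / (y::real)"
proof -
  assume "y > 0"
  moreover have "y \<le> exp y" using exp_ge_add_one_self[of y] by linarith
  ultimately show ?thesis by (simp add: exp_minus inverse_eq_divide frac_le)
qed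

text \<open>Up to constants this is the dominating function of both limit exchanges; the rate 1/4 is
  what the tail bounds for the process provide.\<close>

lemma integrable_exp_minus_abs: "integrable lborel (\<lambda>x::real. exp (- \<bar>x\<bar> / 4))"
proof -
  define h where "h x = exp (- x / 4) * indicator {0..} x" for x :: real
  have "(\<integral>\<^sup>+x. ennreal (exp (- x / 4)) * indicator {0..} x \<partial>lborel) = ennreal (0 - (- 4 * exp (- 0 / 4)))"
  proof (rule nn_integral_FTC_atLeast)
    show "((\<lambda>x::real. - 4 * exp (- x / 4)) \<longlongrightarrow> 0) at_top" by real_asymp
  qed (auto intro!: derivative_eq_intros)
  moreover have "(\<integral>\<^sup>+x. ennreal (exp (- x / 4)) * indicator {0..} x \<partial>lborel) = (\<integral>\<^sup>+x. ennreal (h x) \<partial>lborel)"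
    by (intro nn_integral_cong) (auto simp: h_def indicator_def)
  moreover have "h \<in> borel_measurable borel" unfolding h_def by measurable
  ultimately have "has_bochner_integral lborel h 4"
    by (intro has_bochner_integral_nn_integral) (auto simp: h_def)
  then have h: "integrable lborel h" by (simp add: has_bochner_integral_iff)
  have "integrable lborel (\<lambda>x. h x + h (0 + (- 1) * x))"
    by (intro Bochner_Integration.integrable_add h lborel_integrable_real_affine) auto
  then show ?thesis
  proof (rule Bochner_Integration.integrable_bound)
    show "AE x in lborel. norm (exp (- \<bar>x\<bar> / 4)) \<le> norm (h x + h (0 + (- 1) * x))"
      by (intro AE_I2) (auto simp: h_def indicator_def abs_if)
  qed simp
qed

text \<open>The expected maximum of \<open>n\<close> independent standard exponential variables is \<open>harm n\<close>. Shifting by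
  \<open>ln n\<close> and letting \<open>n\<close> tend to infinity gives the mean \<open>euler_mascheroni\<close> of the Gumbel law.\<close>

definition max_exp_tail :: "nat \<Rightarrow> real \<Rightarrow> real" where
  "max_exp_tail n t = (1 - (1 - exp (- t)) ^ n) * indicator {0..} t"

text \<open>Raising \<open>n\<close> by one adds \<open>exp (- t) * (1 - exp (- t)) ^ n\<close> to
  the tail. This is the derivative of \<open>(1 - exp (- t)) ^ Suc n / Suc n\<close>, so its
  integral is the next harmonic term.\<close>

lemma max_exp_tail_integral: "has_bochner_integral lborel (max_exp_tail n) (harm n)"
proof (induction n)
  case 0
  have "max_exp_tail 0 = (\<lambda>t. 0)" by (auto simp: max_exp_tail_def)
  then show ?case by (simp add: harm_def has_bochner_integral_zero)
next
  case (Suc n)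
  define f where "f t = exp (- t) * (1 - exp (- t)) ^ n" for t :: real
  have f0: "f t \<ge> 0" if "t \<ge> 0" for t using that by (simp add: f_def)
  have fb: "f \<in> borel_measurable borel" unfolding f_def by measurable
  have "((\<lambda>t::real. exp (- t)) \<longlongrightarrow> 0) at_top" by real_asymp
  from tendsto_power[OF tendsto_diff[OF tendsto_const[of 1] this], of "Suc n"]
  have lim0: "((\<lambda>t::real. (1 - exp (- t)) ^ Suc n) \<longlongrightarrow> 1) at_top" by (simp only: diff_0_right power_one)
  have lim: "((\<lambda>t::real. (1 - exp (- t)) ^ Suc n / real (Suc n)) \<longlongrightarrow> 1 / real (Suc n)) at_top"
    by (intro tendsto_divide lim0 tendsto_const) simp
  have "(\<integral>\<^sup>+t. ennreal (f t) * indicator {0..} t \<partial>lborel) = ennreal (1 / real (Suc n) - (1 - exp (- 0)) ^ Suc n / real (Suc n))"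
  proof (rule nn_integral_FTC_atLeast[OF fb _ f0 lim])
    fix t :: real
    have "((\<lambda>t. 1 - exp (- t)) has_real_derivative exp (- t)) (at t)"
      by (auto intro!: derivative_eq_intros)
    from DERIV_cdivide[OF DERIV_power[OF this, of "Suc n"], of "real (Suc n)"]
    show "((\<lambda>t. (1 - exp (- t)) ^ Suc n / real (Suc n)) has_real_derivative f t) (at t)"
      by (simp add: f_def del: of_nat_Suc power_Suc)
  qed
  also have "(\<integral>\<^sup>+t. ennreal (f t) * indicator {0..} t \<partial>lborel) = (\<integral>\<^sup>+t. ennreal (f t * indicator {0..} t) \<partial>lborel)"
    by (intro nn_integral_cong) (auto simp: indicator_def)
  finally have "has_bochner_integral lborel (\<lambda>t. f t * indicator {0..} t) (1 / real (Suc n))"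
    using fb f0 by (intro has_bochner_integral_nn_integral) (auto simp: indicator_def)
  from has_bochner_integral_add[OF Suc this]
  have "has_bochner_integral lborel (\<lambda>t. max_exp_tail n t + f t * indicator {0..} t) (harm n + 1 / real (Suc n))" .
  moreover have "max_exp_tail n t + f t * indicator {0..} t = max_exp_tail (Suc n) t" for t
    by (simp add: max_exp_tail_def f_def algebra_simps)
  ultimately show ?case by (simp add: harm_Suc divide_inverse)
qed

text \<open>For a real random variable \<open>Y\<close>, the integral over \<open>c\<close> of
  \<open>P (Y > c) - of_bool (c < 0)\<close> is its mean. Here \<open>Y\<close> has the limit law of
  the theorem.\<close>

definition gumbel_tail :: "real \<Rightarrow> real" where
  "gumbel_tail c = 1 - exp (- (BF_K * exp (- c))) - of_bool (c < 0)"

lemma gumbel_tail_measurable [measurable]: "gumbel_tail \<in> borel_measurable borel"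
  unfolding gumbel_tail_def by measurable

lemma BF_K_le_1: "BF_K \<le> 1"
  using BF_gfun_le_1[of 1] by (simp add: BF_gfun_1)

text \<open>\<open>w n\<close> is the same expression for the maximum of \<open>n\<close>
  exponential variables shifted by \<open>a n\<close>, so its integral is
  \<open>harm n - ln n + ln BF_K\<close>. It converges pointwise since
  \<open>(1 - y / n) ^ n\<close> tends to \<open>exp (- y)\<close>. Domination uses Bernoulli's
  inequality for \<open>c \<ge> 0\<close> and \<open>exp (- y) \<le> 1 / y\<close> for
  \<open>c < 0\<close>.\<close>

lemma gumbel_tail_integral: "(\<integral>c. gumbel_tail c \<partial>lborel) = euler_mascheroni + ln BF_K"
proof -
  let ?K = BF_K
  have K: "0 < ?K" "?K \<le> 1" by (rule BF_K_pos BF_K_le_1)+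
  define a where "a n = ln ?K - ln (real n)" for n :: nat
  have a0: "a n \<le> 0" if "n \<ge> 1" for n using that K by (simp add: a_def ln_ge_zero_iff order_trans[of "ln ?K" 0])
  define w where "w n c = max_exp_tail n (- a n + 1 * c) - indicator {a n..<0} c" for n c
  have w_int: "has_bochner_integral lborel (w n) (harm n - (ln (real n) - ln ?K))" if "n \<ge> 1" for n
  proof -
    have "has_bochner_integral lborel (\<lambda>c. max_exp_tail n (- a n + 1 * c)) (harm n /\<^sub>R \<bar>1\<bar>)"
      using lborel_has_bochner_integral_real_affine_iff[of 1 "max_exp_tail n" "harm n" "- a n"] max_exp_tail_integral by simp
    moreover have "has_bochner_integral lborel (indicator {a n..<0}) (measure lborel {a n..<0})"
      using a0[OF that] by (intro has_bochner_integral_real_indicator) auto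
    moreover have "measure lborel {a n..<0} = ln (real n) - ln ?K" using a0[OF that] by (simp add: a_def)
    ultimately show ?thesis unfolding w_def by (auto intro!: has_bochner_integral_diff)
  qed
  define y where "y c = ?K * exp (- c)" for c
  have y: "y c > 0" for c using K by (simp add: y_def)
  have yn: "exp (- (- a n + 1 * c)) = y c / real n" if "n \<ge> 1" for n c
    using that K by (simp add: a_def y_def exp_diff exp_add exp_minus field_simps)
  have w_eq: "w n c = 1 - (1 - y c / real n) ^ n - of_bool (c < 0)" if "n \<ge> 1" "a n \<le> c" for n c
    using that(2) unfolding w_def max_exp_tail_def yn[OF that(1)] by (auto simp: indicator_def)
  have w_0: "w n c = 0" if "c < a n" for n c
    using that by (simp add: w_def max_exp_tail_def)
  have y_le: "y c \<le> real n" if "n \<ge> 1" "a n \<le> c" for n c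
  proof -
    have "exp (- (- a n + 1 * c)) \<le> 1" using that by simp
    then show ?thesis unfolding yn[OF that(1)] using that by (simp add: divide_le_eq)
  qed
  have "(\<lambda>i. \<integral>c. w (i + 1) c \<partial>lborel) \<longlonglongrightarrow> (\<integral>c. gumbel_tail c \<partial>lborel)"
  proof (rule integral_dominated_convergence[where w = "\<lambda>c. (1 + 1 / ?K) * exp (- \<bar>c\<bar> / 4)"])
    show "integrable lborel (\<lambda>c. (1 + 1 / ?K) * exp (- \<bar>c\<bar> / 4))"
      by (intro integrable_mult_right integrable_exp_minus_abs)
    show "w (i + 1) \<in> borel_measurable lborel" for i
      using w_int[of "i + 1"] by (auto simp: has_bochner_integral_iff)
    show "AE c in lborel. (\<lambda>i. w (i + 1) c) \<longlonglongrightarrow> gumbel_tail c"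
    proof (intro AE_I2)
      fix c
      have "(\<lambda>n. 1 - (1 + (- y c) / real n) ^ n - of_bool (c < 0)) \<longlonglongrightarrow> 1 - exp (- y c) - of_bool (c < 0)"
        by (intro tendsto_diff tendsto_const tendsto_exp_limit_sequentially)
      moreover have "\<forall>\<^sub>F n in sequentially. 1 - (1 + (- y c) / real n) ^ n - of_bool (c < 0) = w n c"
      proof -
        have "\<forall>\<^sub>F n in sequentially. ln ?K - ln (real n) \<le> c" by real_asymp
        then show ?thesis using eventually_ge_at_top[of 1]
          by eventually_elim (simp add: w_eq a_def)
      qed
      ultimately have "(\<lambda>n. w n c) \<longlonglongrightarrow> 1 - exp (- y c) - of_bool (c < 0)" by (rule Lim_transform_eventually)
      from LIMSEQ_ignore_initial_segment[OF this, of 1]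
      show "(\<lambda>i. w (i + 1) c) \<longlonglongrightarrow> gumbel_tail c" by (simp add: gumbel_tail_def y_def)
    qed
    show "AE c in lborel. norm (w (i + 1) c) \<le> (1 + 1 / ?K) * exp (- \<bar>c\<bar> / 4)" for i
    proof (intro AE_I2)
      fix c
      define n where "n = i + 1"
      have n: "n \<ge> 1" by (simp add: n_def)
      consider "c < a n" | "a n \<le> c" "c \<ge> 0" | "a n \<le> c" "c < 0" by linarith
      then have "\<bar>w n c\<bar> \<le> (1 + 1 / ?K) * exp (- \<bar>c\<bar> / 4)"
      proof cases
        case 1
        then show ?thesis using K by (simp add: w_0)
      next
        case 2
        have yn1: "y c / real n \<le> 1" using y_le[OF n 2(1)] n by (simp add: divide_le_eq)
        have "1 + real n * (- (y c / real n)) \<le> (1 + - (y c / real n)) ^ n"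
          using yn1 by (intro Bernoulli_inequality) auto
        then have "1 - (1 - y c / real n) ^ n \<le> y c" using n by simp
        moreover have "(1 - y c / real n) ^ n \<le> 1" using yn1 y[of c] by (intro power_le_one) auto
        moreover have "y c \<le> 1 * exp (- \<bar>c\<bar> / 4)"
          unfolding y_def using K 2 by (intro mult_mono) auto
        moreover have "0 \<le> 1 / ?K * exp (- \<bar>c\<bar> / 4)" using K by simp
        ultimately show ?thesis using w_eq[OF n 2(1)] 2 by (simp add: algebra_simps)
      next
        case 3
        have "(1 - y c / real n) ^ n \<le> exp (- y c)"
          using exp_ge_one_minus_x_over_n_power_n[of "y c" n] y_le[OF n 3(1)] n by simp
        also have "\<dots> \<le> 1 / y c" by (rule exp_minus_le_inverse[OF y])
        also have "\<dots> = 1 / ?K * exp c" by (simp add: y_def exp_minus field_simps)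
        also have "\<dots> \<le> 1 / ?K * exp (- \<bar>c\<bar> / 4)" using 3 K by (intro mult_left_mono) auto
        finally have "(1 - y c / real n) ^ n \<le> 1 / ?K * exp (- \<bar>c\<bar> / 4)" .
        moreover have "0 \<le> (1 - y c / real n) ^ n" using y_le[OF n 3(1)] n by (intro zero_le_power) (simp add: divide_le_eq)
        moreover have "0 \<le> exp (- \<bar>c\<bar> / 4)" by simp
        moreover have "w n c = - ((1 - y c / real n) ^ n)" using w_eq[OF n 3(1)] 3 by simp
        ultimately show ?thesis by (simp only: abs_minus_cancel abs_of_nonneg distrib_right mult_1 le_add_same_cancel1 add_increasing)
      qed
      then show "norm (w (i + 1) c) \<le> (1 + 1 / ?K) * exp (- \<bar>c\<bar> / 4)" by (simp add: n_def)
    qed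
  qed (simp_all add: gumbel_tail_measurable)
  moreover have "(\<lambda>i. \<integral>c. w (i + 1) c \<partial>lborel) \<longlonglongrightarrow> euler_mascheroni + ln ?K"
  proof -
    have "(\<integral>c. w (i + 1) c \<partial>lborel) = (harm (i + 1) - ln (real (i + 1))) + ln ?K" for i
      using w_int[of "i + 1"] by (simp add: has_bochner_integral_iff)
    moreover have "(\<lambda>i. (harm (i + 1) - ln (real (i + 1))) + ln ?K) \<longlonglongrightarrow> euler_mascheroni + ln ?K"
      by (intro tendsto_add tendsto_const LIMSEQ_ignore_initial_segment[OF euler_mascheroni_LIMSEQ])
    ultimately show ?thesis by simp
  qed
  ultimately show ?thesis by (rule LIMSEQ_unique)
qed

section \<open>The expected connectivity time\<close>

lemma floor_step_integral:
  fixes q :: "nat \<Rightarrow> real"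
  assumes q: "summable q" "\<And>N. q N \<ge> 0"
  shows "has_bochner_integral lborel (\<lambda>t::real. indicator {0..} t * q (nat \<lfloor>t\<rfloor>)) (\<Sum>N. q N)"
proof (rule has_bochner_integral_nn_integral)
  have step: "ennreal (indicator {0..} t * q (nat \<lfloor>t\<rfloor>)) = (\<Sum>N. ennreal (q N) * indicator {real N..<real N + 1} t)" for t :: real
  proof (cases "t \<ge> 0")
    case True
    have "t \<in> {real N..<real N + 1} \<longleftrightarrow> N = nat \<lfloor>t\<rfloor>" for N
    proof -
      have "t \<in> {real N..<real N + 1} \<longleftrightarrow> \<lfloor>t\<rfloor> = int N" by (simp add: floor_eq_iff)
      also have "\<dots> \<longleftrightarrow> N = nat \<lfloor>t\<rfloor>" using True by auto
      finally show ?thesis .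
    qed
    then have "(\<lambda>N. ennreal (q N) * indicator {real N..<real N + 1} t) = (\<lambda>N. if N = nat \<lfloor>t\<rfloor> then ennreal (q N) else 0)"
      by (auto simp: indicator_def fun_eq_iff)
    then show ?thesis using True sums_unique[OF sums_single[of "nat \<lfloor>t\<rfloor>" "\<lambda>N. ennreal (q N)"]] by simp
  qed (auto simp: indicator_def)
  have "(\<integral>\<^sup>+t. ennreal (indicator {0..} (t :: real) * q (nat \<lfloor>t\<rfloor>)) \<partial>lborel) =
     (\<integral>\<^sup>+t. (\<Sum>N. ennreal (q N) * indicator {real N..<real N + 1} t) \<partial>lborel)" by (intro nn_integral_cong step)
  also have "\<dots> = (\<Sum>N. \<integral>\<^sup>+t. ennreal (q N) * indicator {real N..<real N + 1} t \<partial>lborel)"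
    by (rule nn_integral_suminf) auto
  also have "\<dots> = (\<Sum>N. ennreal (q N))"
    by (simp add: nn_integral_cmult_indicator)
  also have "\<dots> = ennreal (\<Sum>N. q N)" by (intro suminf_ennreal2 q)
  finally show "(\<integral>\<^sup>+t. ennreal (indicator {0..} (t :: real) * q (nat \<lfloor>t\<rfloor>)) \<partial>lborel) = ennreal (\<Sum>N. q N)" .
qed (auto simp: q suminf_nonneg)

text \<open>The counterpart of \<open>gumbel_tail\<close> for \<open>(2 * T - n * ln n) / n\<close>,
  with \<open>T\<close> the connectivity time, so that its integral is a rescaled and centred
  expectation.\<close>

definition BF_tail :: "nat \<Rightarrow> real \<Rightarrow> real" where
  "BF_tail n c = BF_prob n (BF_time n c) (\<lambda>E. \<not> graph_connected n E) - of_bool (c < 0)"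

lemma BF_tail_measurable [measurable]: "BF_tail n \<in> borel_measurable borel"
proof -
  have "(\<lambda>c. nat \<lfloor>(real n * ln (real n) + c * real n) / 2\<rfloor>) \<in> borel \<rightarrow>\<^sub>M count_space UNIV" by measurable
  then have "(\<lambda>c. BF_prob n (BF_time n c) (\<lambda>E. \<not> graph_connected n E)) \<in> borel_measurable borel"
    unfolding BF_time_def by (rule measurable_compose) simp
  then show ?thesis unfolding BF_tail_def[abs_def] by measurable
qed

lemma disconnected_at_0: "n \<ge> 2 \<Longrightarrow> BF_prob n 0 (\<lambda>E. \<not> graph_connected n E) = 1"
proof -
  assume n: "n \<ge> 2"
  interpret prob_space "BF_space n" using n by (intro prob_space_BF) auto
  have "\<not> graph_connected n {}" using connected_imp_no_isolated[OF n, of "{}"] n by auto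
  then show ?thesis by (simp add: BF_prob_def prob_space)
qed

lemma BF_tail_integral:
  assumes n: "n \<ge> 2"
  shows "(\<integral>c. BF_tail n c \<partial>lborel) = 2 / real n * (\<Sum>N. BF_prob n N (\<lambda>E. \<not> graph_connected n E)) - ln (real n)"
proof -
  define q where "q N = BF_prob n N (\<lambda>E. \<not> graph_connected n E)" for N
  have n1: "n \<ge> 1" using n by simp
  define T where "T = real n * ln (real n) / 2"
  have T: "T \<ge> 0" using n by (simp add: T_def)
  define F where "F t = indicator {0..} t * q (nat \<lfloor>t\<rfloor>) - indicator {0..<T} t" for t
  have F: "has_bochner_integral lborel F ((\<Sum>N. q N) - T)"
  proof -
    have "has_bochner_integral lborel (indicator {0..<T}) (measure lborel {0..<T})"
      using T by (intro has_bochner_integral_real_indicator) auto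
    then have "has_bochner_integral lborel (indicator {0..<T}) T" using T by simp
    then show ?thesis unfolding F_def
      using disconnected_probability_summable[OF n1]
      by (intro has_bochner_integral_diff floor_step_integral) (auto simp: q_def)
  qed
  have eq: "BF_tail n c = F (T + real n / 2 * c)" for c
  proof -
    have t: "T + real n / 2 * c = (real n * ln (real n) + c * real n) / 2" by (simp add: T_def field_simps)
    have less: "T + real n / 2 * c < T \<longleftrightarrow> c < 0" using n by (simp add: mult_less_0_iff)
    show ?thesis
    proof (cases "T + real n / 2 * c \<ge> 0")
      case True
      then show ?thesis using less unfolding BF_tail_def F_def BF_time_def t[symmetric] q_def[symmetric] by (auto simp: indicator_def)
    next
      case False
      then have "c < 0" using T less by linarith
      \<comment> \<open>For negative times the graph at time 0 is used; it is disconnected with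
        probability 1, and this cancels the indicator of \<open>c < 0\<close>.\<close>
      moreover have "nat \<lfloor>T + real n / 2 * c\<rfloor> = 0" using False by simp
      ultimately show ?thesis using False disconnected_at_0[OF n]
        unfolding BF_tail_def F_def BF_time_def t[symmetric] by (auto simp: indicator_def)
    qed
  qed
  have "has_bochner_integral lborel (\<lambda>c. F (T + real n / 2 * c)) (((\<Sum>N. q N) - T) /\<^sub>R \<bar>real n / 2\<bar>)"
    using lborel_has_bochner_integral_real_affine_iff[of "real n / 2" F "(\<Sum>N. q N) - T" T] F n by simp
  then have "(\<integral>c. BF_tail n c \<partial>lborel) = ((\<Sum>N. q N) - T) /\<^sub>R \<bar>real n / 2\<bar>"
    unfolding eq by (simp add: has_bochner_integral_iff)
  also have "\<dots> = 2 / real n * (\<Sum>N. q N) - ln (real n)" using n by (simp add: T_def field_simps)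
  finally show ?thesis by (simp add: q_def)
qed

lemma BF_tail_limit: "(\<lambda>n. BF_tail n c) \<longlonglongrightarrow> gumbel_tail c"
proof (rule Lim_transform_eventually)
  show "(\<lambda>n. 1 - BF_prob n (BF_time n c) (graph_connected n) - of_bool (c < 0)) \<longlonglongrightarrow> gumbel_tail c"
    unfolding gumbel_tail_def by (intro tendsto_diff tendsto_const connected_limit)
  show "\<forall>\<^sub>F n in sequentially. 1 - BF_prob n (BF_time n c) (graph_connected n) - of_bool (c < 0) = BF_tail n c"
    using eventually_ge_at_top[of 1] by eventually_elim (simp add: BF_tail_def BF_prob_not)
qed

text \<open>Here \<open>c\<close> is unbounded for fixed \<open>n\<close>, so \<open>N\<close> may
  exceed \<open>n^2\<close> and the decay of \<open>cut_rate\<close> is estimated directly. The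
  correction \<open>2 * c / n\<close> eats up to half of the decay, as \<open>n \<ge> 4\<close>. In
  the bad part \<open>ln n + c\<close> is traded for \<open>4 * exp (c / 4)\<close>, which turns the
  rate 1/2 into 1/4.\<close>

lemma upper_tail_bound:
  assumes n: "n \<ge> 4" and c: "c \<ge> 0"
  shows "BF_prob n (BF_time n c) (\<lambda>E. \<not> graph_connected n E) \<le> (exp 4 + 4 * exp 1 * bad_const 1) * exp (- c / 4)"
proof -
  have n1: "n \<ge> 1" and n0: "real n > 0" using n by auto
  have ln0: "ln (real n) \<ge> 0" "ln (real n) \<le> real n"
    using n ln_le_minus_one[of "real n"] by auto
  define N where "N = BF_time n c"
  have N: "real N > real n * (ln (real n) + c) / 2 - 1"
    unfolding N_def using c ln0 by (intro BF_time_bounds) auto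
  have "BF_prob n N (\<lambda>E. \<not> graph_connected n E) \<le> BF_prob n N (\<lambda>E. iso_count n E \<noteq> 0 \<or> BF_bad n E)"
    using disconnected_imp_bad by (intro BF_prob_mono n1) blast
  also have "\<dots> \<le> BF_prob n N (\<lambda>E. iso_count n E \<noteq> 0) + BF_prob n N (BF_bad n)" by (rule BF_prob_disj_le[OF n1])
  also have "BF_prob n N (\<lambda>E. iso_count n E \<noteq> 0) \<le> exp 4 * exp (- c / 4)"
  proof -
    have "BF_prob n N (\<lambda>E. iso_count n E \<noteq> 0) \<le> (\<integral>\<omega>. real (iso_count n (BF_graph \<omega> N)) \<partial>BF_space n)"
      by (rule BF_prob_le_expectation[OF n1]) auto
    also have "\<dots> \<le> real n * (exp 1 * cut_rate n 1 ^ N)" by (rule expectation_iso_count[OF n1])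
    also have "cut_rate n 1 ^ N \<le> exp (3 - ln (real n) - c / 4)"
    proof -
      have "cut_rate n 1 \<le> exp (- (2 * (real n - 2) / real n ^ 2))"
        using exp_ge_add_one_self[of "- (2 * (real n - 2) / real n ^ 2)"] by (simp add: cut_rate_def)
      then have "cut_rate n 1 ^ N \<le> exp (- (2 * (real n - 2) / real n ^ 2)) ^ N"
        by (intro power_mono cut_rate_nonneg n1)
      also have "\<dots> = exp (- (real N * (2 * (real n - 2) / real n ^ 2)))" by (simp add: exp_of_nat_mult[symmetric])
      also have "- (real N * (2 * (real n - 2) / real n ^ 2)) \<le> 3 - ln (real n) - c / 4"
      proof -
        have "(real n * (ln (real n) + c) / 2 - 1) * (2 * (real n - 2) / real n ^ 2) \<le> real N * (2 * (real n - 2) / real n ^ 2)"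
          using N n by (intro mult_right_mono) auto
        also have "(real n * (ln (real n) + c) / 2 - 1) * (2 * (real n - 2) / real n ^ 2)
           = ln (real n) + c - 2 * (ln (real n) / real n) - 2 * (c / real n) - (2 / real n - 4 / real n ^ 2)"
          using n0 by (simp add: field_simps power2_eq_square)
        finally have 1: "ln (real n) + c - 2 * (ln (real n) / real n) - 2 * (c / real n) - (2 / real n - 4 / real n ^ 2)
           \<le> real N * (2 * (real n - 2) / real n ^ 2)" .
        have 2: "ln (real n) / real n \<le> 1" using ln0 n0 by (simp add: divide_le_eq)
        have 3: "c / real n \<le> c / 4" using n c by (intro divide_left_mono) auto
        have 4: "2 / real n \<le> 1 / 2" "0 \<le> 4 / real n ^ 2" using n by (auto simp: divide_le_eq)
        have "- X \<le> 3 - l - c / 4" if "l + c - 2 * u - 2 * v - (w - z) \<le> X" "u \<le> 1" "v \<le> c / 4" "w \<le> 1 / 2" "0 \<le> z"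
          for X l u v w z using that c by linarith
        from this[OF 1 2 3 4] show ?thesis .
      qed
      finally show ?thesis by simp
    qed
    also have "real n * (exp 1 * exp (3 - ln (real n) - c / 4)) = exp 4 * exp (- c / 4)"
    proof -
      have "exp 1 * exp (3 - ln (real n) - c / 4) = exp (4 + - c / 4 + - ln (real n))" by (simp add: exp_add[symmetric])
      also have "\<dots> = exp 4 * exp (- c / 4) / real n" using n0 by (simp only: exp_add exp_minus[of "ln (real n)"] exp_ln divide_inverse)
      finally show ?thesis using n0 by simp
    qed
    finally show ?thesis by (simp add: mult_left_mono)
  qed
  also have "BF_prob n N (BF_bad n) \<le> 4 * exp 1 * bad_const 1 * exp (- c / 4)"
  proof -
    have "BF_prob n N (BF_bad n) \<le> (ln (real n) + c) / real n * exp ((1 - c) / 2) * bad_const (0 + 1)"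
      unfolding N_def using n c ln0 by (intro bad_probability_time) auto
    also have "(ln (real n) + c) / real n \<le> 4 * exp (c / 4)"
    proof -
      have "ln (real n) / real n \<le> 1" using ln0 n0 by (simp add: divide_le_eq)
      moreover have "c / real n \<le> c" using n c by (simp add: divide_le_eq mult_le_cancel_left1)
      ultimately have "(ln (real n) + c) / real n \<le> 1 + c" by (simp add: add_divide_distrib)
      also have "\<dots> \<le> 4 * (1 + c / 4)" by simp
      also have "\<dots> \<le> 4 * exp (c / 4)" using exp_ge_add_one_self[of "c / 4"] by (intro mult_left_mono) auto
      finally show ?thesis .
    qed
    also have "4 * exp (c / 4) * exp ((1 - c) / 2) \<le> 4 * exp 1 * exp (- c / 4)"
      by (simp add: exp_add[symmetric] mult.assoc) (simp add: field_simps)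
    finally show ?thesis using bad_const_nonneg[of 1] by (simp add: mult_right_mono mult_ac)
  qed
  finally show ?thesis by (simp add: N_def algebra_simps)
qed

text \<open>A Chernoff-type bound: \<open>phase1_fun\<close> is 1 when no vertex is isolated, so its
  expectation bounds the probability for every \<open>t\<close>. A small \<open>t\<close> keeps the
  first-phase error under control without a second phase.\<close>

lemma lower_tail_bound:
  assumes n: "n \<ge> 4" and b: "0 \<le> b" "b \<le> ln (real n)"
  shows "BF_prob n (BF_time n (- b)) (\<lambda>E. iso_count n E = 0) \<le> (exp 4 / BF_K + 48 * exp 8) * exp (- b / 4)"
proof -
  have n1: "n \<ge> 1" "n \<ge> 2" and n0: "real n > 0" using n by auto
  have lnn: "ln (real n) \<le> real n" using ln_le_minus_one[of "real n"] n by auto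
  define M where "M = BF_time n (- b)"
  have nb: "ln (real n) + - b \<ge> 0" using b by simp
  have Mb: "real M \<le> real n * (ln (real n) - b) / 2" "real M > real n * (ln (real n) - b) / 2 - 1"
    using BF_time_bounds[OF nb] by (simp_all add: M_def)
  have "real M \<le> real n * (ln (real n) - b) / 2" by (rule Mb)
  also have "\<dots> \<le> real n * real n / 2" using lnn b by (intro divide_right_mono mult_left_mono) auto
  also have "\<dots> \<le> real n ^ 2" by (simp add: power2_eq_square)
  finally have M2: "real M \<le> real n ^ 2" .
  have Mn: "real M / real n \<le> ln (real n) / 2"
  proof -
    have "real M / real n \<le> (real n * (ln (real n) - b) / 2) / real n" using Mb by (intro divide_right_mono) auto
    also have "\<dots> = (ln (real n) - b) / 2" using n0 by simp
    finally show ?thesis using b by simp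
  qed
  \<comment> \<open>The mean of the exponent \<open>t * (number of isolated vertices)\<close> is of order \<open>t * exp b\<close> and its
    variance of order \<open>t\<^sup>2 * exp b\<close>, so \<open>t = exp (- a * b)\<close> works for every \<open>a\<close> in \<open>{1/2<..<1}\<close>.\<close>
  define t where "t = exp (- (3 / 4 * b))"
  have t: "0 \<le> t" "t \<le> 1" using b by (auto simp: t_def)
  let ?p = "1 - 2 / real n"
  \<comment> \<open>The loss \<open>exp (- 4)\<close> comes from the quadratic term of
    \<open>ln (1 - 2 / n)\<close>, in total \<open>8 * M / n^2\<close>, which is at most 4 because
    \<open>M / n \<le> ln n / 2 \<le> n / 2\<close>.\<close>
  have p1: "exp (- 4) * exp b \<le> ?p ^ M * real n"
  proof -
    have pp: "0 < ?p" using n by simp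
    have "- (2 / real n) - 2 * (2 / real n) ^ 2 \<le> ln ?p"
      using n by (intro ln_one_minus_pos_lower_bound) auto
    then have 1: "real M * (- (2 / real n) - 2 * (2 / real n) ^ 2) \<le> real M * ln ?p" by (intro mult_left_mono) auto
    have 2: "real M * (- (2 / real n) - 2 * (2 / real n) ^ 2) = - (2 * (real M / real n)) - 8 * (real M / real n) / real n"
      by (simp add: power2_eq_square algebra_simps)
    have 3: "2 * (real M / real n) \<le> ln (real n) - b" using Mb n0 by (simp add: field_simps)
    have 4: "8 * (real M / real n) / real n \<le> 4"
    proof -
      have "8 * (real M / real n) / real n \<le> 4 * real n / real n"
        using Mn lnn by (intro divide_right_mono) linarith+
      then show ?thesis using n0 by simp
    qed
    have "- 4 + b - l \<le> B" if "A \<le> B" "A = - u - v" "u \<le> l - b" "v \<le> 4" for A B u v l :: real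
      using that by linarith
    from this[OF 1 2 3 4] have "- 4 + b - ln (real n) \<le> real M * ln ?p" .
    then have "exp (- 4 + b - ln (real n)) \<le> exp (real M * ln ?p)" by simp
    also have "\<dots> = ?p ^ M" using pp by (simp add: exp_of_nat_mult)
    also have "exp (- 4 + b - ln (real n)) = exp (- 4) * exp b / real n"
      using n0 by (simp only: exp_diff exp_add exp_ln)
    finally show ?thesis using n0 by (simp add: divide_le_eq)
  qed
  have m: "exp (- (2 * real M / real n)) \<le> exp 1 * exp b / real n"
  proof -
    have "(real n * (ln (real n) - b) - 2) / real n \<le> 2 * real M / real n" using Mb by (intro divide_right_mono) auto
    also have "(real n * (ln (real n) - b) - 2) / real n = ln (real n) - b - 2 / real n" using n0 by (simp add: diff_divide_distrib)
    finally have "- (2 * real M / real n) \<le> 2 / real n + b - ln (real n)" by simp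
    moreover have "2 / real n \<le> 1" using n by simp
    ultimately have "- (2 * real M / real n) \<le> 1 + b - ln (real n)" by linarith
    then have "exp (- (2 * real M / real n)) \<le> exp (1 + b - ln (real n))" by simp
    also have "\<dots> = exp 1 * exp b / real n" using n0 by (simp only: exp_diff exp_add exp_ln)
    finally show ?thesis .
  qed
  have "BF_prob n M (\<lambda>E. iso_count n E = 0) \<le> (\<integral>\<omega>. phase1_fun n t (iso_count n (BF_graph \<omega> M)) \<partial>BF_space n)"
    by (rule BF_prob_le_expectation[OF n1(1), where f = "\<lambda>E. phase1_fun n t (iso_count n E)"])
      (simp add: phase1_fun_def BF_h_0)
  also have "\<dots> \<le> exp (- (t * ?p ^ M * (real n * BF_K))) +
      24 * exp 7 * exp (- (2 * real M / real n)) * (t ^ 2 * real n + t * (real M / real n))"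
    using phase1[OF n1(2) M2 t] by linarith
  also have "exp (- (t * ?p ^ M * (real n * BF_K))) \<le> exp 4 / BF_K * exp (- b / 4)"
  proof -
    have e: "t * (exp (- 4) * exp b) = exp (- 4) * exp (b / 4)" by (simp add: t_def exp_add[symmetric])
    have "t * (exp (- 4) * exp b) * BF_K \<le> t * (?p ^ M * real n) * BF_K"
      using p1 t BF_K_pos by (intro mult_right_mono mult_left_mono) auto
    then have "exp (- (t * ?p ^ M * (real n * BF_K))) \<le> exp (- (exp (- 4) * exp (b / 4) * BF_K))"
      unfolding e by (simp add: mult_ac)
    also have "\<dots> \<le> 1 / (exp (- 4) * exp (b / 4) * BF_K)" using BF_K_pos by (intro exp_minus_le_inverse) auto
    also have "\<dots> = exp 4 / BF_K * exp (- b / 4)" by (simp add: exp_minus field_simps)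
    finally show ?thesis .
  qed
  also have "24 * exp 7 * exp (- (2 * real M / real n)) * (t ^ 2 * real n + t * (real M / real n)) \<le>
     24 * exp 7 * (exp 1 * (2 * exp (- b / 4)))"
  proof -
    have "exp (- (2 * real M / real n)) * (t ^ 2 * real n + t * (real M / real n)) \<le>
       exp 1 * exp b / real n * (t ^ 2 * real n + t * (ln (real n) / 2))"
      using m t Mn n0 by (intro mult_mono add_mono mult_left_mono) auto
    also have "\<dots> = exp 1 * ((exp b * t ^ 2) + (exp b * t) * (ln (real n) / (2 * real n)))"
      using n0 by (simp add: field_simps)
    also have "exp b * t ^ 2 = exp (- b / 2)" by (simp add: t_def exp_double[symmetric] exp_add[symmetric])
    also have "exp b * t = exp (b / 4)" by (simp add: t_def exp_add[symmetric])
    \<comment> \<open>This is where \<open>b \<le> ln n\<close> enters: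
      \<open>ln n / (2 * n)\<close> is at most \<open>1 / sqrt n\<close>, which is at most
      \<open>exp (- b / 2)\<close>.\<close>
    also have "ln (real n) / (2 * real n) \<le> exp (- b / 2)"
    proof -
      have "ln (sqrt (real n)) \<le> sqrt (real n)" using ln_le_minus_one[of "sqrt (real n)"] n0 by simp
      then have "ln (real n) \<le> 2 * sqrt (real n)" using n0 by (simp add: ln_sqrt)
      then have "ln (real n) / (2 * real n) \<le> sqrt (real n) / real n" using n0 by (simp add: divide_le_eq)
      also have "\<dots> = exp (- (ln (real n) / 2))"
      proof -
        have "sqrt (real n) = exp (ln (real n) / 2)" using n0 by (simp add: powr_half_sqrt[symmetric] powr_def)
        moreover have "real n = exp (ln (real n))" using n0 by simp
        ultimately have "sqrt (real n) / real n = exp (ln (real n) / 2 - ln (real n))" by (simp only: exp_diff)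
        then show ?thesis by simp
      qed
      also have "\<dots> \<le> exp (- b / 2)" using b by simp
      finally show ?thesis .
    qed
    also have "exp (b / 4) * exp (- b / 2) = exp (- b / 4)" by (simp add: exp_add[symmetric])
    also have "exp (- b / 2) \<le> exp (- b / 4)" using b by simp
    finally have "exp (- (2 * real M / real n)) * (t ^ 2 * real n + t * (real M / real n)) \<le> exp 1 * (2 * exp (- b / 4))"
      by simp
    then show ?thesis by (simp add: mult.assoc)
  qed
  also have "24 * exp 7 * (exp 1 * (2 * exp (- b / 4))) = 48 * exp 8 * exp (- b / 4)"
  proof -
    have "exp (8::real) = exp 7 * exp 1" by (simp add: exp_add[symmetric])
    then show ?thesis by simp
  qed
  finally show ?thesis by (simp add: M_def algebra_simps)
qed

lemma BF_tail_bound: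
  assumes n: "n \<ge> 4"
  shows "\<bar>BF_tail n c\<bar> \<le> (exp 4 + 4 * exp 1 * bad_const 1 + (exp 4 / BF_K + 48 * exp 8)) * exp (- \<bar>c\<bar> / 4)"
proof -
  have n1: "n \<ge> 1" "n \<ge> 2" using n by auto
  let ?A = "exp 4 + 4 * exp 1 * bad_const 1" and ?B = "exp 4 / BF_K + 48 * exp (8::real)"
  have A: "0 \<le> ?A" using bad_const_nonneg[of 1] by simp
  have B: "0 \<le> ?B" using BF_K_pos by (simp add: add_nonneg_nonneg)
  consider "c \<ge> 0" | "c < 0" "- c \<le> ln (real n)" | "c < 0" "- c > ln (real n)" by linarith
  then show ?thesis
  proof cases
    case 1
    have "\<bar>BF_tail n c\<bar> \<le> ?A * exp (- \<bar>c\<bar> / 4)" using upper_tail_bound[OF n 1] 1 by (simp add: BF_tail_def)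
    also have "\<dots> \<le> (?A + ?B) * exp (- \<bar>c\<bar> / 4)" using B by (intro mult_right_mono) auto
    finally show ?thesis .
  next
    case 2
    have "BF_tail n c = - BF_prob n (BF_time n c) (graph_connected n)"
      using 2 BF_prob_not[OF n1(1), of "BF_time n c" "graph_connected n"] by (simp add: BF_tail_def)
    then have "\<bar>BF_tail n c\<bar> \<le> BF_prob n (BF_time n c) (\<lambda>E. iso_count n E = 0)"
      using connected_probability_bounds(1)[OF n1(2)] by simp
    also have "\<dots> \<le> ?B * exp (- \<bar>c\<bar> / 4)" using lower_tail_bound[OF n, of "- c"] 2 by simp
    also have "\<dots> \<le> (?A + ?B) * exp (- \<bar>c\<bar> / 4)" using A by (intro mult_right_mono) auto
    finally show ?thesis .
  next
    case 3
    have "real n * (ln (real n) + c) \<le> 0" using 3 by (intro mult_nonneg_nonpos) auto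
    then have "BF_time n c = 0" unfolding BF_time_def by (simp add: algebra_simps)
    then have "BF_tail n c = 0" using 3 disconnected_at_0[OF n1(2)] by (simp add: BF_tail_def)
    then show ?thesis using A B by simp
  qed
qed

lemma expected_T_con_limit:
  "(\<lambda>n. 2 / real n * enn2real (BF_expected_T_con n) - ln (real n)) \<longlonglongrightarrow> euler_mascheroni + ln BF_K"
proof -
  have "(\<lambda>i. \<integral>c. BF_tail (i + 4) c \<partial>lborel) \<longlonglongrightarrow> (\<integral>c. gumbel_tail c \<partial>lborel)"
  proof (rule integral_dominated_convergence[where w = "\<lambda>c. (exp 4 + 4 * exp 1 * bad_const 1 + (exp 4 / BF_K + 48 * exp 8)) * exp (- \<bar>c\<bar> / 4)"])
    show "AE c in lborel. (\<lambda>i. BF_tail (i + 4) c) \<longlonglongrightarrow> gumbel_tail c"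
      by (intro AE_I2 LIMSEQ_ignore_initial_segment BF_tail_limit)
    show "AE c in lborel. norm (BF_tail (i + 4) c) \<le> (exp 4 + 4 * exp 1 * bad_const 1 + (exp 4 / BF_K + 48 * exp 8)) * exp (- \<bar>c\<bar> / 4)" for i
      unfolding real_norm_def by (intro AE_I2 BF_tail_bound) simp
    show "integrable lborel (\<lambda>c. (exp 4 + 4 * exp 1 * bad_const 1 + (exp 4 / BF_K + 48 * exp 8)) * exp (- \<bar>c\<bar> / 4))"
      by (intro integrable_mult_right integrable_exp_minus_abs)
  qed (simp_all add: gumbel_tail_measurable BF_tail_measurable)
  then have "(\<lambda>n. \<integral>c. BF_tail n c \<partial>lborel) \<longlonglongrightarrow> euler_mascheroni + ln BF_K"
    unfolding gumbel_tail_integral by (rule LIMSEQ_offset)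
  moreover have "\<forall>\<^sub>F n in sequentially. (\<integral>c. BF_tail n c \<partial>lborel) = 2 / real n * enn2real (BF_expected_T_con n) - ln (real n)"
    using eventually_ge_at_top[of 2]
  proof eventually_elim
    case (elim n)
    then have n1: "n \<ge> 1" by simp
    have "(\<Sum>N. BF_prob n N (\<lambda>E. \<not> graph_connected n E)) \<ge> 0"
      by (intro suminf_nonneg disconnected_probability_summable n1) simp
    then show ?case using BF_tail_integral[OF elim] BF_expected_T_con_eq[OF n1] by simp
  qed
  ultimately show ?thesis by (rule Lim_transform_eventually)
qed

theorem mainTheorem4:
  shows "(\<forall>n\<ge>1. BF_expected_T_con n < \<infinity>) \<and>
    (\<lambda>n. enn2real (BF_expected_T_con n)
           - (real n * ln (real n) / 2
              + (euler_mascheroni / 2 - ln golden_ratio / sqrt 5) * real n))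
      \<in> o(\<lambda>n. real n) \<and>
    (\<forall>c::real.
      (\<lambda>n. measure (BF_space n)
             {\<omega> \<in> space (BF_space n).
                ereal_of_enat (BF_T_con n \<omega>) \<le> ereal ((real n * ln (real n) + c * real n) / 2)})
        \<longlonglongrightarrow> exp (- (golden_ratio powr (- 2 / sqrt 5) * exp (- c)))) \<and>
    (\<lambda>n. measure (BF_space n)
           {\<omega> \<in> space (BF_space n). BF_T_con n \<omega> = BF_T_iso n \<omega>})
      \<longlonglongrightarrow> 1"
proof (intro conjI allI impI)
  show "BF_expected_T_con n < \<infinity>" if "n \<ge> 1" for n
    using BF_expected_T_con_eq[OF that] by simp
  show "(\<lambda>n. enn2real (BF_expected_T_con n)
           - (real n * ln (real n) / 2
              + (euler_mascheroni / 2 - ln golden_ratio / sqrt 5) * real n))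
      \<in> o(\<lambda>n. real n)"
  proof (rule smalloI_tendsto)
    have lnK: "ln BF_K = - (2 * ln golden_ratio / sqrt 5)"
      using golden_ratio_bounds by (simp add: BF_K_def ln_powr)
    have "(\<lambda>n. ((2 / real n * enn2real (BF_expected_T_con n) - ln (real n)) - (euler_mascheroni + ln BF_K)) / 2) \<longlonglongrightarrow> 0"
      using tendsto_divide[OF tendsto_diff[OF expected_T_con_limit tendsto_const[of "euler_mascheroni + ln BF_K"]] tendsto_const[of 2]] by simp
    moreover have "\<forall>\<^sub>F n in sequentially. ((2 / real n * enn2real (BF_expected_T_con n) - ln (real n)) - (euler_mascheroni + ln BF_K)) / 2
       = (enn2real (BF_expected_T_con n) - (real n * ln (real n) / 2 + (euler_mascheroni / 2 - ln golden_ratio / sqrt 5) * real n)) / real n"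
      using eventually_gt_at_top[of 0] by eventually_elim (simp add: lnK field_simps)
    ultimately show "(\<lambda>n. (enn2real (BF_expected_T_con n) - (real n * ln (real n) / 2 + (euler_mascheroni / 2 - ln golden_ratio / sqrt 5) * real n)) / real n) \<longlonglongrightarrow> 0"
      by (rule Lim_transform_eventually)
    show "\<forall>\<^sub>F n in sequentially. real n \<noteq> 0" using eventually_gt_at_top[of 0] by eventually_elim simp
  qed
  show "(\<lambda>n. measure (BF_space n) {\<omega> \<in> space (BF_space n).
      ereal_of_enat (BF_T_con n \<omega>) \<le> ereal ((real n * ln (real n) + c * real n) / 2)})
    \<longlonglongrightarrow> exp (- (golden_ratio powr (- 2 / sqrt 5) * exp (- c)))" for c
    using T_con_limit[of c] by (simp only: BF_K_def)
qed (rule T_con_eq_T_iso_limit)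

end
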